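(* Every ternary form $F\in\mathbb{R}[X,Y,Z]$ that is hyperbolic with respect to $e\in\mathbb{R}^3$ admits a linear determinantal representation that is definite at $e$.
   Context: A form is a homogeneous polynomial; a ternary form here is a form $F\in\mathbb{R}[X,Y,Z]$, and $d$ denotes its degree. The form $F$ is called hyperbolic with respect to some direction $e\in\mathbb{R}^3$ if $F(e)>0$ and for all $a\in\mathbb{R}^3$ the univariate polynomial $F(Te-a)\in\mathbb{R}[T]$ has only real roots. A linear determinantal representation of $F$ is a matrix of the form $XA+YB+ZC$, where $A,B,C\in\mathbb{R}^{d\times d}$ are such that $F=\det(XA+YB+ZC)$. The representation is called definite at $e=(x,y,z)$ if the matrix $xA+yB+zC$ is definite, in particular symmetric. *)

theory Defs
  imports
    "HOL-Analysis.Analysis"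
    "HOL-Library.Poly_Mapping"
    "Jordan_Normal_Form.Determinant"
begin

text \<open>Elements of the polynomial ring R[X,Y,Z]: finitely supported maps from exponent vectors to
  coefficients, with the convolution product of the library. The variables X, Y, Z are indexed by
  1, 2, 3 in the three-element type (so 3 = 0 there), matching the coordinates of \<open>real^3\<close>.\<close>

type_synonym ternary_poly = "(3 \<Rightarrow>\<^sub>0 nat) \<Rightarrow>\<^sub>0 real"

definition PConst :: "real \<Rightarrow> ternary_poly" where
  "PConst c = Poly_Mapping.single 0 c"

definition PVar :: "3 \<Rightarrow> ternary_poly" where
  "PVar i = Poly_Mapping.single (Poly_Mapping.single i 1) 1"

definition ternary_form :: "nat \<Rightarrow> ternary_poly \<Rightarrow> bool" where
  "ternary_form d F \<longleftrightarrow>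
     (\<forall>m \<in> Poly_Mapping.keys F. (\<Sum>i\<in>UNIV. Poly_Mapping.lookup m i) = d)"

text \<open>Substitution of \<open>x i\<close> for the i-th variable, with coefficients sent to the target ring
  by \<open>c\<close>.\<close>

definition psubst :: "(real \<Rightarrow> 'a) \<Rightarrow> (3 \<Rightarrow> 'a) \<Rightarrow> ternary_poly \<Rightarrow> 'a::comm_semiring_1" where
  "psubst c x F =
     (\<Sum>m \<in> Poly_Mapping.keys F.
        c (Poly_Mapping.lookup F m) * (\<Prod>i\<in>UNIV. x i ^ Poly_Mapping.lookup m i))"

definition peval :: "ternary_poly \<Rightarrow> real^3 \<Rightarrow> real" where
  "peval F v = psubst (\<lambda>c. c) (vec_nth v) F"

text \<open>The univariate polynomial F(T e - a).\<close>

definition line_restriction :: "ternary_poly \<Rightarrow> real^3 \<Rightarrow> real^3 \<Rightarrow> real poly" where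
  "line_restriction F e a =
     psubst (\<lambda>c. [:c:]) (\<lambda>i. [:- vec_nth a i, vec_nth e i:]) F"

definition only_real_roots :: "real poly \<Rightarrow> bool" where
  "only_real_roots p \<longleftrightarrow> (\<forall>z::complex. poly (map_poly of_real p) z = 0 \<longrightarrow> z \<in> \<real>)"

definition hyperbolic :: "ternary_poly \<Rightarrow> real^3 \<Rightarrow> bool" where
  "hyperbolic F e \<longleftrightarrow> peval F e > 0 \<and> (\<forall>a. only_real_roots (line_restriction F e a))"

definition pencil :: "real mat \<Rightarrow> real mat \<Rightarrow> real mat \<Rightarrow> ternary_poly mat" where
  "pencil A B C =
     PVar 1 \<cdot>\<^sub>m map_mat PConst A + PVar 2 \<cdot>\<^sub>m map_mat PConst B + PVar 3 \<cdot>\<^sub>m map_mat PConst C"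

definition pencil_at :: "real mat \<Rightarrow> real mat \<Rightarrow> real mat \<Rightarrow> real^3 \<Rightarrow> real mat" where
  "pencil_at A B C v =
     vec_nth v 1 \<cdot>\<^sub>m A + vec_nth v 2 \<cdot>\<^sub>m B + vec_nth v 3 \<cdot>\<^sub>m C"

definition det_representation ::
    "nat \<Rightarrow> ternary_poly \<Rightarrow> real mat \<Rightarrow> real mat \<Rightarrow> real mat \<Rightarrow> bool" where
  "det_representation d F A B C \<longleftrightarrow>
     A \<in> carrier_mat d d \<and> B \<in> carrier_mat d d \<and> C \<in> carrier_mat d d \<and>
     F = Determinant.det (pencil A B C)"

definition sym_mat :: "real mat \<Rightarrow> bool" where
  "sym_mat M \<longleftrightarrow> transpose_mat M = M"

definition pos_definite :: "real mat \<Rightarrow> bool" where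
  "pos_definite M \<longleftrightarrow> sym_mat M \<and>
     (\<forall>v \<in> carrier_vec (dim_row M). v \<noteq> 0\<^sub>v (dim_row M) \<longrightarrow> scalar_prod v (M *\<^sub>v v) > 0)"

definition neg_definite :: "real mat \<Rightarrow> bool" where
  "neg_definite M \<longleftrightarrow> sym_mat M \<and>
     (\<forall>v \<in> carrier_vec (dim_row M). v \<noteq> 0\<^sub>v (dim_row M) \<longrightarrow> scalar_prod v (M *\<^sub>v v) < 0)"

text \<open>A definite representation is a symmetric one: all three coefficient matrices are required
  to be symmetric, not only their combination at \<open>e\<close>. Without this, definiteness at \<open>e\<close> would not
  force the represented form to be hyperbolic. Either sign of definiteness is allowed.\<close>

definition definite_at :: "real mat \<Rightarrow> real mat \<Rightarrow> real mat \<Rightarrow> real^3 \<Rightarrow> bool" where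
  "definite_at A B C e \<longleftrightarrow>
     sym_mat A \<and> sym_mat B \<and> sym_mat C \<and>
     (pos_definite (pencil_at A B C e) \<or> neg_definite (pencil_at A B C e))"

end

(* A continuity argument. After a linear change of coordinates F is monic in X and e = (1,0,0).
   Consider the real forms det (X I + Y D + Z C) with D symmetric and C diagonal. Newton's
   identities bound D and C by the coefficients of the form, so these forms are a closed set. At a
   form whose complex curve is smooth the set is also open among the monic forms: the cofactors of
   the pencil x I + D + z C then generate all polynomials of degree < d in x over R[z], and
   subtracting commutators with D + z C lowers the degree in z until D varies by a constant
   symmetric and C by a constant diagonal matrix; so the determinant map is a submersion there.
   Nuij's operators f + s Y f_X and f + s Z f_X deform any hyperbolic form, through forms whose
   roots over real (Y,Z) are simple, to one and the same form. For generic small perturbations of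
   such a path the remaining singular points, which are non-real, are avoided: they depend on five
   real parameters, while a perturbation has six. Starting from a pencil built from a path graph,
   the property is carried along such paths to every hyperbolic form. *)

theory Submission
  imports Defs "Jordan_Normal_Form.Char_Poly"
begin

text \<open>The obstacle is that two notions of regularity do not match: the determinant map is
  known to be a submersion only where the cofactors of the complex pencil have no common zero, while
  Nuij's operators control the roots over real (Y,Z) only. Generic perturbations bridge this gap;
  one fixed small form is added along a whole path. The common end of the paths comes from the
  contraction F(X, tY, tZ), which at t = 0 forgets F and leaves X^d. Since X^d has multiple roots
  everywhere, a path consists of Nuij images of contracted forms rather than of the contracted forms
  themselves. The pencil of the path graph is chosen because one of its cofactors vanishes nowhere,
  so a whole neighbourhood of its form is representable, whatever the singularities of the curve.
  Its small Nuij deformations lie in this neighbourhood and serve as actual starting points. The six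
  parameters answer the three complex conditions of a singular point at given (x, z): value,
  x-derivative and z-derivative. Prescribing them at a conjugate pair by real polynomials takes a
  cubic in z, so degrees one and two are treated separately.\<close>

hide_const (open) Module.smult

subsection \<open>Determinants and cofactors of matrices given as functions\<close>

text \<open>Matrices are plain functions, so that ring homomorphisms, limits and derivatives act
  entrywise without carrier conditions. Only entries with indices below \<open>n\<close> count
  (\<open>Det_cong\<close>).\<close>

definition Det :: "nat \<Rightarrow> (nat \<Rightarrow> nat \<Rightarrow> 'a::comm_ring_1) \<Rightarrow> 'a" where
  "Det n A = Determinant.det (Matrix.mat n n (\<lambda>(i,j). A i j))"

definition Cof :: "nat \<Rightarrow> (nat \<Rightarrow> nat \<Rightarrow> 'a::comm_ring_1) \<Rightarrow> nat \<Rightarrow> nat \<Rightarrow> 'a" where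
  "Cof n A i j = (-1) ^ (i + j) * Det (n - 1) (\<lambda>k l. A (insert_index i k) (insert_index j l))"

lemma Det_alt: "Det n A = (\<Sum>p | p permutes {0..<n}. of_int (sign p) * (\<Prod>i = 0..<n. A i (p i)))"
proof -
  have "(\<Prod>i = 0..<n. Matrix.mat n n (\<lambda>(i, j). A i j) $$ (i, p i)) = (\<Prod>i = 0..<n. A i (p i))"
    if "p permutes {0..<n}" for p
    using permutes_in_image[OF that] by (intro prod.cong) auto
  then show ?thesis
    unfolding Det_def by (subst det_def'[of _ n]) (auto intro!: sum.cong)
qed

lemma Det_cong:
  assumes "\<And>i j. i < n \<Longrightarrow> j < n \<Longrightarrow> A i j = B i j"
  shows "Det n A = Det n B"
  unfolding Det_def by (intro arg_cong[of _ _ Determinant.det] eq_matI) (auto simp: assms)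

lemma insert_index_less: "k < n - 1 \<Longrightarrow> insert_index i k < n"
  by (auto simp: insert_index_def)

lemma Cof_cong:
  assumes "\<And>i j. i < n \<Longrightarrow> j < n \<Longrightarrow> A i j = B i j"
  shows "Cof n A i j = Cof n B i j"
  unfolding Cof_def by (intro arg_cong2[of _ _ _ _ "(*)"] refl Det_cong assms insert_index_less)

lemma cofactor_mat:
  assumes "i < n" "j < n"
  shows "cofactor (Matrix.mat n n (\<lambda>(i,j). A i j)) i j = Cof n A i j"
  unfolding cofactor_def Cof_def Det_def
  by (intro arg_cong2[of _ _ _ _ "(*)"] refl arg_cong[of _ _ Determinant.det] eq_matI)
     (auto simp: mat_delete_def insert_index_def)

lemma Det_transpose: "Det n (\<lambda>i j. A j i) = Det n A"
proof -
  have "transpose_mat (Matrix.mat n n (\<lambda>(i,j). A i j)) = Matrix.mat n n (\<lambda>(i,j). A j i)"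
    by (auto simp: transpose_mat_def)
  then show ?thesis
    unfolding Det_def using det_transpose[of "Matrix.mat n n (\<lambda>(i,j). A i j)" n] by simp
qed

lemma Cof_transpose: "Cof n (\<lambda>i j. A j i) i j = Cof n A j i"
  unfolding Cof_def
  by (simp add: add.commute Det_transpose[of _ "\<lambda>k l. A (insert_index j k) (insert_index i l)"])

lemma Cof_rows:
  assumes "i < n" "k < n"
  shows "(\<Sum>l<n. A i l * Cof n A k l) = (if i = k then Det n A else 0)"
proof -
  let ?A = "Matrix.mat n n (\<lambda>(i,j). A i j)"
  have "(?A * adj_mat ?A) $$ (i, k) = (\<Sum>l<n. A i l * Cof n A k l)"
    using assms by (auto simp: adj_mat_def scalar_prod_def cofactor_mat lessThan_atLeast0 intro!: sum.cong)
  moreover have "(?A * adj_mat ?A) $$ (i, k) = (Determinant.det ?A \<cdot>\<^sub>m 1\<^sub>m n) $$ (i, k)"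
    by (subst adj_mat(2)[of _ n]) auto
  ultimately show ?thesis using assms by (auto simp: Det_def)
qed

lemma Cof_cols:
  assumes "i < n" "k < n"
  shows "(\<Sum>l<n. A l i * Cof n A l k) = (if i = k then Det n A else 0)"
  using Cof_rows[OF assms, of "\<lambda>i j. A j i"] 
  unfolding Cof_transpose[of n A] Det_transpose[of n A] .

lemma (in comm_ring_hom) hom_Det: "hom (Det n A) = Det n (\<lambda>i j. hom (A i j))"
proof -
  have "map_mat hom (Matrix.mat n n (\<lambda>(i,j). A i j)) = Matrix.mat n n (\<lambda>(i,j). hom (A i j))"
    by auto
  then show ?thesis unfolding Det_def by (simp flip: hom_det)
qed

lemma (in comm_ring_hom) hom_Cof: "hom (Cof n A i j) = Cof n (\<lambda>i j. hom (A i j)) i j"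
  unfolding Cof_def by (simp add: hom_Det hom_distribs)

lemma Det_smult: "Det n (\<lambda>i j. c * A i j) = c ^ n * Det n A"
  by (simp add: Det_alt prod.distrib sum_distrib_left algebra_simps)

lemma Det_upper_triangular:
  assumes "\<And>i j. j < i \<Longrightarrow> i < n \<Longrightarrow> A i j = 0"
  shows "Det n A = (\<Prod>i<n. A i i)"
proof -
  let ?A = "Matrix.mat n n (\<lambda>(i,j). A i j)"
  have "Determinant.det ?A = prod_list (diag_mat ?A)"
    by (rule det_upper_triangular[of _ n]) (auto simp: assms upper_triangular_def)
  also have "\<dots> = (\<Prod>i = 0..<n. ?A $$ (i, i))"
    by (simp add: prod_list_diag_prod)
  finally show ?thesis unfolding Det_def by (auto simp: lessThan_atLeast0 intro!: prod.cong)
qed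

lemma tendsto_Det:
  fixes A :: "'b \<Rightarrow> nat \<Rightarrow> nat \<Rightarrow> 'a::{comm_ring_1,real_normed_algebra_1}"
  assumes "\<And>i j. ((\<lambda>t. A t i j) \<longlongrightarrow> B i j) F"
  shows "((\<lambda>t. Det n (A t)) \<longlongrightarrow> Det n B) F"
  unfolding Det_alt by (intro tendsto_intros assms tendsto_prod)

lemma tendsto_Cof:
  fixes A :: "'b \<Rightarrow> nat \<Rightarrow> nat \<Rightarrow> 'a::{comm_ring_1,real_normed_algebra_1}"
  assumes "\<And>i j. ((\<lambda>t. A t i j) \<longlongrightarrow> B i j) F"
  shows "((\<lambda>t. Cof n (A t) i j) \<longlongrightarrow> Cof n B i j) F"
  unfolding Cof_def by (intro tendsto_intros tendsto_Det assms)

text \<open>Jacobi's formula in algebraic form: the left side is the derivative of the Leibniz sum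
  at \<open>A\<close> in the direction \<open>B\<close>. For fixed \<open>i\<close> the inner sum is
  the determinant of \<open>A\<close> with row \<open>i\<close> replaced by that of
  \<open>B\<close>; the cofactors along row \<open>i\<close> do not see the replacement.\<close>

lemma sum_sign_replace_row:
  fixes A B :: "nat \<Rightarrow> nat \<Rightarrow> 'a::comm_ring_1"
  shows "(\<Sum>p | p permutes {0..<n}. of_int (sign p) * (\<Sum>i\<in>{0..<n}. B i (p i) * (\<Prod>k\<in>{0..<n}-{i}. A k (p k))))
    = (\<Sum>i<n. \<Sum>j<n. B i j * Cof n A i j)"
proof -
  have "(\<Sum>p | p permutes {0..<n}. of_int (sign p) * (B i (p i) * (\<Prod>k\<in>{0..<n}-{i}. A k (p k))))
     = (\<Sum>j<n. B i j * Cof n A i j)" if i: "i < n" for i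
  proof -
    let ?R = "\<lambda>k j. if k = i then B i j else A k j"
    have "(\<Prod>k = 0..<n. ?R k (p k)) = B i (p i) * (\<Prod>k\<in>{0..<n}-{i}. A k (p k))" for p
      using i by (subst prod.remove[of _ i]) (auto intro!: prod.cong)
    then have "(\<Sum>p | p permutes {0..<n}. of_int (sign p) * (B i (p i) * (\<Prod>k\<in>{0..<n}-{i}. A k (p k)))) = Det n ?R"
      by (simp add: Det_alt)
    also have "\<dots> = (\<Sum>j<n. ?R i j * Cof n ?R i j)"
      using Cof_rows[OF i i, of ?R] by simp
    also have "\<dots> = (\<Sum>j<n. B i j * Cof n A i j)"
      unfolding Cof_def by (auto intro!: sum.cong arg_cong2[of _ _ _ _ "(*)"] Det_cong simp: insert_index_def)
    finally show ?thesis .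
  qed
  then show ?thesis
    unfolding sum_distrib_left lessThan_atLeast0
    by (subst sum.swap) (auto intro!: sum.cong)
qed

text \<open>An abstract product rule, to differentiate determinants once and for all: it is instantiated with
  strict differentiability, complex differentiability and formal derivatives.\<close>

locale derivation_rule =
  fixes SD :: "('w \<Rightarrow> 'r::comm_ring_1) \<Rightarrow> ('w \<Rightarrow> 'r) \<Rightarrow> bool" and w0 :: 'w
  assumes of_int: "SD (\<lambda>_. of_int c) (\<lambda>_. 0)"
    and add: "SD f f' \<Longrightarrow> SD g g' \<Longrightarrow> SD (\<lambda>w. f w + g w) (\<lambda>w. f' w + g' w)"
    and mult: "SD f f' \<Longrightarrow> SD g g' \<Longrightarrow> SD (\<lambda>w. f w * g w) (\<lambda>w. f' w * g w0 + f w0 * g' w)"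
begin

lemma sum:
  "(\<And>i. i \<in> I \<Longrightarrow> SD (f i) (f' i)) \<Longrightarrow> SD (\<lambda>w. \<Sum>i\<in>I. f i w) (\<lambda>w. \<Sum>i\<in>I. f' i w)"
proof (induction I rule: infinite_finite_induct)
  case (insert x F)
  then show ?case using add[of "f x" "f' x"] by simp
qed (use of_int[of 0] in simp_all)

lemma prod:
  "finite I \<Longrightarrow> (\<And>i. i \<in> I \<Longrightarrow> SD (f i) (f' i)) \<Longrightarrow>
    SD (\<lambda>w. \<Prod>i\<in>I. f i w) (\<lambda>w. \<Sum>i\<in>I. f' i w * (\<Prod>k\<in>I-{i}. f k w0))"
proof (induction I rule: finite_induct)
  case empty
  then show ?case using of_int[of 1] by simp
next
  case (insert x F)
  have "(\<Sum>i\<in>insert x F. f' i w * (\<Prod>k\<in>insert x F-{i}. f k w0))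
     = f' x w * (\<Prod>i\<in>F. f i w0) + f x w0 * (\<Sum>i\<in>F. f' i w * (\<Prod>k\<in>F-{i}. f k w0))" for w
  proof -
    have "(\<Prod>k\<in>insert x F-{i}. f k w0) = f x w0 * (\<Prod>k\<in>F-{i}. f k w0)" if "i \<in> F" for i
    proof -
      have "insert x F - {i} = insert x (F - {i})" using that insert.hyps by auto
      then show ?thesis using insert.hyps by simp
    qed
    moreover have "insert x F - {x} = F" using insert.hyps by auto
    ultimately show ?thesis using insert.hyps
      by (simp add: sum_distrib_left algebra_simps)
  qed
  with mult[of "f x" "f' x" "\<lambda>w. \<Prod>i\<in>F. f i w" "\<lambda>w. \<Sum>i\<in>F. f' i w * (\<Prod>k\<in>F-{i}. f k w0)"]
  show ?case using insert by simp
qed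

lemma Det:
  assumes "\<And>i j. SD (\<lambda>w. A w i j) (\<lambda>w. A' w i j)"
  shows "SD (\<lambda>w. Det n (A w)) (\<lambda>w. \<Sum>i<n. \<Sum>j<n. A' w i j * Cof n (A w0) i j)"
proof -
  have "SD (\<lambda>w. \<Sum>p | p permutes {0..<n}. of_int (sign p) * (\<Prod>i = 0..<n. A w i (p i)))
     (\<lambda>w. \<Sum>p | p permutes {0..<n}. 0 * (\<Prod>i = 0..<n. A w0 i (p i)) +
        of_int (sign p) * (\<Sum>i\<in>{0..<n}. A' w i (p i) * (\<Prod>k\<in>{0..<n}-{i}. A w0 k (p k))))"
    by (intro sum mult of_int prod assms) auto
  then show ?thesis unfolding Det_alt[symmetric] by (simp add: sum_sign_replace_row)
qed

text \<open>The Cauchy product carries a product rule from the ring to the coefficients of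
  polynomials. Applied twice it reaches polynomials in x over polynomials in z, hence pencils,
  without a topology on polynomials.\<close>

lemma lift_poly:
  "derivation_rule (\<lambda>f f'. \<forall>k. SD (\<lambda>w. coeff (f w) k) (\<lambda>w. coeff (f' w) k)) w0"
proof
  show "\<forall>k. SD (\<lambda>w. coeff (of_int c) k) (\<lambda>w. coeff 0 k)" for c
  proof
    fix k
    have "coeff (of_int c :: 'r poly) k = of_int (if k = 0 then c else 0)"
      by (simp add: of_int_poly coeff_pCons split: nat.split)
    then show "SD (\<lambda>w. coeff (of_int c) k) (\<lambda>w. coeff 0 k)"
      using of_int[of "if k = 0 then c else 0"] by simp
  qed
next
  fix f f' g g' :: "'w \<Rightarrow> 'r poly"
  assume f: "\<forall>k. SD (\<lambda>w. coeff (f w) k) (\<lambda>w. coeff (f' w) k)"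
     and g: "\<forall>k. SD (\<lambda>w. coeff (g w) k) (\<lambda>w. coeff (g' w) k)"
  show "\<forall>k. SD (\<lambda>w. coeff (f w + g w) k) (\<lambda>w. coeff (f' w + g' w) k)"
    using f g add by simp
  show "\<forall>k. SD (\<lambda>w. coeff (f w * g w) k) (\<lambda>w. coeff (f' w * g w0 + f w0 * g' w) k)"
  proof
    fix k
    have "SD (\<lambda>w. \<Sum>i\<le>k. coeff (f w) i * coeff (g w) (k - i))
       (\<lambda>w. \<Sum>i\<le>k. coeff (f' w) i * coeff (g w0) (k - i) + coeff (f w0) i * coeff (g' w) (k - i))"
      by (intro sum mult f[rule_format] g[rule_format])
    then show "SD (\<lambda>w. coeff (f w * g w) k) (\<lambda>w. coeff (f' w * g w0 + f w0 * g' w) k)"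
      by (simp add: coeff_mult sum.distrib)
  qed
qed

end

subsection \<open>The tangent map of a determinantal pencil\<close>

text \<open>The ternary form \<open>F\<close> is represented by \<open>F(x, 1, z)\<close>, as a polynomial in \<open>x\<close> whose coefficients are
  polynomials in \<open>z\<close>; thus \<open>lin D C\<close> is the matrix \<open>x I + D + z C\<close>.\<close>

definition lin :: "(nat \<Rightarrow> nat \<Rightarrow> 'a::comm_ring_1) \<Rightarrow> (nat \<Rightarrow> nat \<Rightarrow> 'a) \<Rightarrow> nat \<Rightarrow> nat \<Rightarrow> 'a poly poly" where
  "lin D C i j = [:[:D i j, C i j:], if i = j then 1 else 0:]"

abbreviation cf :: "'a::zero poly poly \<Rightarrow> nat \<Rightarrow> nat \<Rightarrow> 'a" where
  "cf f k j \<equiv> coeff (coeff f k) j"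

section \<open>Modules over C[z] and the span of the cofactors\<close>

lemma map_poly_linear: "f 0 = 0 \<Longrightarrow> map_poly f [:a, b:] = [:f a, f b:]"
  by (rule poly_eqI) (simp add: coeff_map_poly coeff_pCons split: nat.split)

lemma map_poly_constant: "f 0 = 0 \<Longrightarrow> map_poly f [:a:] = [:f a:]"
  by (rule poly_eqI) (simp add: coeff_map_poly coeff_pCons split: nat.split)

lemma map_poly_eval_hom: "comm_ring_hom (map_poly (\<lambda>p. poly p (z::'a::comm_ring_1)))"
proof -
  interpret map_poly_comm_ring_hom "\<lambda>p. poly p z" ..
  show ?thesis ..
qed

text \<open>An element of least degree divides all others, so a root of it would be a common zero.
  The lemma serves for an ideal of top coefficients in C[z] and for an ideal built from cofactors in
  C[x].\<close>

lemma complex_ideal_contains_one: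
  fixes I :: "complex poly set"
  assumes add: "\<And>p q. p \<in> I \<Longrightarrow> q \<in> I \<Longrightarrow> p + q \<in> I"
    and mult: "\<And>p q. p \<in> I \<Longrightarrow> q * p \<in> I"
    and no_zero: "\<And>z. \<exists>p\<in>I. poly p z \<noteq> 0"
  shows "1 \<in> I"
proof -
  define P where "P p \<longleftrightarrow> p \<in> I \<and> p \<noteq> 0" for p
  have "\<exists>p. P p" using no_zero[of 0] unfolding P_def by auto
  then obtain p where p: "P p" and min: "\<And>q. P q \<Longrightarrow> degree p \<le> degree q"
    using ex_has_least_nat[of P _ degree] by metis
  have dvd: "p dvd q" if q: "q \<in> I" for q
  proof (rule ccontr)
    assume "\<not> p dvd q"
    then have "q mod p \<noteq> 0" by (simp add: mod_eq_0_iff_dvd)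
    moreover have "q mod p = q + (- (q div p)) * p"
      by (simp add: minus_div_mult_eq_mod[symmetric])
    then have "q mod p \<in> I" using p q unfolding P_def by (metis add mult)
    ultimately have "degree p \<le> degree (q mod p)" by (intro min) (simp add: P_def)
    moreover have "degree (q mod p) < degree p"
      using \<open>q mod p \<noteq> 0\<close> p degree_mod_less[of p q] unfolding P_def by auto
    ultimately show False by simp
  qed
  have "degree p = 0"
  proof (rule ccontr)
    assume "degree p \<noteq> 0"
    then obtain z where z: "poly p z = 0"
      using fundamental_theorem_of_algebra[of p] constant_degree[of p] by auto
    obtain q where "q \<in> I" "poly q z \<noteq> 0" using no_zero by blast
    then show False using dvd[of q] z by (metis dvd_def mult_eq_0_iff poly_mult)
  qed
  then obtain c where c: "p = [:c:]" by (metis degree_eq_zeroE)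
  with p have "c \<noteq> 0" "p \<in> I" unfolding P_def by auto
  then have "[:1 / c:] * p \<in> I" using mult by blast
  then show ?thesis using c \<open>c \<noteq> 0\<close> by (simp add: one_pCons)
qed

text \<open>The free module \<open>\<complex>[z]\<^sup>n\<close> appears here as the polynomials of degree less than \<open>n\<close> in \<open>x\<close>.\<close>

lemma full_submodule_if_full_fibres:
  fixes U :: "complex poly poly set"
  assumes "0 \<in> U" and "\<And>u v. u \<in> U \<Longrightarrow> v \<in> U \<Longrightarrow> u + v \<in> U"
    and "\<And>p u. u \<in> U \<Longrightarrow> smult p u \<in> U"
    and "\<And>u k. u \<in> U \<Longrightarrow> k \<ge> n \<Longrightarrow> coeff u k = 0"
    and "\<And>z h. (\<And>k. k \<ge> n \<Longrightarrow> coeff h k = 0) \<Longrightarrow> \<exists>u\<in>U. map_poly (\<lambda>p. poly p z) u = h"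
    and "\<And>k. k \<ge> n \<Longrightarrow> coeff g k = 0"
  shows "g \<in> U"
  using assms
proof (induction n arbitrary: U g)
  case 0
  then have "g = 0" by (intro poly_eqI) simp
  with 0(1) show ?case by simp
next
  case (Suc n)
  note zero = Suc.prems(1) and add = Suc.prems(2) and smult = Suc.prems(3)
    and deg = Suc.prems(4) and surj = Suc.prems(5)
  have coeff_ev: "coeff (map_poly (\<lambda>p. poly p z) u) k = poly (coeff u k) z" for z u k
    by (rule coeff_map_poly) simp
  let ?I = "(\<lambda>u. coeff u n) ` U"
  \<comment> \<open>The top coefficients form an ideal of C[z]; since the fibre at \<open>z\<close>
    reaches \<open>monom 1 n\<close>, the point \<open>z\<close> is not a common zero. The resulting
    \<open>e\<close> with top coefficient 1 splits off one rank.\<close>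
  have "1 \<in> ?I"
  proof (rule complex_ideal_contains_one)
    show "p + q \<in> ?I" if "p \<in> ?I" "q \<in> ?I" for p q
      using that add by (auto simp flip: coeff_add)
    show "q * p \<in> ?I" if "p \<in> ?I" for p q
      using that smult by (auto simp flip: coeff_smult)
    show "\<exists>p\<in>?I. poly p z \<noteq> 0" for z
    proof -
      obtain u where "u \<in> U" "map_poly (\<lambda>p. poly p z) u = monom 1 n"
        using surj[of "monom 1 n" z] by auto
      then show ?thesis using coeff_ev[of z u n] by (intro bexI[of _ "coeff u n"]) auto
    qed
  qed
  then obtain e where e: "e \<in> U" "coeff e n = 1" by force
  define V where "V = {u \<in> U. coeff u n = 0}"
  have V: "h \<in> V" if "\<And>k. k \<ge> n \<Longrightarrow> coeff h k = 0" for h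
  proof (rule Suc.IH[where U = V])
    show "0 \<in> V" using zero by (simp add: V_def)
    show "u + v \<in> V" if "u \<in> V" "v \<in> V" for u v using that add by (simp add: V_def)
    show "smult p u \<in> V" if "u \<in> V" for p u using that smult by (simp add: V_def)
    show "coeff u k = 0" if "u \<in> V" "n \<le> k" for u k
      using that deg[of u k] by (cases "k = n") (auto simp: V_def)
    show "coeff h k = 0" if "n \<le> k" for k using that \<open>\<And>k. k \<ge> n \<Longrightarrow> coeff h k = 0\<close> by simp
    show "\<exists>u\<in>V. map_poly (\<lambda>p. poly p z) u = h'" if h': "\<And>k. n \<le> k \<Longrightarrow> coeff h' k = 0" for z h'
    proof -
      obtain w where w: "w \<in> U" "map_poly (\<lambda>p. poly p z) w = h'"
        using surj[of h' z] h' by auto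
      define w' where "w' = w + smult (- coeff w n) e"
      have "w' \<in> U" unfolding w'_def by (intro add smult w e)
      then have "w' \<in> V" using e by (simp add: V_def w'_def)
      \<comment> \<open>The multiple of \<open>e\<close> that is subtracted has a factor vanishing
        at \<open>z\<close>, so it is invisible in this fibre and \<open>V\<close> inherits full
        fibres.\<close>
      moreover have "poly (coeff w n) z = 0" using w(2) coeff_ev[of z w n] h' by simp
      then have "map_poly (\<lambda>p. poly p z) w' = h'"
        using w(2) by (intro poly_eqI) (simp add: w'_def coeff_ev flip: w(2))
      ultimately show ?thesis by blast
    qed
  qed
  have "g + smult (- coeff g n) e \<in> V"
  proof (rule V)
    fix k assume "k \<ge> n"
    then show "coeff (g + smult (- coeff g n) e) k = 0"
      using e deg[of e k] Suc.prems(6)[of k] by (cases "k = n") auto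
  qed
  then have "g + smult (- coeff g n) e \<in> U" by (simp add: V_def)
  then have "(g + smult (- coeff g n) e) + smult (coeff g n) e \<in> U"
    by (rule add[OF _ smult[OF e(1)]])
  then show ?case by simp
qed

text \<open>x I + K is the characteristic matrix of \<open>- K\<close>. Stated over rings because
  for \<open>lin\<close> the entries of \<open>K\<close> are polynomials in z.\<close>

lemma
  fixes K :: "nat \<Rightarrow> nat \<Rightarrow> 'a::comm_ring_1"
  shows Det_monic: "coeff (Det d (\<lambda>i j. [:K i j, if i = j then 1 else 0:])) d = 1"
    and coeff_Det_linear: "k > d \<Longrightarrow> coeff (Det d (\<lambda>i j. [:K i j, if i = j then 1 else 0:])) k = 0"
proof -
  let ?A = "Matrix.mat d d (\<lambda>(i,j). - K i j)"
  have "char_poly_matrix ?A = Matrix.mat d d (\<lambda>(i,j). [:K i j, if i = j then 1 else 0:])"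
    unfolding char_poly_matrix_def by (rule eq_matI) (auto simp: one_pCons)
  then have D: "Det d (\<lambda>i j. [:K i j, if i = j then 1 else 0:]) = char_poly ?A"
    unfolding Det_def char_poly_def by simp
  have "degree (char_poly ?A) = d" "coeff (char_poly ?A) d = 1"
    using degree_monic_char_poly[of ?A d] by auto
  then show "coeff (Det d (\<lambda>i j. [:K i j, if i = j then 1 else 0:])) d = 1"
    "k > d \<Longrightarrow> coeff (Det d (\<lambda>i j. [:K i j, if i = j then 1 else 0:])) k = 0"
    unfolding D by (auto intro: coeff_eq_0)
qed

lemma degree_Cof_linear:
  fixes A :: "nat \<Rightarrow> nat \<Rightarrow> 'a::comm_ring_1 poly"
  assumes "\<And>i j. degree (A i j) \<le> 1"
  shows "degree (Cof d A i j) \<le> d - 1"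
proof -
  have "degree (Det (d - 1) (\<lambda>k l. A (insert_index i k) (insert_index j l))) \<le> 1 * (d - 1)"
    unfolding Det_def using assms by (intro degree_det_le) auto
  moreover have "(-1) ^ (i + j) = (1::'a poly) \<or> (-1) ^ (i + j) = (-1::'a poly)"
    by (metis neg_one_even_power neg_one_odd_power)
  ultimately show ?thesis unfolding Cof_def by auto
qed

text \<open>Together with the characteristic polynomial the span is an ideal of \<open>\<complex>[x]\<close>, and it has no zero.\<close>

lemma cofactor_span_full:
  fixes K :: "nat \<Rightarrow> nat \<Rightarrow> complex"
  defines "M \<equiv> \<lambda>i j. [:K i j, if i = j then 1 else 0:]"
  assumes nz: "\<And>x. \<exists>i<d. \<exists>j<d. poly (Cof d M i j) x \<noteq> 0"
    and h: "\<And>k. k \<ge> d \<Longrightarrow> coeff h k = 0"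
  shows "\<exists>S. h = (\<Sum>i<d. \<Sum>j<d. smult (S i j) (Cof d M i j))"
proof -
  define L where "L S = (\<Sum>i<d. \<Sum>j<d. smult (S i j) (Cof d M i j))" for S
  define chi where "chi = Det d M"
  define J where "J = {p. \<exists>S r. p = L S + chi * r}"
  have L_add: "L S + L T = L (\<lambda>i j. S i j + T i j)" for S T
    by (simp add: L_def sum.distrib smult_add_left)
  have L_smult: "smult c (L S) = L (\<lambda>i j. c * S i j)" for S c
    by (simp add: L_def smult_sum2)
  have J_add: "p + q \<in> J" if "p \<in> J" "q \<in> J" for p q
  proof -
    from that obtain S r T s where "p = L S + chi * r" "q = L T + chi * s" unfolding J_def by auto
    then have "p + q = L (\<lambda>i j. S i j + T i j) + chi * (r + s)"
      by (simp add: L_add[symmetric] algebra_simps)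
    then show ?thesis unfolding J_def by blast
  qed
  have J_smult: "smult c p \<in> J" if "p \<in> J" for c p
  proof -
    from that obtain S r where "p = L S + chi * r" unfolding J_def by auto
    then have "smult c p = L (\<lambda>i j. c * S i j) + chi * (smult c r)"
      by (simp add: L_smult[symmetric] smult_add_right)
    then show ?thesis unfolding J_def by blast
  qed
  \<comment> \<open>The identity (x I + K) adj = \<open>chi\<close> I read entrywise: modulo
    \<open>chi\<close>, multiplication by x maps the scalar span of the cofactors to itself. This
    makes \<open>J\<close> an ideal.\<close>
  have shift: "[:0,1:] * Cof d M k i = (if i = k then chi else 0) - (\<Sum>m<d. smult (K i m) (Cof d M k m))"
    if "i < d" "k < d" for i k
  proof -
    have "(\<Sum>m<d. M i m * Cof d M k m) = (if i = k then chi else 0)"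
      using Cof_rows[OF that, of M] by (simp add: chi_def)
    moreover have "M i m * Cof d M k m = smult (K i m) (Cof d M k m) + (if m = i then [:0,1:] * Cof d M k i else 0)" for m
      by (simp add: M_def)
    ultimately have "(\<Sum>m<d. smult (K i m) (Cof d M k m)) + [:0,1:] * Cof d M k i = (if i = k then chi else 0)"
      using that by (simp add: sum.distrib del: mult_pCons_left)
    then show ?thesis by (simp add: algebra_simps del: mult_pCons_left)
  qed
  have J_x: "[:0,1:] * p \<in> J" if "p \<in> J" for p
  proof -
    from that obtain S r where p: "p = L S + chi * r" unfolding J_def by auto
    define T where "T k m = - (\<Sum>i<d. S k i * K i m)" for k m
    have "[:0,1:] * L S = (\<Sum>k<d. \<Sum>i<d. smult (S k i) ([:0,1:] * Cof d M k i))"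
      unfolding L_def sum_distrib_left mult_smult_right ..
    also have "\<dots> = (\<Sum>k<d. \<Sum>i<d. smult (S k i) (if i = k then chi else 0)
         - (\<Sum>m<d. smult (S k i * K i m) (Cof d M k m)))"
      by (intro sum.cong refl) (simp only: shift lessThan_iff, simp add: smult_diff_right smult_sum2)
    also have "\<dots> = (\<Sum>k<d. smult (S k k) chi) - (\<Sum>k<d. \<Sum>i<d. \<Sum>m<d. smult (S k i * K i m) (Cof d M k m))"
      by (simp add: sum_subtractf if_distrib[where f = "smult _"] cong: if_cong)
    also have "(\<Sum>k<d. \<Sum>i<d. \<Sum>m<d. smult (S k i * K i m) (Cof d M k m))
        = (\<Sum>k<d. \<Sum>m<d. \<Sum>i<d. smult (S k i * K i m) (Cof d M k m))"
      by (intro sum.cong refl sum.swap)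
    also have "\<dots> = - L T"
      by (simp add: L_def T_def smult_sum sum_negf)
    finally have "[:0,1:] * p = L T + chi * ((\<Sum>k<d. [:S k k:]) + [:0,1:] * r)"
      unfolding p by (simp add: algebra_simps sum_distrib_left)
    then show ?thesis unfolding J_def by blast
  qed
  have J_mult: "q * p \<in> J" if "p \<in> J" for p q
  proof (induction q)
    case 0
    have "smult 0 p \<in> J" using J_smult[OF that] .
    then show ?case by simp
  next
    case (pCons a q)
    have "pCons a q * p = smult a p + [:0,1:] * (q * p)" by simp
    then show ?case using J_add[OF J_smult[OF that] J_x[OF pCons.IH]] by simp
  qed
  have "1 \<in> J"
  proof (rule complex_ideal_contains_one[OF J_add J_mult])
    fix z
    obtain i j where ij: "i < d" "j < d" "poly (Cof d M i j) z \<noteq> 0" using nz by blast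
    have "L (\<lambda>k l. if k = i then if l = j then 1 else 0 else 0) = Cof d M i j"
    proof -
      have "(\<Sum>l<d. smult (if k = i then if l = j then 1 else 0 else 0) (Cof d M k l))
          = (if k = i then Cof d M k j else 0)" for k
        using ij sum.delta[of "{..<d}" j "Cof d M i"]
        by (cases "k = i") (simp_all add: if_distrib[where f = "\<lambda>c. smult c _"] cong: if_cong)
      then show ?thesis unfolding L_def using ij by simp
    qed
    then have "Cof d M i j = L (\<lambda>k l. if k = i then if l = j then 1 else 0 else 0) + chi * 0" by simp
    then have "Cof d M i j \<in> J" unfolding J_def by blast
    then show "\<exists>p\<in>J. poly p z \<noteq> 0" using ij by blast
  qed auto
  then have "h * 1 \<in> J" by (rule J_mult)
  then obtain S r where hS: "h = L S + chi * r" unfolding J_def by auto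
  have Cof0: "coeff (Cof d M i j) k = 0" if "k \<ge> d" "i < d" for i j k
  proof -
    have "degree (Cof d M i j) \<le> d - 1" by (rule degree_Cof_linear) (auto simp: M_def)
    then show ?thesis using that by (intro coeff_eq_0) auto
  qed
  \<comment> \<open>Degrees separate the two summands: \<open>h\<close> and the cofactors have
    degree below \<open>d\<close>, whereas a nonzero multiple of the monic \<open>chi\<close> has
    degree at least \<open>d\<close>.\<close>
  have "r = 0"
  proof (rule ccontr)
    assume r: "r \<noteq> 0"
    have chi: "coeff chi d = 1" "\<And>k. k > d \<Longrightarrow> coeff chi k = 0"
      unfolding chi_def M_def by (rule Det_monic, rule coeff_Det_linear)
    then have "degree chi = d"
      by (metis (no_types) le_antisym le_degree degree_le zero_neq_one)
    with chi have "coeff (chi * r) (d + degree r) = lead_coeff r"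
      using coeff_mult_degree_sum[of chi r] by simp
    moreover have "coeff (L S) (d + degree r) = 0"
      unfolding L_def by (simp add: coeff_sum Cof0)
    ultimately have "coeff h (d + degree r) \<noteq> 0" using r hS by simp
    then show False using h by simp
  qed
  then show ?thesis using hS unfolding L_def by auto
qed

section \<open>Lowering the degree in z of a combination of cofactors\<close>

lemma Cof_smult: "Cof n (\<lambda>i j. c * A i j) i j = c ^ (n - 1) * Cof n A i j"
  unfolding Cof_def by (simp add: Det_smult)

text \<open>The entry \<open>a j\<close> is cancelled from a row expansion. Used with linear
  polynomials in x as entries, which are nonzero as polynomials, the formula can afterwards be
  evaluated also at points where one of them vanishes.\<close>

lemma Cof_diag:
  fixes a :: "nat \<Rightarrow> 'a::idom"
  assumes nz: "\<And>m. m < n \<Longrightarrow> a m \<noteq> 0" and ij: "i < n" "j < n"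
  shows "Cof n (\<lambda>i j. if i = j then a i else 0) i j = (if i = j then \<Prod>m\<in>{..<n}-{i}. a m else 0)"
proof -
  let ?A = "\<lambda>i j. if i = j then a i else 0"
  have "(\<Sum>l<n. ?A j l * Cof n ?A i l) = a j * Cof n ?A i j"
    using ij by (simp add: if_distrib if_distribR cong: if_cong)
  then have "a j * Cof n ?A i j = (if j = i then Det n ?A else 0)"
    using Cof_rows[OF ij(2,1), of ?A] by simp
  also have "Det n ?A = (\<Prod>m<n. a m)"
    by (subst Det_upper_triangular) auto
  also have "\<dots> = a i * (\<Prod>m\<in>{..<n}-{i}. a m)"
    using ij by (subst prod.remove[of _ i]) auto
  finally show ?thesis using nz[OF ij(2)] by (cases "i = j") auto
qed

lemma poly_eq_sum_atMost:
  fixes p :: "'a::comm_semiring_1 poly"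
  assumes "degree p \<le> n"
  shows "poly p x = (\<Sum>i\<le>n. coeff p i * x ^ i)"
  unfolding poly_altdef
  by (rule sum.mono_neutral_left) (use assms in \<open>auto simp: coeff_eq_0\<close>)

lemma poly_map_poly_eval:
  fixes h :: "'a::comm_ring_1 poly poly"
  assumes "\<And>k. k > n \<Longrightarrow> coeff h k = 0" "\<And>k. degree (coeff h k) \<le> m"
  shows "poly (map_poly (\<lambda>p. poly p z) h) x = (\<Sum>k\<le>n. \<Sum>j\<le>m. cf h k j * x ^ k * z ^ j)"
proof -
  have "degree (map_poly (\<lambda>p. poly p z) h) \<le> n"
    by (intro degree_le) (simp add: coeff_map_poly assms(1))
  then have "poly (map_poly (\<lambda>p. poly p z) h) x = (\<Sum>k\<le>n. poly (coeff h k) z * x ^ k)"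
    by (simp add: poly_eq_sum_atMost[of _ n] coeff_map_poly)
  also have "\<dots> = (\<Sum>k\<le>n. (\<Sum>j\<le>m. cf h k j * z ^ j) * x ^ k)"
    by (intro sum.cong refl arg_cong2[of _ _ _ _ "(*)"] poly_eq_sum_atMost assms(2))
  finally show ?thesis by (simp add: sum_distrib_left sum_distrib_right algebra_simps)
qed

text \<open>The differential of the determinant at \<open>M\<close> in the direction
  \<open>S\<close>, that is, the trace of \<open>S\<close> times the adjugate. \<open>S\<close> is
  constant in x but may have any degree in z; degree one with diagonal leading part is what a
  variation of \<open>D\<close> and \<open>C\<close> provides.\<close>

definition cofactor_comb :: "nat \<Rightarrow> (nat \<Rightarrow> nat \<Rightarrow> 'a::comm_ring_1 poly poly) \<Rightarrow> (nat \<Rightarrow> nat \<Rightarrow> 'a poly) \<Rightarrow> 'a poly poly" where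
  "cofactor_comb d M S = (\<Sum>i<d. \<Sum>l<d. smult (S i l) (Cof d M i l))"

lemma cofactor_comb_diff:
  "cofactor_comb d M (\<lambda>i l. S i l - T i l) = cofactor_comb d M S - cofactor_comb d M T"
  by (simp add: cofactor_comb_def smult_diff_left sum_subtractf)

text \<open>Commutators are tangent to conjugation orbits, on which the determinant is constant.
  Algebraically, [K, W] = [x I + K, W], and the trace of [M, W] adj(M) vanishes because
  \<open>M\<close> commutes with its adjugate.\<close>

lemma cofactor_comb_commutator:
  fixes D C :: "nat \<Rightarrow> nat \<Rightarrow> 'a::comm_ring_1"
  defines "K \<equiv> \<lambda>i l. [:D i l, C i l:]"
  shows "cofactor_comb d (lin D C) (\<lambda>i l. (\<Sum>m<d. K i m * W m l) - (\<Sum>m<d. W i m * K m l)) = 0"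
proof -
  let ?M = "lin D C" and ?d = "Det d (lin D C)"
  let ?A = "Cof d (lin D C)"
  have M: "?M i m = [:K i m:] + (if i = m then [:0,1:] else 0)" for i m
    by (simp add: lin_def K_def)
  have const_sum: "[:\<Sum>m<d. f m:] = (\<Sum>m<d. [:f m:])" for f :: "nat \<Rightarrow> 'a poly"
  proof (induction d)
    case (Suc d)
    show ?case using Suc.IH[symmetric] by simp
  qed simp
  have 1: "(\<Sum>m<d. ?M i m * [:W m l:]) = [:\<Sum>m<d. K i m * W m l:] + [:0,1:] * [:W i l:]" if "i < d" for i l
  proof -
    have "?M i m * [:W m l:] = [:K i m * W m l:] + (if m = i then [:0,1:] * [:W i l:] else 0)" for m
      by (simp add: M algebra_simps)
    then show ?thesis using that by (simp add: sum.distrib const_sum)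
  qed
  have 2: "(\<Sum>m<d. [:W i m:] * ?M m l) = [:\<Sum>m<d. W i m * K m l:] + [:0,1:] * [:W i l:]" if "l < d" for i l
  proof -
    have "[:W i m:] * ?M m l = [:W i m * K m l:] + (if m = l then [:0,1:] * [:W i l:] else 0)" for m
      by (simp add: M algebra_simps)
    then show ?thesis using that by (simp add: sum.distrib const_sum)
  qed
  have "cofactor_comb d ?M (\<lambda>i l. (\<Sum>m<d. K i m * W m l) - (\<Sum>m<d. W i m * K m l))
     = (\<Sum>i<d. \<Sum>l<d. ((\<Sum>m<d. ?M i m * [:W m l:]) - (\<Sum>m<d. [:W i m:] * ?M m l)) * ?A i l)"
    unfolding cofactor_comb_def
  proof (intro sum.cong refl)
    fix i l assume "i \<in> {..<d}" "l \<in> {..<d}"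
    then have "(\<Sum>m<d. ?M i m * [:W m l:]) - (\<Sum>m<d. [:W i m:] * ?M m l)
      = [:(\<Sum>m<d. K i m * W m l) - (\<Sum>m<d. W i m * K m l):]"
      by (simp only: 1 2 lessThan_iff) simp
    then show "smult ((\<Sum>m<d. K i m * W m l) - (\<Sum>m<d. W i m * K m l)) (?A i l)
       = ((\<Sum>m<d. ?M i m * [:W m l:]) - (\<Sum>m<d. [:W i m:] * ?M m l)) * ?A i l" by simp
  qed
  also have "\<dots> = (\<Sum>i<d. \<Sum>l<d. \<Sum>m<d. [:W m l:] * (?M i m * ?A i l))
       - (\<Sum>i<d. \<Sum>l<d. \<Sum>m<d. [:W i m:] * (?M m l * ?A i l))"
    by (simp only: left_diff_distrib sum_subtractf sum_distrib_right) (simp only: mult_ac)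
  also have "(\<Sum>i<d. \<Sum>l<d. \<Sum>m<d. [:W i m:] * (?M m l * ?A i l)) = (\<Sum>i<d. \<Sum>m<d. [:W i m:] * (\<Sum>l<d. ?M m l * ?A i l))"
    unfolding sum_distrib_left by (intro sum.cong refl sum.swap)
  also have "\<dots> = (\<Sum>i<d. \<Sum>m<d. if m = i then [:W i i:] * ?d else 0)"
    by (intro sum.cong refl) (simp add: Cof_rows)
  also have "\<dots> = (\<Sum>i<d. [:W i i:] * ?d)" by simp
  also have "(\<Sum>i<d. \<Sum>l<d. \<Sum>m<d. [:W m l:] * (?M i m * ?A i l)) = (\<Sum>l<d. \<Sum>i<d. \<Sum>m<d. [:W m l:] * (?M i m * ?A i l))"
    by (rule sum.swap)
  also have "\<dots> = (\<Sum>l<d. \<Sum>m<d. [:W m l:] * (\<Sum>i<d. ?M i m * ?A i l))"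
    unfolding sum_distrib_left by (intro sum.cong refl sum.swap)
  also have "\<dots> = (\<Sum>l<d. \<Sum>m<d. if m = l then [:W l l:] * ?d else 0)"
    by (intro sum.cong refl) (simp add: Cof_cols)
  also have "\<dots> = (\<Sum>l<d. [:W l l:] * ?d)" by simp
  finally show ?thesis by simp
qed

lemma poly_eval_hom: "comm_ring_hom (\<lambda>f. poly (map_poly (\<lambda>p. poly p (z::'a::comm_ring_1)) f) x)"
proof -
  interpret comm_ring_hom "map_poly (\<lambda>p. poly p z)" by (rule map_poly_eval_hom)
  show ?thesis by unfold_locales (simp_all add: hom_distribs)
qed

lemma poly_lin:
  "poly (map_poly (\<lambda>p. poly p z) (lin D C i j)) x = D i j + z * C i j + (if i = j then x else 0)"
  by (simp add: lin_def map_poly_linear)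

lemma poly_cofactor_comb:
  "poly (map_poly (\<lambda>p. poly p z) (cofactor_comb d (lin D C) S)) x
    = (\<Sum>i<d. \<Sum>l<d. poly (S i l) z * Cof d (\<lambda>i j. D i j + z * C i j + (if i = j then x else 0)) i l)"
proof -
  interpret comm_ring_hom "\<lambda>f. poly (map_poly (\<lambda>p. poly p z) f) x" by (rule poly_eval_hom)
  have "poly (map_poly (\<lambda>p. poly p z) (smult p f)) x = poly p z * poly (map_poly (\<lambda>p. poly p z) f) x" for p f
    using hom_mult[of "[:p:]" f] by (simp add: map_poly_constant)
  then show ?thesis
    unfolding cofactor_comb_def by (simp add: hom_sum hom_Cof poly_lin)
qed

text \<open>Compare the parts of highest degree: homogenize with \<open>y\<close> and let \<open>y\<close> tend to \<open>0\<close>, which leaves the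
  cofactors of the diagonal matrix \<open>x I + C\<close>.\<close>

lemma leading_diagonal_zero:
  fixes D C :: "nat \<Rightarrow> nat \<Rightarrow> complex"
  assumes C: "\<And>i j. C i j = (if i = j then c i else 0)" and inj: "inj_on c {..<d}"
    and deg: "\<And>i l. i < d \<Longrightarrow> l < d \<Longrightarrow> degree (S i l) \<le> N" and N: "N \<ge> 2"
    and h: "h = cofactor_comb d (lin D C) S"
    and tdeg: "\<And>k j. k + j > d \<Longrightarrow> cf h k j = 0" and i: "i < d"
  shows "coeff (S i i) N = 0"
proof -
  let ?M = "\<lambda>x y i j. y * D i j + C i j + (if i = j then x else 0)"
  have h_eval: "poly (map_poly (\<lambda>p. poly p z) h) x = (\<Sum>k\<le>d. \<Sum>j\<le>d. cf h k j * x ^ k * z ^ j)" for x z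
    by (rule poly_map_poly_eval) (auto intro!: poly_eqI degree_le tdeg)
  have rev: "y ^ N * poly (S i l) (1 / y) = (\<Sum>k\<le>N. coeff (S i l) k * y ^ (N - k))"
    if "i < d" "l < d" "y \<noteq> 0" for i l y
  proof -
    have "y ^ N * (1 / y) ^ k = y ^ (N - k)" if "k \<le> N" for k
      using that \<open>y \<noteq> 0\<close> by (simp add: power_diff power_one_over)
    then show ?thesis
      using deg[OF that(1,2)]
      by (auto simp: poly_eq_sum_atMost[of _ N] sum_distrib_left mult.left_commute[of "y ^ N"] intro!: sum.cong)
  qed
  \<comment> \<open>With z = 1/y and x/y for x, both sides are multiplied by
    \<open>y ^ (N + d - 1)\<close>: degree \<open>N\<close> from \<open>S\<close> and
    \<open>d - 1\<close> from the cofactors. Where the subtraction on the right could truncate, the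
    coefficient of \<open>h\<close> is zero.\<close>
  have scaled: "(\<Sum>i<d. \<Sum>l<d. (\<Sum>k\<le>N. coeff (S i l) k * y ^ (N - k)) * Cof d (?M x y) i l)
      = (\<Sum>k\<le>d. \<Sum>j\<le>d. cf h k j * x ^ k * y ^ (N + d - 1 - k - j))" if y: "y \<noteq> 0" for x y
  proof -
    have Cof: "y ^ (d - 1) * Cof d (\<lambda>i j. D i j + 1 / y * C i j + (if i = j then x / y else 0)) i l = Cof d (?M x y) i l" for i l
      unfolding Cof_smult[symmetric] by (rule Cof_cong) (use y in \<open>auto simp: field_simps\<close>)
    have "(\<Sum>i<d. \<Sum>l<d. (\<Sum>k\<le>N. coeff (S i l) k * y ^ (N - k)) * Cof d (?M x y) i l)
      = (\<Sum>i<d. \<Sum>l<d. (y ^ N * poly (S i l) (1 / y)) * (y ^ (d - 1) * Cof d (\<lambda>i j. D i j + 1 / y * C i j + (if i = j then x / y else 0)) i l))"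
      unfolding Cof using y by (intro sum.cong refl) (simp add: rev)
    also have "\<dots> = y ^ (N + d - 1) * poly (map_poly (\<lambda>p. poly p (1 / y)) h) (x / y)"
    proof -
      have "N + d - 1 = N + (d - 1)" using i by simp
      then have "y ^ N * p * (y ^ (d - 1) * q) = y ^ (N + d - 1) * (p * q)" for p q
        by (simp add: power_add mult_ac)
      then show ?thesis
        unfolding h poly_cofactor_comb sum_distrib_left by (intro sum.cong refl)
    qed
    also have "\<dots> = (\<Sum>k\<le>d. \<Sum>j\<le>d. cf h k j * x ^ k * y ^ (N + d - 1 - k - j))"
      unfolding h_eval sum_distrib_left
    proof (intro sum.cong refl)
      fix k j
      show "y ^ (N + d - 1) * (cf h k j * (x / y) ^ k * (1 / y) ^ j) = cf h k j * x ^ k * y ^ (N + d - 1 - k - j)"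
      proof (cases "k + j > d")
        case False
        then have "y ^ (N + d - 1) = y ^ (N + d - 1 - k - j) * y ^ k * y ^ j"
          using N by (simp flip: power_add)
        then show ?thesis using y by (simp add: field_simps)
      qed (simp add: tdeg)
    qed
    finally show ?thesis .
  qed
  have zero: "(\<Sum>i<d. \<Sum>l<d. coeff (S i l) N * Cof d (\<lambda>i j. C i j + (if i = j then x else 0)) i l) = 0" for x
  proof -
    let ?L = "\<lambda>y. \<Sum>i<d. \<Sum>l<d. (\<Sum>k\<le>N. coeff (S i l) k * y ^ (N - k)) * Cof d (?M x y) i l"
    have 1: "(?L \<longlongrightarrow> (\<Sum>i<d. \<Sum>l<d. (\<Sum>k\<le>N. coeff (S i l) k * 0 ^ (N - k)) * Cof d (?M x 0) i l)) (at 0)"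
      by (intro tendsto_intros tendsto_Cof)
    let ?R = "\<lambda>y. \<Sum>k\<le>d. \<Sum>j\<le>d. cf h k j * x ^ k * y ^ (N + d - 1 - k - j)"
    have "(?R \<longlongrightarrow> ?R 0) (at 0)"
      by (intro tendsto_intros)
    \<comment> \<open>Here \<open>N \<ge> 2\<close> enters: for k + j \<le> d a positive power of y
      remains, so nothing of \<open>h\<close> survives at y = 0.\<close>
    moreover have "cf h k j * x ^ k * 0 ^ (N + d - 1 - k - j) = 0" for k j
      using N by (cases "k + j > d") (auto simp: tdeg)
    then have "?R 0 = 0" by (intro sum.neutral ballI)
    moreover have "\<forall>\<^sub>F y in at 0. ?R y = ?L y"
      unfolding eventually_at_filter by (intro always_eventually allI impI scaled[symmetric])
    ultimately have 2: "(?L \<longlongrightarrow> 0) (at 0)"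
      using Lim_transform_eventually[of ?R 0 "at 0" ?L] by (simp only: simp_thms)
    have "(\<Sum>k\<le>N. coeff p k * 0 ^ (N - k)) = coeff p N" for p :: "complex poly"
    proof -
      have "(\<Sum>k\<le>N. coeff p k * 0 ^ (N - k)) = (\<Sum>k\<le>N. if k = N then coeff p N else 0)"
        by (intro sum.cong) (auto simp: power_0_left)
      then show ?thesis by simp
    qed
    with tendsto_unique[OF _ 1 2] show ?thesis by simp
  qed
  have Cof: "Cof d (\<lambda>i j. C i j + (if i = j then x else 0)) i l = (if i = l then \<Prod>m\<in>{..<d}-{i}. c m + x else 0)"
    if "i < d" "l < d" for i l x
  proof -
    have "Cof d (\<lambda>i j. C i j + (if i = j then x else 0)) i l
       = Cof d (\<lambda>i j. poly (if i = j then [:c i, 1:] else 0) x) i l"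
      by (rule Cof_cong) (simp add: C)
    also have "\<dots> = poly (Cof d (\<lambda>i j. if i = j then [:c i, 1:] else 0) i l) x"
      by (rule poly_hom.hom_Cof[symmetric])
    finally show ?thesis using that by (simp add: Cof_diag poly_prod)
  qed
  have "(\<Sum>k<d. coeff (S k k) N * (\<Prod>m\<in>{..<d}-{k}. c m + x)) = 0" for x
  proof -
    have "(\<Sum>l<d. coeff (S k l) N * Cof d (\<lambda>i j. C i j + (if i = j then x else 0)) k l)
       = coeff (S k k) N * (\<Prod>m\<in>{..<d}-{k}. c m + x)" if "k < d" for k
    proof -
      have "(\<Sum>l<d. coeff (S k l) N * Cof d (\<lambda>i j. C i j + (if i = j then x else 0)) k l)
        = (\<Sum>l<d. if l = k then coeff (S k k) N * (\<Prod>m\<in>{..<d}-{k}. c m + x) else 0)"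
        using that by (intro sum.cong) (auto simp: Cof)
      then show ?thesis using that by simp
    qed
    then show ?thesis using zero[of x] by simp
  qed
  \<comment> \<open>At x = - c i only the summand k = i survives, and its product is nonzero because
    the \<open>c\<close> are distinct.\<close>
  from this[of "- c i"] have "(\<Sum>k<d. coeff (S k k) N * (\<Prod>m\<in>{..<d}-{k}. c m - c i)) = 0" by simp
  moreover have "(\<Prod>m\<in>{..<d}-{k}. c m - c i) = 0" if "k \<noteq> i" for k
    using that i by (intro prod_zero) auto
  then have "(\<Sum>k<d. coeff (S k k) N * (\<Prod>m\<in>{..<d}-{k}. c m - c i))
     = (\<Sum>k<d. if k = i then coeff (S i i) N * (\<Prod>m\<in>{..<d}-{i}. c m - c i) else 0)"
    by (intro sum.cong) auto
  ultimately have "coeff (S i i) N * (\<Prod>m\<in>{..<d}-{i}. c m - c i) = 0"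
    using i by simp
  moreover have "(\<Prod>m\<in>{..<d}-{i}. c m - c i) \<noteq> 0"
    using inj i by (auto simp: inj_on_def)
  ultimately show ?thesis by simp
qed

text \<open>For W = w z^(N-1) the leading part of [D + z C, W] is [C, w], with entries (c i - c l) w
  i l. For distinct \<open>c\<close> it can be made to cancel all off-diagonal leading coefficients,
  and it does not touch the diagonal.\<close>

lemma reduce_degree_step:
  fixes D C :: "nat \<Rightarrow> nat \<Rightarrow> complex"
  assumes C: "\<And>i j. C i j = (if i = j then c i else 0)" and inj: "inj_on c {..<d}"
    and deg: "\<And>i l. i < d \<Longrightarrow> l < d \<Longrightarrow> degree (S i l) \<le> N" and N: "N \<ge> 1"
  shows "\<exists>S'. cofactor_comb d (lin D C) S' = cofactor_comb d (lin D C) S \<and>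
    (\<forall>i<d. \<forall>l<d. degree (S' i l) \<le> N \<and>
      coeff (S' i l) N = (if i = l then coeff (S i i) N else 0))"
proof -
  define K where "K = (\<lambda>i l. [:D i l, C i l:])"
  define w where "w i l = (if i = l then 0 else coeff (S i l) N / (c i - c l))" for i l
  define W where "W i l = monom (w i l) (N - 1)" for i l
  define X where "X i l = (\<Sum>m<d. K i m * W m l) - (\<Sum>m<d. W i m * K m l)" for i l
  have degK: "degree (K i m * W j l) \<le> N" for i m j l
  proof -
    have "degree (K i m * W j l) \<le> degree (K i m) + degree (W j l)" by (rule degree_mult_le)
    also have "\<dots> \<le> 1 + (N - 1)"
      by (intro add_mono) (auto simp: K_def W_def degree_monom_le)
    finally show ?thesis using N by simp
  qed
  have degX: "degree (X i l) \<le> N" for i l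
    unfolding X_def using degK by (intro degree_diff_le degree_sum_le) (auto simp: mult.commute)
  have coK: "coeff (K i m * W j l) N = C i m * w j l" for i m j l
  proof -
    have "coeff (W j l) N = 0" using N by (simp add: W_def)
    moreover have "K i m * W j l = smult (D i m) (W j l) + pCons 0 (smult (C i m) (W j l))"
      by (simp add: K_def)
    moreover obtain N' where "N = Suc N'" using N by (cases N) auto
    ultimately show ?thesis by (simp add: W_def)
  qed
  have coX: "coeff (X i l) N = (c i - c l) * w i l" if "i < d" "l < d" for i l
  proof -
    have "(\<Sum>m<d. C i m * w m l) = c i * w i l" "(\<Sum>m<d. C m l * w i m) = c l * w i l"
      using that by (simp_all add: C if_distrib if_distribR cong: if_cong)
    then show ?thesis
      by (simp add: X_def coeff_sum coK mult.commute[of "W i _"] left_diff_distrib)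
  qed
  show ?thesis
  proof (intro exI[of _ "\<lambda>i l. S i l - X i l"] conjI allI impI)
    show "cofactor_comb d (lin D C) (\<lambda>i l. S i l - X i l) = cofactor_comb d (lin D C) S"
      unfolding cofactor_comb_diff
      using cofactor_comb_commutator[of d D C W] by (simp add: X_def K_def)
    fix i l assume il: "i < d" "l < d"
    show "degree (S i l - X i l) \<le> N" by (intro degree_diff_le deg il degX)
    show "coeff (S i l - X i l) N = (if i = l then coeff (S i i) N else 0)"
      using inj il by (auto simp: coX w_def inj_on_def)
  qed
qed

text \<open>Commutators clear the leading coefficients off the diagonal; in degrees at least two the
  bound on the total degree of \<open>h\<close> then clears those on the diagonal. The descent stops
  in degree one with a diagonal leading part, which is a variation of \<open>C\<close>.\<close>

lemma reduce_degree:
  fixes D C :: "nat \<Rightarrow> nat \<Rightarrow> complex"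
  assumes C: "\<And>i j. C i j = (if i = j then c i else 0)" and inj: "inj_on c {..<d}"
    and tdeg: "\<And>k j. k + j > d \<Longrightarrow> cf h k j = 0"
    and h: "h = cofactor_comb d (lin D C) S"
    and deg: "\<And>i l. i < d \<Longrightarrow> l < d \<Longrightarrow> degree (S i l) \<le> N"
  shows "\<exists>S. h = cofactor_comb d (lin D C) S \<and>
    (\<forall>i<d. \<forall>l<d. degree (S i l) \<le> 1 \<and> (i \<noteq> l \<longrightarrow> coeff (S i l) 1 = 0))"
  using h deg
proof (induction N arbitrary: S)
  case 0
  then show ?case by (intro exI[of _ S]) (auto simp: coeff_eq_0)
next
  case (Suc N)
  obtain S' where S': "cofactor_comb d (lin D C) S' = h"
    "\<forall>i<d. \<forall>l<d. degree (S' i l) \<le> Suc N \<and> coeff (S' i l) (Suc N) = (if i = l then coeff (S i i) (Suc N) else 0)"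
    using reduce_degree_step[where S = S and N = "Suc N" and D = D, OF C inj Suc.prems(2)] Suc.prems(1) by auto
  show ?case
  proof (cases "N = 0")
    case True
    with S' show ?thesis by (intro exI[of _ S']) auto
  next
    case False
    then have "coeff (S i i) (Suc N) = 0" if "i < d" for i
      using leading_diagonal_zero[where S = S and N = "Suc N" and D = D, OF C inj Suc.prems(2) _ Suc.prems(1) tdeg that] by simp
    with S'(2) have "degree (S' i l) \<le> N" if "i < d" "l < d" for i l
      using that by (metis (no_types, lifting) eq_zero_or_degree_less leading_coeff_0_iff le_SucE degree_0 less_eq_nat.simps(1))
    then show ?thesis using Suc.IH[of S'] S'(1) by simp
  qed
qed

text \<open>\<open>nz\<close> says that the complex pencil has corank at most one everywhere in the
  chart y = 1, which gives spanning in the fibre over each \<open>z\<close>. The condition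
  \<open>coeff h d = 0\<close> makes \<open>h\<close> tangent to the monic forms.\<close>

lemma complex_tangent:
  fixes D C :: "nat \<Rightarrow> nat \<Rightarrow> complex"
  assumes C: "\<And>i j. C i j = (if i = j then c i else 0)" and inj: "inj_on c {..<d}"
    and nz: "\<And>x z. \<exists>i<d. \<exists>j<d. Cof d (\<lambda>i j. D i j + z * C i j + (if i = j then x else 0)) i j \<noteq> 0"
    and tdeg: "\<And>k j. k + j > d \<Longrightarrow> cf h k j = 0" and h: "coeff h d = 0"
  shows "\<exists>S. h = cofactor_comb d (lin D C) S \<and>
    (\<forall>i<d. \<forall>l<d. degree (S i l) \<le> 1 \<and> (i \<noteq> l \<longrightarrow> coeff (S i l) 1 = 0))"
proof -
  let ?A = "Cof d (lin D C)" and ?U = "range (cofactor_comb d (lin D C))"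
  have A0: "coeff (?A i j) k = 0" if "k \<ge> d" "i < d" for i j k
  proof -
    have "degree (?A i j) \<le> d - 1" by (rule degree_Cof_linear) (auto simp: lin_def)
    then show ?thesis using that by (intro coeff_eq_0) auto
  qed
  have "h \<in> ?U"
  proof (rule full_submodule_if_full_fibres[where n = d])
    show "0 \<in> ?U"
      by (rule image_eqI[of _ _ "\<lambda>_ _. 0"]) (auto simp: cofactor_comb_def)
    show "u + v \<in> ?U"
      if uv: "u \<in> ?U" "v \<in> ?U" for u v
    proof -
      obtain S T where "u = cofactor_comb d (lin D C) S" "v = cofactor_comb d (lin D C) T" using uv by auto
      then show ?thesis
        by (intro image_eqI[of _ _ "\<lambda>i l. S i l + T i l"]) (auto simp: cofactor_comb_def smult_add_left sum.distrib)
    qed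
    show "smult p u \<in> ?U" if u: "u \<in> ?U" for p u
    proof -
      obtain S where "u = cofactor_comb d (lin D C) S" using u by auto
      then show ?thesis
        by (intro image_eqI[of _ _ "\<lambda>i l. p * S i l"]) (auto simp: cofactor_comb_def smult_sum2)
    qed
    show "coeff u k = 0" if "u \<in> ?U" "d \<le> k" for u k
      using that by (auto simp: cofactor_comb_def coeff_sum A0)
    show "coeff h k = 0" if "d \<le> k" for k
      using that h by (cases "k = d") (auto intro!: poly_eqI tdeg)
    show "\<exists>u\<in>?U. map_poly (\<lambda>p. poly p z) u = g"
      if g: "\<And>k. d \<le> k \<Longrightarrow> coeff g k = 0" for z g
    proof -
      interpret comm_ring_hom "map_poly (\<lambda>p. poly p z)" by (rule map_poly_eval_hom)
      let ?K = "\<lambda>i j. D i j + z * C i j"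
      let ?M = "\<lambda>i j. [:?K i j, if i = j then 1 else 0:]"
      have lin: "map_poly (\<lambda>p. poly p z) (lin D C i j) = ?M i j" for i j
        by (simp add: lin_def map_poly_linear)
      have "\<exists>i<d. \<exists>j<d. poly (Cof d ?M i j) x \<noteq> 0" for x
      proof -
        have "poly (Cof d ?M i j) x = Cof d (\<lambda>i j. D i j + z * C i j + (if i = j then x else 0)) i j" for i j
          unfolding poly_hom.hom_Cof by (rule Cof_cong) simp
        then show ?thesis using nz by simp
      qed
      then obtain S where S: "g = (\<Sum>i<d. \<Sum>j<d. smult (S i j) (Cof d ?M i j))"
        using cofactor_span_full[where K = ?K, OF _ g] by blast
      have sm: "map_poly (\<lambda>p. poly p z) (smult p f) = smult (poly p z) (map_poly (\<lambda>p. poly p z) f)" for p f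
        by (rule poly_eqI) (simp add: coeff_map_poly)
      have "map_poly (\<lambda>p. poly p z) (cofactor_comb d (lin D C) (\<lambda>i j. [:S i j:])) = g"
        unfolding S cofactor_comb_def hom_sum sm hom_Cof lin by simp
      then show ?thesis by blast
    qed
  qed
  then obtain S where S: "h = cofactor_comb d (lin D C) S" by blast
  have "degree (S i l) \<le> (\<Sum>i<d. \<Sum>l<d. degree (S i l))" if "i < d" "l < d" for i l
  proof -
    have "degree (S i l) \<le> (\<Sum>l<d. degree (S i l))"
      by (rule member_le_sum) (use that in auto)
    also have "\<dots> \<le> (\<Sum>i<d. \<Sum>l<d. degree (S i l))"
      by (rule member_le_sum[of i _ "\<lambda>i. \<Sum>l<d. degree (S i l)"]) (use that in auto)
    finally show ?thesis .
  qed
  then show ?thesis using reduce_degree[where S = S and D = D, OF C inj tdeg S] by blast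
qed

section \<open>Descent to real symmetric directions\<close>

lemma lin_hom:
  assumes "comm_ring_hom f"
  shows "map_poly (map_poly f) (lin D C i j) = lin (\<lambda>i j. f (D i j)) (\<lambda>i j. f (C i j)) i j"
proof -
  interpret comm_ring_hom f by fact
  show ?thesis unfolding lin_def
    by (intro poly_eqI) (simp add: coeff_map_poly coeff_pCons hom_distribs split: nat.split)
qed

lemma lin_sym: "(\<And>i j. D i j = D j i) \<Longrightarrow> (\<And>i j. C i j = C j i) \<Longrightarrow> lin D C i j = lin D C j i"
  by (auto simp: lin_def)

text \<open>The cofactors of the real symmetric pencil are real and symmetric, so a complex solution
  may be replaced by its real part and then by its symmetric part.\<close>

lemma real_tangent:
  fixes D C :: "nat \<Rightarrow> nat \<Rightarrow> real"
  assumes D: "\<And>i j. D i j = D j i" and C: "\<And>i j. C i j = (if i = j then c i else 0)" and inj: "inj_on c {..<d}"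
    and nz: "\<And>x z. \<exists>i<d. \<exists>j<d. Cof d (\<lambda>i j. complex_of_real (D i j) + z * complex_of_real (C i j) + (if i = j then x else 0)) i j \<noteq> 0"
    and tdeg: "\<And>k j. k + j > d \<Longrightarrow> cf h k j = 0" and h: "coeff h d = 0"
  shows "\<exists>D' C'. (\<forall>i j. D' i j = D' j i) \<and> (\<forall>i j. i \<noteq> j \<longrightarrow> C' i j = 0) \<and>
    h = cofactor_comb d (lin D C) (\<lambda>i j. [:D' i j, C' i j:])"
proof -
  let ?c = "map_poly (map_poly complex_of_real)"
  interpret r: map_poly_comm_ring_hom complex_of_real ..
  interpret rr: map_poly_comm_ring_hom "map_poly complex_of_real" ..
  have cf_c: "cf (?c f) k j = complex_of_real (cf f k j)" for f k j
    by (simp add: coeff_map_poly)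
  obtain S where S: "?c h = cofactor_comb d (lin (\<lambda>i j. complex_of_real (D i j)) (\<lambda>i j. complex_of_real (C i j))) S"
    and deg: "\<And>i l. i < d \<Longrightarrow> l < d \<Longrightarrow> degree (S i l) \<le> 1"
    and off: "\<And>i l. i < d \<Longrightarrow> l < d \<Longrightarrow> i \<noteq> l \<Longrightarrow> coeff (S i l) 1 = 0"
    using complex_tangent[of "\<lambda>i j. complex_of_real (C i j)" "\<lambda>i. complex_of_real (c i)" d "\<lambda>i j. complex_of_real (D i j)" "?c h"]
      nz inj tdeg h by (fastforce simp: C inj_on_def cf_c coeff_map_poly)
  define A where "A = Cof d (lin D C)"
  have A: "Cof d (lin (\<lambda>i j. complex_of_real (D i j)) (\<lambda>i j. complex_of_real (C i j))) i j = ?c (A i j)" for i j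
    unfolding A_def rr.hom_Cof lin_hom[OF of_real_hom.comm_ring_hom_axioms] ..
  have A_sym: "A i j = A j i" for i j
    unfolding A_def
    by (subst Cof_transpose[symmetric]) (auto intro!: Cof_cong simp: lin_sym D C)
  have coeff_lin: "cf (smult p f) k j = coeff p 0 * cf f k j + coeff p 1 * (case j of 0 \<Rightarrow> 0 | Suc j \<Rightarrow> cf f k j)"
    if "degree p \<le> 1" for p :: "'b::comm_semiring_1 poly" and f k j
  proof -
    have "p = [:coeff p 0, coeff p 1:]"
      using that by (intro poly_eqI) (auto simp: coeff_pCons coeff_eq_0 split: nat.split)
    then have "coeff (p * coeff f k) j = coeff ([:coeff p 0, coeff p 1:] * coeff f k) j" by simp
    then show ?thesis by (simp add: coeff_pCons split: nat.split)
  qed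
  define R where "R i j = [:Re (coeff (S i j) 0), Re (coeff (S i j) 1):]" for i j
  have hR: "h = (\<Sum>i<d. \<Sum>l<d. smult (R i l) (A i l))"
  proof (intro poly_eqI)
    fix k j
    have "complex_of_real (cf h k j) = (\<Sum>i<d. \<Sum>l<d. coeff (S i l) 0 * of_real (cf (A i l) k j)
        + coeff (S i l) 1 * of_real (case j of 0 \<Rightarrow> 0 | Suc j \<Rightarrow> cf (A i l) k j))"
      unfolding cf_c[symmetric] S cofactor_comb_def coeff_sum A
      by (intro sum.cong refl, subst coeff_lin) (auto simp: deg[unfolded One_nat_def] cf_c split: nat.split)
    then have "cf h k j = Re (\<Sum>i<d. \<Sum>l<d. coeff (S i l) 0 * of_real (cf (A i l) k j)
        + coeff (S i l) 1 * of_real (case j of 0 \<Rightarrow> 0 | Suc j \<Rightarrow> cf (A i l) k j))"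
      by (metis Re_complex_of_real)
    also have "\<dots> = (\<Sum>i<d. \<Sum>l<d. cf (smult (R i l) (A i l)) k j)"
      by (subst coeff_lin) (auto simp: R_def split: nat.split)
    finally show "cf h k j = cf (\<Sum>i<d. \<Sum>l<d. smult (R i l) (A i l)) k j"
      by (simp add: coeff_sum)
  qed
  define D' where "D' i j = (if i < d \<and> j < d then (Re (coeff (S i j) 0) + Re (coeff (S j i) 0)) / 2 else 0)" for i j
  define C' where "C' i j = (if i = j then Re (coeff (S i i) 1) else 0)" for i j
  \<comment> \<open>Transposing the coefficients gives a second expression for \<open>h\<close>;
    \<open>D'\<close> and \<open>C'\<close> are the mean of the two.\<close>
  have "h = (\<Sum>l<d. \<Sum>i<d. smult (R i l) (A i l))"
    unfolding hR by (rule sum.swap)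
  also have "\<dots> = (\<Sum>i<d. \<Sum>l<d. smult (R l i) (A i l))"
    by (intro sum.cong refl) (simp add: A_sym)
  finally have hR': "h = (\<Sum>i<d. \<Sum>l<d. smult (R l i) (A i l))" .
  have "cofactor_comb d (lin D C) (\<lambda>i j. [:D' i j, C' i j:])
     = (\<Sum>i<d. \<Sum>l<d. smult [:1/2:] (smult (R i l) (A i l) + smult (R l i) (A i l)))"
    unfolding cofactor_comb_def A_def[symmetric]
  proof (intro sum.cong refl)
    fix i l assume "i \<in> {..<d}" "l \<in> {..<d}"
    then have "[:D' i l, C' i l:] = [:1/2:] * (R i l + R l i)"
      by (auto simp: R_def D'_def C'_def off[unfolded One_nat_def])
    then show "smult [:D' i l, C' i l:] (A i l) = smult [:1/2:] (smult (R i l) (A i l) + smult (R l i) (A i l))"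
      by (simp only: smult_smult smult_add_left[symmetric])
  qed
  also have "\<dots> = smult [:1/2:] (h + h)"
  proof -
    have "h + h = (\<Sum>i<d. \<Sum>l<d. smult (R i l) (A i l)) + (\<Sum>i<d. \<Sum>l<d. smult (R l i) (A i l))"
      using hR hR' by simp
    then show ?thesis by (simp only: sum.distrib[symmetric] smult_sum2)
  qed
  also have "\<dots> = h"
    by (simp only: smult_add_right smult_add_left[symmetric]) (simp add: one_pCons[symmetric])
  finally have "h = cofactor_comb d (lin D C) (\<lambda>i j. [:D' i j, C' i j:])" ..
  then show ?thesis by (intro exI[of _ D'] exI[of _ C']) (auto simp: D'_def C'_def add.commute)
qed

subsection \<open>Openness\<close>

text \<open>The dimension of the parameter space depends on \<open>d\<close>, so vectors are
  functions on a finite index set; \<open>l1\<close> is a seminorm that ignores coordinates outside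
  \<open>I\<close>.\<close>

definition l1 :: "'i set \<Rightarrow> ('i \<Rightarrow> real) \<Rightarrow> real" where
  "l1 I w = (\<Sum>i\<in>I. \<bar>w i\<bar>)"

text \<open>Strict derivative at the origin; \<open>f'\<close> is not assumed to be linear.\<close>

definition strict_deriv :: "'i set \<Rightarrow> (('i \<Rightarrow> real) \<Rightarrow> real) \<Rightarrow> (('i \<Rightarrow> real) \<Rightarrow> real) \<Rightarrow> bool" where
  "strict_deriv I f f' \<longleftrightarrow>
    (\<exists>B\<ge>0. \<forall>v w. \<bar>f' v - f' w\<bar> \<le> B * l1 I (\<lambda>i. v i - w i)) \<and>
    (\<forall>e>0. \<exists>r>0. \<forall>v w. l1 I v < r \<longrightarrow> l1 I w < r \<longrightarrow>
       \<bar>f v - f w - (f' v - f' w)\<bar> \<le> e * l1 I (\<lambda>i. v i - w i))"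

lemma l1_nonneg [simp]: "0 \<le> l1 I w"
  by (simp add: l1_def sum_nonneg)

lemma l1_zero [simp]: "l1 I (\<lambda>_. 0) = 0"
  by (simp add: l1_def)

lemma l1_triangle: "l1 I (\<lambda>i. v i + w i) \<le> l1 I v + l1 I w"
  unfolding l1_def sum.distrib[symmetric] by (intro sum_mono) auto

lemma component_le_l1: "finite I \<Longrightarrow> i \<in> I \<Longrightarrow> \<bar>w i\<bar> \<le> l1 I w"
  unfolding l1_def by (rule member_le_sum) auto

lemma strict_derivD:
  assumes "strict_deriv I f f'" "0 < e"
  shows "\<exists>r>0. \<forall>v w. l1 I v < r \<longrightarrow> l1 I w < r \<longrightarrow>
    \<bar>f v - f w - (f' v - f' w)\<bar> \<le> e * l1 I (\<lambda>i. v i - w i)"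
  using assms unfolding strict_deriv_def by simp

lemma strict_deriv_bounds:
  assumes "strict_deriv I f f'" "strict_deriv I g g'" "0 < e"
  obtains r where "r > 0"
    "\<And>v w. l1 I v < r \<Longrightarrow> l1 I w < r \<Longrightarrow> \<bar>f v - f w - (f' v - f' w)\<bar> \<le> e * l1 I (\<lambda>i. v i - w i)"
    "\<And>v w. l1 I v < r \<Longrightarrow> l1 I w < r \<Longrightarrow> \<bar>g v - g w - (g' v - g' w)\<bar> \<le> e * l1 I (\<lambda>i. v i - w i)"
proof -
  obtain r s where "r > 0" "s > 0"
    "\<forall>v w. l1 I v < r \<longrightarrow> l1 I w < r \<longrightarrow> \<bar>f v - f w - (f' v - f' w)\<bar> \<le> e * l1 I (\<lambda>i. v i - w i)"
    "\<forall>v w. l1 I v < s \<longrightarrow> l1 I w < s \<longrightarrow> \<bar>g v - g w - (g' v - g' w)\<bar> \<le> e * l1 I (\<lambda>i. v i - w i)"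
    using strict_derivD[OF assms(1,3)] strict_derivD[OF assms(2,3)] by auto
  then show thesis using that[of "min r s"] by simp
qed

lemma strict_deriv_isCont:
  assumes "strict_deriv I f f'" "0 < e"
  obtains r where "r > 0" "\<And>w. l1 I w < r \<Longrightarrow> \<bar>f w - f (\<lambda>_. 0)\<bar> \<le> e"
proof -
  obtain B where B: "B \<ge> 0" "\<And>v w. \<bar>f' v - f' w\<bar> \<le> B * l1 I (\<lambda>i. v i - w i)"
    using assms unfolding strict_deriv_def by blast
  obtain r where r: "r > 0" "\<And>v w. l1 I v < r \<Longrightarrow> l1 I w < r \<Longrightarrow> \<bar>f v - f w - (f' v - f' w)\<bar> \<le> 1 * l1 I (\<lambda>i. v i - w i)"
    using strict_derivD[OF assms(1), of 1] by auto
  show thesis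
  proof (rule that[of "min r (e / (B + 1))"])
    show "0 < min r (e / (B + 1))" using r B assms by auto
    fix w assume w: "l1 I w < min r (e / (B + 1))"
    have "\<bar>f w - f (\<lambda>_. 0) - (f' w - f' (\<lambda>_. 0))\<bar> \<le> l1 I w"
      using r(2)[of w "\<lambda>_. 0"] w r(1) by simp
    moreover have "\<bar>f' w - f' (\<lambda>_. 0)\<bar> \<le> B * l1 I w"
      using B(2)[of w "\<lambda>_. 0"] by simp
    ultimately have "\<bar>f w - f (\<lambda>_. 0)\<bar> \<le> (B + 1) * l1 I w"
      unfolding distrib_right by linarith
    also have "\<dots> \<le> (B + 1) * (e / (B + 1))"
      using w B by (intro mult_left_mono) auto
    also have "\<dots> = e" using B by simp
    finally show "\<bar>f w - f (\<lambda>_. 0)\<bar> \<le> e" .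
  qed
qed

lemma strict_deriv_add:
  assumes f: "strict_deriv I f f'" and g: "strict_deriv I g g'"
  shows "strict_deriv I (\<lambda>w. f w + g w) (\<lambda>w. f' w + g' w)"
proof -
  obtain A B where AB: "A \<ge> 0" "B \<ge> 0" "\<And>v w. \<bar>f' v - f' w\<bar> \<le> A * l1 I (\<lambda>i. v i - w i)"
    "\<And>v w. \<bar>g' v - g' w\<bar> \<le> B * l1 I (\<lambda>i. v i - w i)"
    using f g unfolding strict_deriv_def by blast
  have "\<bar>f' v + g' v - (f' w + g' w)\<bar> \<le> (A + B) * l1 I (\<lambda>i. v i - w i)" for v w
    using AB(3,4)[of v w] unfolding distrib_right by linarith
  moreover have "\<exists>r>0. \<forall>v w. l1 I v < r \<longrightarrow> l1 I w < r \<longrightarrow>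
       \<bar>f v + g v - (f w + g w) - (f' v + g' v - (f' w + g' w))\<bar> \<le> e * l1 I (\<lambda>i. v i - w i)" if e: "e > 0" for e
  proof -
    obtain r where r: "r > 0"
      "\<And>v w. l1 I v < r \<Longrightarrow> l1 I w < r \<Longrightarrow> \<bar>f v - f w - (f' v - f' w)\<bar> \<le> e / 2 * l1 I (\<lambda>i. v i - w i)"
      "\<And>v w. l1 I v < r \<Longrightarrow> l1 I w < r \<Longrightarrow> \<bar>g v - g w - (g' v - g' w)\<bar> \<le> e / 2 * l1 I (\<lambda>i. v i - w i)"
      using strict_deriv_bounds[OF f g half_gt_zero[OF e]] by blast
    have "\<bar>f v + g v - (f w + g w) - (f' v + g' v - (f' w + g' w))\<bar> \<le> e * l1 I (\<lambda>i. v i - w i)"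
      if "l1 I v < r" "l1 I w < r" for v w
    proof -
      have "e * l1 I (\<lambda>i. v i - w i) = e / 2 * l1 I (\<lambda>i. v i - w i) + e / 2 * l1 I (\<lambda>i. v i - w i)"
        by simp
      then show ?thesis using r(2)[OF that] r(3)[OF that] by linarith
    qed
    then show ?thesis using r(1) by blast
  qed
  ultimately show ?thesis
    unfolding strict_deriv_def using add_nonneg_nonneg[OF AB(1,2)] by blast
qed

lemma strict_deriv_mult:
  assumes f: "strict_deriv I f f'" and g: "strict_deriv I g g'"
  shows "strict_deriv I (\<lambda>w. f w * g w) (\<lambda>w. f' w * g (\<lambda>_. 0) + f (\<lambda>_. 0) * g' w)"
proof -
  define a b where "a = f (\<lambda>_. 0)" and "b = g (\<lambda>_. 0)"
  obtain A B where AB: "A \<ge> 0" "B \<ge> 0" "\<And>v w. \<bar>f' v - f' w\<bar> \<le> A * l1 I (\<lambda>i. v i - w i)"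
    "\<And>v w. \<bar>g' v - g' w\<bar> \<le> B * l1 I (\<lambda>i. v i - w i)"
    using f g unfolding strict_deriv_def by blast
  have "\<bar>f' v * b + a * g' v - (f' w * b + a * g' w)\<bar> \<le> (A * \<bar>b\<bar> + \<bar>a\<bar> * B) * l1 I (\<lambda>i. v i - w i)" for v w
  proof -
    have "\<bar>f' v * b + a * g' v - (f' w * b + a * g' w)\<bar> = \<bar>(f' v - f' w) * b + a * (g' v - g' w)\<bar>"
      by (simp add: algebra_simps)
    also have "\<dots> \<le> \<bar>f' v - f' w\<bar> * \<bar>b\<bar> + \<bar>a\<bar> * \<bar>g' v - g' w\<bar>"
      by (simp add: abs_mult[symmetric])
    also have "\<dots> \<le> (A * l1 I (\<lambda>i. v i - w i)) * \<bar>b\<bar> + \<bar>a\<bar> * (B * l1 I (\<lambda>i. v i - w i))"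
      using AB by (intro add_mono mult_left_mono mult_right_mono) auto
    finally show ?thesis by (simp add: algebra_simps)
  qed
  moreover have "\<exists>r>0. \<forall>v w. l1 I v < r \<longrightarrow> l1 I w < r \<longrightarrow>
       \<bar>f v * g v - f w * g w - (f' v * b + a * g' v - (f' w * b + a * g' w))\<bar> \<le> e * l1 I (\<lambda>i. v i - w i)" if "e > 0" for e
  proof -
    \<comment> \<open>Half of \<open>e\<close> pays for the two remainders, which are multiplied by
      values of size at most |b| + 1 and |a| + 1; the other half pays for the derivatives multiplied
      by the oscillations of \<open>f\<close> and \<open>g\<close>. The cap 1 in \<open>e2\<close>
      yields those bounds on the values.\<close>
    define e1 e2 where "e1 = e / (2 * (\<bar>a\<bar> + \<bar>b\<bar> + 2))" and "e2 = min 1 (e / (2 * (A + B + 1)))"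
    have e: "e1 > 0" "e2 > 0" using that AB by (auto simp: e1_def e2_def)
    obtain r where r: "r > 0"
      "\<And>v w. l1 I v < r \<Longrightarrow> l1 I w < r \<Longrightarrow> \<bar>f v - f w - (f' v - f' w)\<bar> \<le> e1 * l1 I (\<lambda>i. v i - w i)"
      "\<And>v w. l1 I v < r \<Longrightarrow> l1 I w < r \<Longrightarrow> \<bar>g v - g w - (g' v - g' w)\<bar> \<le> e1 * l1 I (\<lambda>i. v i - w i)"
      using strict_deriv_bounds[OF f g e(1)] by auto
    obtain s where s: "s > 0" "\<And>w. l1 I w < s \<Longrightarrow> \<bar>f w - a\<bar> \<le> e2"
      using strict_deriv_isCont[OF f e(2)] unfolding a_def by blast
    obtain t where t: "t > 0" "\<And>w. l1 I w < t \<Longrightarrow> \<bar>g w - b\<bar> \<le> e2"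
      using strict_deriv_isCont[OF g e(2)] unfolding b_def by blast
    have "\<bar>f v * g v - f w * g w - (f' v * b + a * g' v - (f' w * b + a * g' w))\<bar> \<le> e * l1 I (\<lambda>i. v i - w i)"
      if v: "l1 I v < min r (min s t)" and w: "l1 I w < min r (min s t)" for v w
    proof -
      let ?n = "l1 I (\<lambda>i. v i - w i)"
      have "f v * g v - f w * g w - (f' v * b + a * g' v - (f' w * b + a * g' w))
        = (f v - f w - (f' v - f' w)) * g v + (f' v - f' w) * (g v - b)
          + f w * (g v - g w - (g' v - g' w)) + (f w - a) * (g' v - g' w)" (is "?l = ?x1 + ?x2 + ?x3 + ?x4")
        by (simp add: algebra_simps)
      then have "\<bar>?l\<bar> \<le> \<bar>?x1\<bar> + \<bar>?x2\<bar> + \<bar>?x3\<bar> + \<bar>?x4\<bar>" by linarith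
      also have "\<dots> \<le> (e1 * ?n) * (\<bar>b\<bar> + 1) + (A * ?n) * e2 + (\<bar>a\<bar> + 1) * (e1 * ?n) + e2 * (B * ?n)"
      proof (intro add_mono)
        have gv: "\<bar>g v\<bar> \<le> \<bar>b\<bar> + 1" and fw: "\<bar>f w\<bar> \<le> \<bar>a\<bar> + 1"
          using t(2)[of v] s(2)[of w] v w by (auto simp: e2_def)
        show "\<bar>?x1\<bar> \<le> (e1 * ?n) * (\<bar>b\<bar> + 1)"
          unfolding abs_mult using r(2)[of v w] v w gv e by (intro mult_mono) auto
        show "\<bar>?x2\<bar> \<le> (A * ?n) * e2"
          unfolding abs_mult using AB(1,3) t(2)[of v] v by (intro mult_mono) auto
        show "\<bar>?x3\<bar> \<le> (\<bar>a\<bar> + 1) * (e1 * ?n)"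
          unfolding abs_mult using r(3)[of v w] v w fw by (intro mult_mono) auto
        show "\<bar>?x4\<bar> \<le> e2 * (B * ?n)"
          unfolding abs_mult using AB(2,4) s(2)[of w] w e by (intro mult_mono) auto
      qed
      also have "\<dots> = (e1 * (\<bar>a\<bar> + \<bar>b\<bar> + 2) + e2 * (A + B)) * ?n"
        by (simp add: algebra_simps)
      also have "\<dots> \<le> e * ?n"
      proof (intro mult_right_mono)
        have "e1 * (\<bar>a\<bar> + \<bar>b\<bar> + 2) = e / 2" by (simp add: e1_def field_simps)
        moreover have "e2 * (A + B) \<le> e / (2 * (A + B + 1)) * (A + B)"
          using AB by (intro mult_right_mono) (auto simp: e2_def)
        moreover have "e / (2 * (A + B + 1)) * (A + B) \<le> e / 2"
          using AB \<open>e > 0\<close> by (simp add: field_simps)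
        ultimately show "e1 * (\<bar>a\<bar> + \<bar>b\<bar> + 2) + e2 * (A + B) \<le> e" by linarith
      qed auto
      finally show ?thesis .
    qed
    then show ?thesis using r(1) s(1) t(1) by (intro exI[of _ "min r (min s t)"]) simp
  qed
  moreover have "A * \<bar>b\<bar> + \<bar>a\<bar> * B \<ge> 0" using AB by simp
  ultimately show ?thesis unfolding strict_deriv_def a_def b_def by blast
qed

lemma strict_deriv_affine:
  assumes "finite I"
  shows "strict_deriv I (\<lambda>w. a + (\<Sum>i\<in>I. w i * b i)) (\<lambda>w. \<Sum>i\<in>I. w i * b i)"
proof -
  have "\<bar>(\<Sum>i\<in>I. v i * b i) - (\<Sum>i\<in>I. w i * b i)\<bar> \<le> (\<Sum>i\<in>I. \<bar>b i\<bar>) * l1 I (\<lambda>i. v i - w i)" for v w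
  proof -
    have "\<bar>(\<Sum>i\<in>I. v i * b i) - (\<Sum>i\<in>I. w i * b i)\<bar> = \<bar>\<Sum>i\<in>I. (v i - w i) * b i\<bar>"
      by (simp add: sum_subtractf left_diff_distrib)
    also have "\<dots> \<le> (\<Sum>i\<in>I. \<bar>(v i - w i) * b i\<bar>)" by (rule sum_abs)
    also have "\<dots> \<le> (\<Sum>i\<in>I. l1 I (\<lambda>i. v i - w i) * \<bar>b i\<bar>)"
      unfolding abs_mult using component_le_l1[OF assms, of _ "\<lambda>i. v i - w i"]
      by (intro sum_mono mult_right_mono) auto
    finally show ?thesis by (simp add: sum_distrib_right mult.commute)
  qed
  moreover have "(\<Sum>i\<in>I. \<bar>b i\<bar>) \<ge> 0" by (simp add: sum_nonneg)
  moreover have "\<exists>r>0. \<forall>v w. l1 I v < r \<longrightarrow> l1 I w < r \<longrightarrow>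
      \<bar>a + (\<Sum>i\<in>I. v i * b i) - (a + (\<Sum>i\<in>I. w i * b i)) - ((\<Sum>i\<in>I. v i * b i) - (\<Sum>i\<in>I. w i * b i))\<bar>
       \<le> e * l1 I (\<lambda>i. v i - w i)" if "e > 0" for e
    using that by (intro exI[of _ 1]) simp
  ultimately show ?thesis unfolding strict_deriv_def by blast
qed

lemma strict_deriv_rule: "derivation_rule (strict_deriv I) (\<lambda>_. 0)"
proof
  show "strict_deriv I (\<lambda>_. of_int c) (\<lambda>_. 0)" for c
    unfolding strict_deriv_def by (auto intro!: exI[of _ 0] exI[of _ 1])
qed (rule strict_deriv_add strict_deriv_mult; assumption)+

text \<open>Newton's iteration with the derivative frozen: w + (q - phi w) contracts by 1/2 near the
  origin. With the identity as derivative no linear map has to be inverted; this is arranged by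
  taking, for each coefficient, a direction that changes it alone to first order.\<close>

lemma local_surjectivity:
  fixes phi :: "('i \<Rightarrow> real) \<Rightarrow> 'i \<Rightarrow> real"
  assumes fin: "finite I" and phi: "\<And>i. i \<in> I \<Longrightarrow> strict_deriv I (\<lambda>w. phi w i) (\<lambda>w. w i)"
  shows "\<exists>e>0. \<forall>q. l1 I (\<lambda>i. q i - phi (\<lambda>_. 0) i) < e \<longrightarrow> (\<exists>w. \<forall>i\<in>I. phi w i = q i)"
proof -
  \<comment> \<open>The estimate is summed over all components, hence the factor
    \<open>card I\<close>.\<close>
  define e0 where "e0 = 1 / (2 * (real (card I) + 1))"
  have e0: "e0 > 0" "card I * e0 \<le> 1 / 2" by (auto simp: e0_def field_simps)
  have "\<forall>i\<in>I. \<exists>r>0. \<forall>v w. l1 I v < r \<longrightarrow> l1 I w < r \<longrightarrow>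
     \<bar>phi v i - phi w i - (v i - w i)\<bar> \<le> e0 * l1 I (\<lambda>i. v i - w i)"
    using strict_derivD[OF phi e0(1)] by blast
  then obtain R where R: "\<And>i. i \<in> I \<Longrightarrow> R i > 0"
    "\<And>i v w. i \<in> I \<Longrightarrow> l1 I v < R i \<Longrightarrow> l1 I w < R i \<Longrightarrow>
      \<bar>phi v i - phi w i - (v i - w i)\<bar> \<le> e0 * l1 I (\<lambda>i. v i - w i)"
    by metis
  define r where "r = Min (insert 1 (R ` I))"
  have r: "r > 0" "\<And>i. i \<in> I \<Longrightarrow> r \<le> R i"
    using fin R(1) by (auto simp: r_def)
  have near: "\<bar>phi v i - phi w i - (v i - w i)\<bar> \<le> e0 * l1 I (\<lambda>i. v i - w i)"
    if "i \<in> I" "l1 I v < r" "l1 I w < r" for i v w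
    using R(2)[OF that(1)] r(2)[OF that(1)] that by force
  have contr: "l1 I (\<lambda>i. (v i - w i) - (phi v i - phi w i)) \<le> l1 I (\<lambda>i. v i - w i) / 2"
    if "l1 I v < r" "l1 I w < r" for v w
  proof -
    have "l1 I (\<lambda>i. (v i - w i) - (phi v i - phi w i)) \<le> (\<Sum>i\<in>I. e0 * l1 I (\<lambda>i. v i - w i))"
      unfolding l1_def[of I "\<lambda>i. (v i - w i) - (phi v i - phi w i)"]
      using near[OF _ that] by (intro sum_mono) (simp add: abs_minus_commute)
    also have "\<dots> = (card I * e0) * l1 I (\<lambda>i. v i - w i)" by simp
    also have "\<dots> \<le> (1 / 2) * l1 I (\<lambda>i. v i - w i)" by (intro mult_right_mono e0) simp
    finally show ?thesis by simp
  qed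
  have "\<exists>w. \<forall>i\<in>I. phi w i = q i" if q: "l1 I (\<lambda>i. q i - phi (\<lambda>_. 0) i) < r / 2" for q
  proof -
    define e where "e = l1 I (\<lambda>i. q i - phi (\<lambda>_. 0) i)"
    define x where "x = rec_nat (\<lambda>_. 0) (\<lambda>_ w i. w i + (q i - phi w i))"
    have x0: "x 0 = (\<lambda>_. 0)" and xS: "x (Suc n) = (\<lambda>i. x n i + (q i - phi (x n) i))" for n
      by (simp_all add: x_def)
    \<comment> \<open>The steps halve, so all iterates stay within 2 e of the origin;
      \<open>q\<close> lies within r / 2 of the starting value, so this is inside the ball of
      contraction.\<close>
    have step: "l1 I (x n) \<le> 2 * e * (1 - (1/2)^n) \<and> l1 I (\<lambda>i. x (Suc n) i - x n i) \<le> e * (1/2)^n" for n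
    proof (induction n)
      case 0
      then show ?case by (simp add: x0 xS e_def)
    next
      case (Suc n)
      have "l1 I (x (Suc n)) \<le> l1 I (x n) + l1 I (\<lambda>i. x (Suc n) i - x n i)"
        using l1_triangle[of I "x n" "\<lambda>i. x (Suc n) i - x n i"] by simp
      also have "\<dots> \<le> 2 * e * (1 - (1/2)^n) + e * (1/2)^n" using Suc by linarith
      finally have 1: "l1 I (x (Suc n)) \<le> 2 * e * (1 - (1/2)^Suc n)" by (simp add: algebra_simps)
      have small: "2 * e * (1 - (1/2)^m) < r" for m
      proof -
        have "e \<ge> 0" by (simp add: e_def)
        then have "2 * e * (1 - (1/2)^m) \<le> 2 * e" by (simp add: mult_left_le)
        then show ?thesis using q by (simp add: e_def)
      qed
      have "(\<lambda>i. x (Suc (Suc n)) i - x (Suc n) i) = (\<lambda>i. (x (Suc n) i - x n i) - (phi (x (Suc n)) i - phi (x n) i))"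
        by (auto simp: xS)
      moreover have "l1 I (x n) < r" "l1 I (x (Suc n)) < r"
        using Suc 1 small[of n] small[of "Suc n"] by linarith+
      ultimately have "l1 I (\<lambda>i. x (Suc (Suc n)) i - x (Suc n) i) \<le> l1 I (\<lambda>i. x (Suc n) i - x n i) / 2"
        using contr by simp
      with Suc 1 show ?case by simp
    qed
    have conv: "convergent (\<lambda>n. x n i)" if i: "i \<in> I" for i
    proof -
      have "summable (\<lambda>n. x (Suc n) i - x n i)"
      proof (rule summable_comparison_test')
        show "summable (\<lambda>n. e * (1/2)^n)" by (intro summable_mult summable_geometric) simp
        show "norm (x (Suc n) i - x n i) \<le> e * (1/2)^n" if "n \<ge> 0" for n
          using component_le_l1[OF fin i, of "\<lambda>i. x (Suc n) i - x n i"] step[of n] by simp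
      qed
      then have "convergent (\<lambda>n. \<Sum>k<n. x (Suc k) i - x k i)"
        by (simp add: summable_iff_convergent)
      moreover have "(\<Sum>k<n. x (Suc k) i - x k i) = x n i" for n
        using sum_lessThan_telescope[of "\<lambda>k. x k i" n] by (simp add: x0)
      ultimately show ?thesis by simp
    qed
    define w where "w i = lim (\<lambda>n. x n i)" for i
    have w: "(\<lambda>n. x n i) \<longlonglongrightarrow> w i" if "i \<in> I" for i
      using conv[OF that] unfolding w_def by (simp add: convergent_LIMSEQ_iff)
    have l1_lim: "(\<lambda>n. l1 I (\<lambda>i. w i - x n i)) \<longlonglongrightarrow> 0"
    proof -
      have "(\<lambda>n. l1 I (\<lambda>i. w i - x n i)) \<longlonglongrightarrow> (\<Sum>i\<in>I. \<bar>w i - w i\<bar>)"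
        unfolding l1_def by (intro tendsto_intros w)
      then show ?thesis by simp
    qed
    have e: "0 \<le> e" "2 * e < r" using q by (auto simp: e_def)
    have xr: "l1 I (x n) \<le> 2 * e" for n
    proof -
      have "2 * e * (1 - (1/2)^n) \<le> 2 * e" using e(1) by (simp add: mult_left_le)
      then show ?thesis using step[of n] by linarith
    qed
    have "(\<lambda>n. l1 I (x n)) \<longlonglongrightarrow> l1 I w"
      unfolding l1_def by (intro tendsto_intros w)
    then have "l1 I w \<le> 2 * e" by (rule LIMSEQ_le_const2) (use xr in blast)
    then have wr: "l1 I w < r" using e by simp
    have "phi w i = q i" if i: "i \<in> I" for i
    proof -
      have "(\<lambda>n. x (Suc n) i - x n i) \<longlonglongrightarrow> w i - w i"
        by (intro tendsto_diff LIMSEQ_Suc w i)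
      then have lim1: "(\<lambda>n. phi (x n) i) \<longlonglongrightarrow> q i"
        using tendsto_diff[OF tendsto_const[of "q i"]] by (fastforce simp: xS)
      have "(\<lambda>n. phi w i - phi (x n) i - (w i - x n i)) \<longlonglongrightarrow> 0"
      proof (rule Lim_null_comparison)
        show "\<forall>\<^sub>F n in sequentially. norm (phi w i - phi (x n) i - (w i - x n i)) \<le> e0 * l1 I (\<lambda>i. w i - x n i)"
          using near[OF i wr] xr e by (intro always_eventually) (auto intro: order_le_less_trans)
        show "(\<lambda>n. e0 * l1 I (\<lambda>i. w i - x n i)) \<longlonglongrightarrow> 0"
          using tendsto_mult_left[OF l1_lim, of e0] by simp
      qed
      from tendsto_add[OF this tendsto_diff[OF tendsto_const[of "w i"] w[OF i]]]
      have "(\<lambda>n. phi w i - phi (x n) i) \<longlonglongrightarrow> 0" by simp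
      from tendsto_diff[OF tendsto_const[of "phi w i"] this]
      have "(\<lambda>n. phi (x n) i) \<longlonglongrightarrow> phi w i" by simp
      with lim1 show ?thesis using LIMSEQ_unique by blast
    qed
    then show ?thesis by blast
  qed
  then show ?thesis using r(1) by (intro exI[of _ "r / 2"]) simp
qed

section \<open>Monic forms and openness of representability\<close>

definition total_degree_le :: "nat \<Rightarrow> 'a::zero poly poly \<Rightarrow> bool" where
  "total_degree_le n f \<longleftrightarrow> (\<forall>k j. k + j > n \<longrightarrow> cf f k j = 0)"

text \<open>In the chart y = 1 the forms of degree \<open>d\<close> become the polynomials of total
  degree at most \<open>d\<close> in x and z; the first condition then expresses F(1,0,0) =
  1.\<close>

definition monic_form :: "nat \<Rightarrow> real poly poly \<Rightarrow> bool" where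
  "monic_form d f \<longleftrightarrow> coeff f d = 1 \<and> total_degree_le d f"

lemma total_degree_le_sum:
  fixes f :: "'i \<Rightarrow> 'a::comm_monoid_add poly poly"
  shows "(\<And>i. i \<in> I \<Longrightarrow> total_degree_le n (f i)) \<Longrightarrow> total_degree_le n (\<Sum>i\<in>I. f i)"
  by (simp add: total_degree_le_def coeff_sum)

lemma total_degree_le_mult:
  fixes f g :: "'a::comm_semiring_0 poly poly"
  assumes "total_degree_le m f" "total_degree_le n g"
  shows "total_degree_le (m + n) (f * g)"
  unfolding total_degree_le_def
proof (intro allI impI)
  fix k j assume kj: "m + n < k + j"
  have "cf (f * g) k j = (\<Sum>a\<le>k. \<Sum>b\<le>j. cf f a b * cf g (k - a) (j - b))"
    by (simp add: coeff_mult coeff_sum)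
  also have "\<dots> = 0"
  proof (intro sum.neutral ballI)
    fix a b assume "a \<in> {..k}" "b \<in> {..j}"
    then have "a + b > m \<or> (k - a) + (j - b) > n" using kj by auto
    then show "cf f a b * cf g (k - a) (j - b) = 0"
      using assms unfolding total_degree_le_def by auto
  qed
  finally show "cf (f * g) k j = 0" .
qed

lemma total_degree_le_prod:
  fixes f :: "'i \<Rightarrow> 'a::comm_semiring_1 poly poly"
  assumes "finite I" "\<And>i. i \<in> I \<Longrightarrow> total_degree_le (m i) (f i)"
  shows "total_degree_le (\<Sum>i\<in>I. m i) (\<Prod>i\<in>I. f i)"
  using assms
proof (induction I rule: finite_induct)
  case empty
  show ?case by (simp add: total_degree_le_def)
next
  case (insert x F)
  then show ?case by (simp add: total_degree_le_mult)
qed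

lemma total_degree_le_const: "total_degree_le 0 [:[:a:]:]"
  by (auto simp: total_degree_le_def coeff_pCons split: nat.split)

lemma total_degree_le_lin: "total_degree_le 1 (lin D C i j)"
  by (auto simp: total_degree_le_def lin_def coeff_pCons split: nat.splits)

lemma monic_form_Det: "monic_form d (Det d (lin D C))"
  unfolding monic_form_def
proof
  show "coeff (Det d (lin D C)) d = 1"
    unfolding lin_def by (rule Det_monic)
  have "total_degree_le d (of_int (sign p) * (\<Prod>i = 0..<d. lin D C i (p i)))" for p :: "nat \<Rightarrow> nat"
  proof -
    have "total_degree_le 0 (of_int (sign p) :: real poly poly)"
      using total_degree_le_const[of "of_int (sign p) :: real"] by (simp add: of_int_poly)
    moreover have "total_degree_le (\<Sum>i = 0..<d. 1) (\<Prod>i = 0..<d. lin D C i (p i))"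
      by (rule total_degree_le_prod) (simp_all add: total_degree_le_lin[simplified])
    ultimately show ?thesis using total_degree_le_mult by fastforce
  qed
  then show "total_degree_le d (Det d (lin D C))"
    unfolding Det_alt by (intro total_degree_le_sum) auto
qed

text \<open>With \<open>C\<close> diagonal the number of free parameters of \<open>(D, C)\<close> equals that of a monic form.\<close>

definition representable :: "nat \<Rightarrow> real poly poly \<Rightarrow> bool" where
  "representable d f \<longleftrightarrow> (\<exists>D c. (\<forall>i j. D i j = D j i) \<and>
     f = Det d (lin D (\<lambda>i j. if i = j then c i else 0)))"

text \<open>For each free monomial a direction \<open>(D', C')\<close> is chosen whose image under
  the differential is exactly that monomial. In the coordinates \<open>w\<close> along these
  directions the coefficient map has the identity as derivative at 0.\<close>

lemma representable_nbhd:
  fixes D :: "nat \<Rightarrow> nat \<Rightarrow> real" and c :: "nat \<Rightarrow> real"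
  defines "C \<equiv> \<lambda>i j. if i = j then c i else 0"
  assumes D: "\<And>i j. D i j = D j i" and inj: "inj_on c {..<d}"
    and nz: "\<And>x z. \<exists>i<d. \<exists>j<d. Cof d (\<lambda>i j. complex_of_real (D i j) + z * complex_of_real (C i j) + (if i = j then x else 0)) i j \<noteq> 0"
  shows "\<exists>e>0. \<forall>g. monic_form d g \<longrightarrow> (\<forall>k\<le>d. \<forall>j\<le>d. \<bar>cf g k j - cf (Det d (lin D C)) k j\<bar> < e) \<longrightarrow> representable d g"
proof -
  \<comment> \<open>The positions of the free coefficients: in the row k = d a monic form has no
    freedom, and beyond total degree \<open>d\<close> all coefficients vanish.\<close>
  define I where "I = {(k, j). k < d \<and> k + j \<le> d}"
  have fin: "finite I"
    by (rule finite_subset[of _ "{..d} \<times> {..d}"]) (auto simp: I_def)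
  define Q where "Q p D' C' \<longleftrightarrow> (\<forall>i j. D' i j = D' j i) \<and> (\<forall>i j. i \<noteq> j \<longrightarrow> C' i j = 0) \<and>
    monom (monom 1 (snd p)) (fst p) = cofactor_comb d (lin D C) (\<lambda>i j. [:D' i j, C' i j:])" for p D' C'
  have "\<exists>D' C'. Q p D' C'" if "p \<in> I" for p
    unfolding Q_def
  proof (rule real_tangent[where c = c, OF D _ inj nz])
    show "C i j = (if i = j then c i else 0)" for i j by (simp add: C_def)
    show "cf (monom (monom 1 (snd p)) (fst p)) k j = 0" if "k + j > d" for k j
      using that \<open>p \<in> I\<close> by (auto simp: I_def)
    show "coeff (monom (monom 1 (snd p)) (fst p)) d = 0"
      using \<open>p \<in> I\<close> by (auto simp: I_def)
  qed
  then obtain D' C' where Q: "\<And>p. p \<in> I \<Longrightarrow> Q p (D' p) (C' p)" by metis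
  have DC: "D' p i j = D' p j i" "i \<noteq> j \<Longrightarrow> C' p i j = 0"
    "cofactor_comb d (lin D C) (\<lambda>i j. [:D' p i j, C' p i j:]) = monom (monom 1 (snd p)) (fst p)"
    if "p \<in> I" for p i j
    using Q[OF that] unfolding Q_def by auto
  define Dw where "Dw w i j = D i j + (\<Sum>p\<in>I. w p * D' p i j)" for w i j
  define Cw where "Cw w i j = C i j + (\<Sum>p\<in>I. w p * C' p i j)" for w i j
  define A where "A w i j = [:[:\<Sum>p\<in>I. w p * D' p i j, \<Sum>p\<in>I. w p * C' p i j:]:]" for w i j
  define phi where "phi w p = cf (Det d (lin (Dw w) (Cw w))) (fst p) (snd p)" for w p
  have Dw0: "Dw (\<lambda>_. 0) = D" by (intro ext) (simp add: Dw_def)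
  have Cw0: "Cw (\<lambda>_. 0) = C" by (intro ext) (simp add: Cw_def)
  interpret r: derivation_rule "strict_deriv I" "\<lambda>_. 0" by (rule strict_deriv_rule)
  interpret rp: derivation_rule "\<lambda>f f'. \<forall>k. strict_deriv I (\<lambda>w. coeff (f w) k) (\<lambda>w. coeff (f' w) k)" "\<lambda>_. 0"
    by (rule r.lift_poly)
  interpret rpp: derivation_rule "\<lambda>f f'. \<forall>j k. strict_deriv I (\<lambda>w. cf (f w) j k) (\<lambda>w. cf (f' w) j k)" "\<lambda>_. 0"
    by (rule rp.lift_poly)
  have "strict_deriv I (\<lambda>w. cf (lin (Dw w) (Cw w) i j) a b) (\<lambda>w. cf (A w i j) a b)" for i j a b
  proof -
    define B where "B p = cf [:[:D' p i j, C' p i j:]:] a b" for p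
    have "cf (lin (Dw w) (Cw w) i j) a b = cf (lin D C i j) a b + (\<Sum>p\<in>I. w p * B p)" for w
      unfolding B_def by (auto simp: lin_def Dw_def Cw_def coeff_pCons split: nat.split)
    moreover have "cf (A w i j) a b = (\<Sum>p\<in>I. w p * B p)" for w
      unfolding B_def by (auto simp: A_def coeff_pCons split: nat.split)
    ultimately show ?thesis using strict_deriv_affine[OF fin] by presburger
  qed
  then have der: "strict_deriv I (\<lambda>w. cf (Det d (lin (Dw w) (Cw w))) k l)
     (\<lambda>w. cf (\<Sum>i<d. \<Sum>j<d. A w i j * Cof d (lin D C) i j) k l)" for k l
    using rpp.Det[of "\<lambda>w. lin (Dw w) (Cw w)" A d] unfolding Dw0 Cw0 by blast
  have sumA: "(\<Sum>i<d. \<Sum>j<d. A w i j * Cof d (lin D C) i j) = (\<Sum>p\<in>I. smult [:w p:] (monom (monom 1 (snd p)) (fst p)))" for w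
  proof -
    have "A w i j * X = (\<Sum>p\<in>I. smult [:w p:] (smult [:D' p i j, C' p i j:] X))" for i j and X :: "real poly poly"
    proof -
      have "[:\<Sum>p\<in>I. w p * D' p i j, \<Sum>p\<in>I. w p * C' p i j:] = (\<Sum>p\<in>I. [:w p:] * [:D' p i j, C' p i j:])"
        by (intro poly_eqI) (simp add: coeff_sum coeff_pCons mult.commute split: nat.split)
      then show ?thesis by (simp add: A_def smult_sum)
    qed
    then have "(\<Sum>i<d. \<Sum>j<d. A w i j * Cof d (lin D C) i j)
       = (\<Sum>i<d. \<Sum>j<d. \<Sum>p\<in>I. smult [:w p:] (smult [:D' p i j, C' p i j:] (Cof d (lin D C) i j)))"
      by simp
    also have "\<dots> = (\<Sum>i<d. \<Sum>p\<in>I. \<Sum>j<d. smult [:w p:] (smult [:D' p i j, C' p i j:] (Cof d (lin D C) i j)))"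
      by (intro sum.cong refl sum.swap)
    also have "\<dots> = (\<Sum>p\<in>I. \<Sum>i<d. \<Sum>j<d. smult [:w p:] (smult [:D' p i j, C' p i j:] (Cof d (lin D C) i j)))"
      by (rule sum.swap)
    also have "\<dots> = (\<Sum>p\<in>I. smult [:w p:] (cofactor_comb d (lin D C) (\<lambda>i j. [:D' p i j, C' p i j:])))"
      unfolding cofactor_comb_def smult_sum2 ..
    finally show ?thesis by (simp add: DC(3) cong: sum.cong)
  qed
  have "strict_deriv I (\<lambda>w. phi w p) (\<lambda>w. w p)" if p: "p \<in> I" for p
  proof -
    have "cf (\<Sum>i<d. \<Sum>j<d. A w i j * Cof d (lin D C) i j) (fst p) (snd p) = w p" for w
    proof -
      have "cf (\<Sum>i<d. \<Sum>j<d. A w i j * Cof d (lin D C) i j) (fst p) (snd p)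
        = (\<Sum>q\<in>I. if q = p then w p else 0)"
        unfolding sumA coeff_sum
        by (intro sum.cong refl) (auto simp: prod_eq_iff)
      then show ?thesis using p fin by simp
    qed
    then show ?thesis using der[of "fst p" "snd p"] unfolding phi_def by simp
  qed
  from local_surjectivity[OF fin this]
  obtain e where e: "e > 0" "\<And>q. l1 I (\<lambda>p. q p - phi (\<lambda>_. 0) p) < e \<Longrightarrow> \<exists>w. \<forall>p\<in>I. phi w p = q p"
    by blast
  have "representable d g"
    if g: "monic_form d g" and near: "\<forall>k\<le>d. \<forall>j\<le>d. \<bar>cf g k j - cf (Det d (lin D C)) k j\<bar> < e / (card I + 1)" for g
  proof -
    define q where "q p = cf g (fst p) (snd p)" for p
    have "l1 I (\<lambda>p. q p - phi (\<lambda>_. 0) p) \<le> (\<Sum>p\<in>I. e / (card I + 1))"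
      unfolding l1_def q_def phi_def Dw0 Cw0
      using near by (intro sum_mono less_imp_le) (auto simp: I_def)
    also have "\<dots> < e" using e(1) by (simp add: field_simps)
    finally obtain w where w: "\<And>p. p \<in> I \<Longrightarrow> phi w p = q p" using e(2) by blast
    have g_eq: "g = Det d (lin (Dw w) (Cw w))"
    proof (intro poly_eqI)
      fix k j
      have f: "monic_form d (Det d (lin (Dw w) (Cw w)))" by (rule monic_form_Det)
      consider "k + j > d" | "k = d" "k + j \<le> d" | "(k, j) \<in> I" unfolding I_def by fastforce
      then show "cf g k j = cf (Det d (lin (Dw w) (Cw w))) k j"
      proof cases
        case 3
        then show ?thesis using w[of "(k, j)"] by (simp add: phi_def q_def)
      qed (use f g in \<open>auto simp: monic_form_def total_degree_le_def\<close>)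
    qed
    have sym: "Dw w i j = Dw w j i" for i j
      unfolding Dw_def
      by (intro arg_cong2[of _ _ _ _ "(+)"] D sum.cong refl arg_cong2[of _ _ _ _ "(*)"] DC(1))
    have diag: "(\<lambda>i j. if i = j then Cw w i i else 0) = Cw w"
      by (intro ext) (auto simp: Cw_def C_def DC(2))
    have "(\<forall>i j. Dw w i j = Dw w j i) \<and> g = Det d (lin (Dw w) (\<lambda>i j. if i = j then Cw w i i else 0))"
      unfolding diag by (intro conjI allI sym g_eq)
    then show ?thesis
      unfolding representable_def by (intro exI[of _ "Dw w"] exI[of _ "\<lambda>i. Cw w i i"])
  qed
  then show ?thesis using e(1) by (intro exI[of _ "e / (card I + 1)"]) auto
qed

subsection \<open>Homogeneous evaluation\<close>

text \<open>The polynomial \<open>F(x, y, z)\<close> in \<open>x\<close>. The truncated subtraction is harmless, since the coefficients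
  with \<open>k + j > d\<close> vanish for the forms considered.\<close>

definition hpoly :: "nat \<Rightarrow> real poly poly \<Rightarrow> complex \<Rightarrow> complex \<Rightarrow> complex poly" where
  "hpoly d f y z = (\<Sum>k\<le>d. monom (\<Sum>j\<le>d. of_real (cf f k j) * y ^ (d - k - j) * z ^ j) k)"

lemma coeff_hpoly: "coeff (hpoly d f y z) k =
    (if k \<le> d then \<Sum>j\<le>d. of_real (cf f k j) * y ^ (d - k - j) * z ^ j else 0)"
proof -
  have "coeff (hpoly d f y z) k = (\<Sum>i\<le>d. if i = k then \<Sum>j\<le>d. of_real (cf f k j) * y ^ (d - k - j) * z ^ j else 0)"
    unfolding hpoly_def coeff_sum by (intro sum.cong) auto
  then show ?thesis by simp
qed

lemma poly_hpoly: "poly (hpoly d f y z) x = (\<Sum>k\<le>d. \<Sum>j\<le>d. of_real (cf f k j) * x ^ k * y ^ (d - k - j) * z ^ j)"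
  by (simp add: hpoly_def poly_sum poly_monom sum_distrib_left mult_ac)

lemma monic_form_coeff_gt: "monic_form d f \<Longrightarrow> k > d \<Longrightarrow> coeff f k = 0"
  by (auto simp: monic_form_def total_degree_le_def intro!: poly_eqI)

lemma monic_form_degree_coeff: "monic_form d f \<Longrightarrow> degree (coeff f k) \<le> d"
  by (auto simp: monic_form_def total_degree_le_def intro!: degree_le)

lemma poly_real_eval:
  assumes "monic_form d f"
  shows "poly (map_poly (\<lambda>p. poly p z) f) x = (\<Sum>k\<le>d. \<Sum>j\<le>d. cf f k j * x ^ k * z ^ j)"
  using monic_form_coeff_gt[OF assms] monic_form_degree_coeff[OF assms] by (intro poly_map_poly_eval)

lemma poly_hpoly_1:
  assumes "monic_form d f"
  shows "poly (hpoly d f 1 z) x = poly (map_poly (\<lambda>p. poly p z) (map_poly (map_poly complex_of_real) f)) x"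
proof -
  let ?f = "map_poly (map_poly complex_of_real) f"
  have cf: "cf ?f k j = of_real (cf f k j)" for k j by (simp add: coeff_map_poly)
  have "poly (map_poly (\<lambda>p. poly p z) ?f) x = (\<Sum>k\<le>d. \<Sum>j\<le>d. cf ?f k j * x ^ k * z ^ j)"
  proof (rule poly_map_poly_eval)
    show "coeff ?f k = 0" if "k > d" for k
      using monic_form_coeff_gt[OF assms that] by (simp add: coeff_map_poly)
    show "degree (coeff ?f k) \<le> d" for k
      using monic_form_degree_coeff[OF assms, of k] degree_map_poly_le[of complex_of_real "coeff f k"]
      by (simp add: coeff_map_poly)
  qed
  then show ?thesis by (simp add: poly_hpoly cf)
qed

text \<open>Both sides are homogeneous of degree \<open>d\<close> and agree at y = 1. Scaling
  extends this to y \<noteq> 0, and continuity to y = 0, the line that sees only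
  \<open>C\<close>.\<close>

lemma poly_hpoly_Det:
  fixes D C :: "nat \<Rightarrow> nat \<Rightarrow> real"
  shows "poly (hpoly d (Det d (lin D C)) y z) x =
    Det d (\<lambda>i j. y * of_real (D i j) + z * of_real (C i j) + (if i = j then x else 0))"
proof -
  let ?f = "Det d (lin D C)"
  let ?M = "\<lambda>y z x i j. y * of_real (D i j) + z * of_real (C i j) + (if i = j then x else 0)"
  have f: "monic_form d ?f" by (rule monic_form_Det)
  interpret r: map_poly_comm_ring_hom complex_of_real ..
  interpret rr: map_poly_comm_ring_hom "map_poly complex_of_real" ..
  have at1: "poly (hpoly d ?f 1 z) x = Det d (?M 1 z x)" for x z
  proof -
    interpret e: comm_ring_hom "\<lambda>f. poly (map_poly (\<lambda>p. poly p z) f) x" by (rule poly_eval_hom)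
    show ?thesis
      unfolding poly_hpoly_1[OF f] rr.hom_Det lin_hom[OF of_real_hom.comm_ring_hom_axioms] e.hom_Det poly_lin
      by simp
  qed
  have scaled: "poly (hpoly d ?f y z) x = Det d (?M y z x)" if "y \<noteq> 0" for y
  proof -
    have "poly (hpoly d ?f y z) x = y ^ d * poly (hpoly d ?f 1 (z / y)) (x / y)"
      unfolding poly_hpoly sum_distrib_left
    proof (intro sum.cong refl)
      fix k j
      show "complex_of_real (cf ?f k j) * x ^ k * y ^ (d - k - j) * z ^ j =
        y ^ d * (complex_of_real (cf ?f k j) * (x / y) ^ k * 1 ^ (d - k - j) * (z / y) ^ j)"
      proof (cases "k + j \<le> d")
        case True
        then have "y ^ d = y ^ (d - k - j) * y ^ k * y ^ j" by (simp flip: power_add)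
        then show ?thesis using that by (simp add: field_simps)
      qed (use f in \<open>simp add: monic_form_def total_degree_le_def\<close>)
    qed
    also have "\<dots> = Det d (\<lambda>i j. y * ?M 1 (z / y) (x / y) i j)"
      unfolding at1 Det_smult ..
    also have "\<dots> = Det d (?M y z x)"
      using that by (intro Det_cong) (auto simp: field_simps)
    finally show ?thesis .
  qed
  show ?thesis
  proof (cases "y = 0")
    case True
    have 1: "((\<lambda>y. poly (hpoly d ?f y z) x) \<longlongrightarrow> poly (hpoly d ?f 0 z) x) (at 0)"
      unfolding poly_hpoly by (intro tendsto_intros)
    have 2: "((\<lambda>y. Det d (?M y z x)) \<longlongrightarrow> Det d (?M 0 z x)) (at 0)"
      by (intro tendsto_Det tendsto_intros)
    have 3: "\<forall>\<^sub>F y in at 0. Det d (?M y z x) = poly (hpoly d ?f y z) x"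
      unfolding eventually_at_filter by (intro always_eventually allI impI scaled[symmetric])
    show ?thesis
      unfolding True by (rule tendsto_unique[OF _ 1 Lim_transform_eventually[OF 2 3]]) simp
  qed (rule scaled)
qed

lemma poly_poly_ext:
  fixes f g :: "real poly poly"
  assumes "\<And>x z. poly (map_poly (\<lambda>p. poly p z) f) x = poly (map_poly (\<lambda>p. poly p z) g) x"
  shows "f = g"
proof (rule poly_eqI)
  fix k
  have eq: "map_poly (\<lambda>p. poly p z) f = map_poly (\<lambda>p. poly p z) g" for z
    using assms by (simp add: poly_eq_poly_eq_iff[symmetric] fun_eq_iff)
  have "poly (coeff f k) z = poly (coeff g k) z" for z
    using arg_cong[OF eq[of z], of "\<lambda>p. coeff p k"]
    by (simp add: coeff_map_poly)
  then show "coeff f k = coeff g k" by (simp add: poly_eq_poly_eq_iff[symmetric] fun_eq_iff)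
qed

subsection \<open>Closedness\<close>

text \<open>Newton's identity for the second power sum of the eigenvalues: for symmetric \<open>D\<close> it bounds the
  entries by the coefficients.\<close>

lemma sum_squares_from_coeffs:
  fixes D :: "nat \<Rightarrow> nat \<Rightarrow> real" and d :: nat
  defines "p \<equiv> Det d (\<lambda>i j. [:D i j, if i = j then 1 else 0:])"
  assumes d: "d \<ge> 3"
  shows "(\<Sum>i<d. \<Sum>j<d. D i j * D j i) = (coeff p (d - 1))\<^sup>2 - 2 * coeff p (d - 2)"
proof -
  define M where "M = (\<lambda>i j. [:D i j, if i = j then 1 else 0:])"
  define A where "A = Cof d M"
  have p: "p = Det d M" by (simp add: p_def M_def)
  \<comment> \<open>A one-point parameter space makes formal differentiation in x an instance of the
    abstract product rule; it shows that the derivative of \<open>p\<close> is the trace of the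
    adjugate.\<close>
  interpret dr: derivation_rule "\<lambda>f f'. f' () = pderiv (f ())" "() :: unit"
    by unfold_locales (auto simp: pderiv_add pderiv_mult pderiv_pCons of_int_poly)
  have "pderiv p = (\<Sum>i<d. \<Sum>j<d. pderiv (M i j) * A i j)"
    using dr.Det[where A = "\<lambda>_. M" and A' = "\<lambda>_ i j. pderiv (M i j)" and n = d] by (simp add: p A_def)
  also have "\<dots> = (\<Sum>i<d. \<Sum>j<d. if j = i then A i i else 0)"
    by (intro sum.cong refl) (auto simp: M_def pderiv_pCons)
  finally have dp: "pderiv p = (\<Sum>i<d. A i i)" by simp
  have top: "coeff (A i j) n = 0" if "n \<ge> d" for i j n
  proof -
    have "degree (A i j) \<le> d - 1" unfolding A_def by (rule degree_Cof_linear) (auto simp: M_def)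
    then show ?thesis using that d by (intro coeff_eq_0) auto
  qed
  \<comment> \<open>Comparing coefficients in (x I + D) adj = p I gives the Faddeev-LeVerrier
    recursion, whose first terms from the top are I, c1 I - D and c2 I - c1 D + D^2. The third has
    index d - 3, which explains the bound on \<open>d\<close>.\<close>
  have rec: "(\<Sum>l<d. D i l * coeff (A k l) (Suc n)) + coeff (A k i) n = (if i = k then coeff p (Suc n) else 0)"
    if "i < d" "k < d" for i k n
  proof -
    have "M i l * A k l = smult (D i l) (A k l) + (if l = i then pCons 0 (A k i) else 0)" for l
      by (simp add: M_def)
    then have "(\<Sum>l<d. smult (D i l) (A k l)) + pCons 0 (A k i) = (\<Sum>l<d. M i l * A k l)"
      using that by (simp add: sum.distrib)
    also have "\<dots> = (if i = k then p else 0)"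
      unfolding A_def p by (rule Cof_rows[OF that])
    finally have "(\<Sum>l<d. smult (D i l) (A k l)) + pCons 0 (A k i) = (if i = k then p else 0)" .
    from arg_cong[OF this, of "\<lambda>q. coeff q (Suc n)"] show ?thesis
      by (simp add: coeff_sum)
  qed
  have "d = Suc (Suc (Suc (d - 3)))" using d by simp
  then obtain m where m: "d = Suc (Suc (Suc m))" by blast
  have pd: "coeff p (Suc (Suc (Suc m))) = 1" unfolding p M_def m[symmetric] by (rule Det_monic)
  have top': "coeff (A i j) (Suc (Suc (Suc m))) = 0" for i j by (rule top) (simp add: m)
  define c1 c2 where "c1 = coeff p (Suc (Suc m))" and "c2 = coeff p (Suc m)"
  have c: "c1 = coeff p (d - 1)" "c2 = coeff p (d - 2)" by (simp_all add: c1_def c2_def m)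
  have rd: "real d = real m + 3" by (simp add: m)
  have a0: "coeff (A k i) (Suc (Suc m)) = (if i = k then 1 else 0)" if "i < d" "k < d" for i k
    using rec[OF that, of "Suc (Suc m)"] pd by (simp add: top')
  have a1: "coeff (A k i) (Suc m) = (if i = k then c1 else 0) - D i k" if "i < d" "k < d" for i k
  proof -
    have "(\<Sum>l<d. D i l * coeff (A k l) (Suc (Suc m))) = (\<Sum>l<d. if l = k then D i k else 0)"
      using that by (intro sum.cong) (auto simp: a0)
    then show ?thesis using rec[OF that, of "Suc m"] that unfolding c1_def by (cases "i = k") (simp; linarith)+
  qed
  have a2: "coeff (A k i) m = (if i = k then c2 else 0) - c1 * D i k + (\<Sum>l<d. D i l * D l k)" if "i < d" "k < d" for i k
  proof -
    have "(\<Sum>l<d. D i l * coeff (A k l) (Suc m)) = (\<Sum>l<d. (if l = k then c1 * D i k else 0) - D i l * D l k)"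
      using that by (intro sum.cong) (auto simp: a1 algebra_simps)
    also have "\<dots> = c1 * D i k - (\<Sum>l<d. D i l * D l k)"
      using that by (simp add: sum_subtractf)
    finally show ?thesis using rec[OF that, of m] unfolding c2_def by (cases "i = k") (simp; linarith)+
  qed
  \<comment> \<open>The traces of the adjugate coefficients are computed twice, from the derivative
    of \<open>p\<close> and from the recursion; equating them gives the first two power
    sums.\<close>
  have "(\<Sum>i<d. coeff (A i i) (Suc m)) = (real d - 1) * c1"
    using arg_cong[OF dp, of "\<lambda>q. coeff q (Suc m)"] by (simp add: coeff_pderiv coeff_sum c1_def rd)
  moreover have "(\<Sum>i<d. coeff (A i i) (Suc m)) = real d * c1 - (\<Sum>i<d. D i i)"
    by (simp add: a1 sum_subtractf)
  ultimately have tr: "(\<Sum>i<d. D i i) = c1" by (simp add: algebra_simps)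
  have "(\<Sum>i<d. coeff (A i i) m) = (real d - 2) * c2"
    using arg_cong[OF dp, of "\<lambda>q. coeff q m"] by (simp add: coeff_pderiv coeff_sum c2_def rd)
  moreover have "(\<Sum>i<d. coeff (A i i) m) = real d * c2 - c1 * c1 + (\<Sum>i<d. \<Sum>l<d. D i l * D l i)"
    by (simp add: a2 sum_subtractf sum.distrib sum_distrib_left[symmetric] tr)
  ultimately show ?thesis
    unfolding c[symmetric] by (simp add: algebra_simps power2_eq_square)
qed

lemma coeff_Det_bottom:
  fixes D C :: "nat \<Rightarrow> nat \<Rightarrow> real"
  shows "coeff (Det d (\<lambda>i j. [:D i j, if i = j then 1 else 0:])) k = cf (Det d (lin D C)) k 0"
proof -
  interpret comm_ring_hom "map_poly (\<lambda>p. poly p (0::real))" by (rule map_poly_eval_hom)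
  have "map_poly (\<lambda>p. poly p 0) (lin D C i j) = [:D i j, if i = j then 1 else 0:]" for i j
    by (simp add: lin_def map_poly_linear)
  then have "map_poly (\<lambda>p. poly p 0) (Det d (lin D C)) = Det d (\<lambda>i j. [:D i j, if i = j then 1 else 0:])"
    by (simp add: hom_Det)
  from arg_cong[OF this, of "\<lambda>p. coeff p k"] show ?thesis
    by (simp add: coeff_map_poly poly_0_coeff_0)
qed

lemma coeff_hpoly_top:
  assumes "monic_form d f" "k \<le> d"
  shows "coeff (hpoly d f 0 1) k = of_real (cf f k (d - k))"
proof -
  have "coeff (hpoly d f 0 1) k = (\<Sum>j\<le>d. if j = d - k then of_real (cf f k (d - k)) else 0)"
  proof -
    \<comment> \<open>Truncated subtraction makes the power of 0 equal to 1 for every j \<ge> d - k;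
      beyond j = d - k it is the coefficient that vanishes.\<close>
    have "of_real (cf f k j) * 0 ^ (d - k - j) * 1 ^ j = (if j = d - k then complex_of_real (cf f k (d - k)) else 0)" for j
      using assms by (cases j "d - k" rule: linorder_cases) (auto simp: monic_form_def total_degree_le_def)
    then show ?thesis using assms by (simp add: coeff_hpoly)
  qed
  then show ?thesis by simp
qed

lemma hpoly_top_Det:
  fixes D C :: "nat \<Rightarrow> nat \<Rightarrow> real"
  shows "hpoly d (Det d (lin D C)) 0 1 = map_poly of_real (Det d (\<lambda>i j. [:C i j, if i = j then 1 else 0:]))"
proof -
  interpret rr: map_poly_comm_ring_hom complex_of_real ..
  have "poly (map_poly of_real (Det d (\<lambda>i j. [:C i j, if i = j then 1 else 0:]))) x
     = poly (hpoly d (Det d (lin D C)) 0 1) x" for x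
    unfolding rr.hom_Det poly_hpoly_Det poly_hom.hom_Det
    by (intro Det_cong) (simp add: map_poly_linear)
  then have "poly (map_poly of_real (Det d (\<lambda>i j. [:C i j, if i = j then 1 else 0:]))) = poly (hpoly d (Det d (lin D C)) 0 1)"
    by (intro ext)
  then show ?thesis by (simp only: poly_eq_poly_eq_iff)
qed

lemma coeff_Det_top:
  fixes D C :: "nat \<Rightarrow> nat \<Rightarrow> real"
  assumes "k \<le> d"
  shows "coeff (Det d (\<lambda>i j. [:C i j, if i = j then 1 else 0:])) k = cf (Det d (lin D C)) k (d - k)"
proof -
  have "complex_of_real (coeff (Det d (\<lambda>i j. [:C i j, if i = j then 1 else 0:])) k) = of_real (cf (Det d (lin D C)) k (d - k))"
    using coeff_hpoly_top[OF monic_form_Det assms] by (simp add: hpoly_top_Det coeff_map_poly)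
  then show ?thesis by simp
qed

lemma bounded_family_subsequence:
  fixes X :: "nat \<Rightarrow> 'i \<Rightarrow> real"
  assumes "finite I" "\<And>i. i \<in> I \<Longrightarrow> Bseq (\<lambda>n. X n i)"
  shows "\<exists>r. strict_mono r \<and> (\<forall>i\<in>I. convergent (\<lambda>n. X (r n) i))"
  using assms
proof (induction I rule: finite_induct)
  case empty
  show ?case using strict_mono_id by blast
next
  case (insert x F)
  then obtain r where r: "strict_mono r" "\<forall>i\<in>F. convergent (\<lambda>n. X (r n) i)" by auto
  have "Bseq (\<lambda>n. X (r n) x)"
    using Bseq_subseq[of "\<lambda>n. X n x" r] insert.prems[of x] by simp
  then have "bounded (range (\<lambda>n. X (r n) x))" by (simp add: Bseq_eq_bounded)
  then obtain l s where s: "strict_mono s" "((\<lambda>n. X (r n) x) \<circ> s) \<longlonglongrightarrow> l"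
    using bounded_imp_convergent_subsequence by blast
  have "convergent (\<lambda>n. X ((r \<circ> s) n) i)" if "i \<in> insert x F" for i
  proof (cases "i = x")
    case True
    then show ?thesis using s(2) by (auto simp: convergent_def comp_def)
  next
    case False
    then have "convergent (\<lambda>n. X (r n) i)" using that r(2) by auto
    from convergent_subseq_convergent[OF this s(1)] show ?thesis by (simp add: comp_def)
  qed
  then show ?case using strict_mono_o[OF r(1) s(1)] by blast
qed

lemma representable_limit:
  assumes d: "d \<ge> 3" and F: "\<And>n. representable d (F n)"
    and lim: "\<And>k j. (\<lambda>n. cf (F n) k j) \<longlonglongrightarrow> cf g k j" and g: "monic_form d g"
  shows "representable d g"
proof -
  define Q where "Q n D c \<longleftrightarrow> (\<forall>i j. D i j = D j i) \<and> F n = Det d (lin D (\<lambda>i j. if i = j then c i else 0))" for n D c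
  have "\<exists>D c. Q n D c" for n using F unfolding representable_def Q_def .
  then obtain D c where "\<And>n. Q n (D n) (c n)" by metis
  then have D: "D n i j = D n j i" and Fn: "F n = Det d (lin (D n) (\<lambda>i j. if i = j then c n i else 0))" for n i j
    unfolding Q_def by blast+
  have square_bound: "Bseq h" if "s \<longlonglongrightarrow> (l::real)" "\<And>n. (h n)\<^sup>2 \<le> s n" for s l h
  proof -
    have "Bseq s" using that(1) convergentI convergent_imp_Bseq by blast
    then obtain K where K: "K > 0" "\<And>n. norm (s n) \<le> K" using BseqE by blast
    have "norm (h n) \<le> max 1 K" for n
    proof -
      have "(h n)\<^sup>2 \<le> K" using that(2)[of n] K(2)[of n] by simp
      show ?thesis
      proof (cases "\<bar>h n\<bar> \<le> 1")
        case False
        then have "\<bar>h n\<bar> \<le> \<bar>h n\<bar>\<^sup>2" by (intro self_le_power) auto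
        then show ?thesis using \<open>(h n)\<^sup>2 \<le> K\<close> by simp
      qed simp
    qed
    then show ?thesis by (rule BseqI')
  qed
  have D_bound: "Bseq (\<lambda>n. D n i j)" if "i < d" "j < d" for i j
  proof (rule square_bound)
    show "(\<lambda>n. (cf (F n) (d - 1) 0)\<^sup>2 - 2 * cf (F n) (d - 2) 0) \<longlonglongrightarrow> (cf g (d - 1) 0)\<^sup>2 - 2 * cf g (d - 2) 0"
      by (intro tendsto_intros lim)
    fix n
    have "(D n i j)\<^sup>2 \<le> (\<Sum>j<d. (D n i j)\<^sup>2)"
      by (rule member_le_sum) (use that in auto)
    also have "\<dots> \<le> (\<Sum>i<d. \<Sum>j<d. (D n i j)\<^sup>2)"
      by (rule member_le_sum[of i _ "\<lambda>i. \<Sum>j<d. (D n i j)\<^sup>2"]) (use that in \<open>auto intro: sum_nonneg\<close>)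
    also have "\<dots> = (\<Sum>i<d. \<Sum>j<d. D n i j * D n j i)"
      by (intro sum.cong refl) (subst power2_eq_square, rule arg_cong2[of _ _ _ _ "(*)", OF refl D])
    also have "\<dots> = (cf (F n) (d - 1) 0)\<^sup>2 - 2 * cf (F n) (d - 2) 0"
      unfolding sum_squares_from_coeffs[OF d] Fn coeff_Det_bottom[where C = "\<lambda>i j. if i = j then c n i else 0"] ..
    finally show "(D n i j)\<^sup>2 \<le> (cf (F n) (d - 1) 0)\<^sup>2 - 2 * cf (F n) (d - 2) 0" .
  qed
  have c_bound: "Bseq (\<lambda>n. c n i)" if "i < d" for i
  proof (rule square_bound)
    show "(\<lambda>n. (cf (F n) (d - 1) 1)\<^sup>2 - 2 * cf (F n) (d - 2) 2) \<longlonglongrightarrow> (cf g (d - 1) 1)\<^sup>2 - 2 * cf g (d - 2) 2"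
      by (intro tendsto_intros lim)
    fix n
    let ?C = "\<lambda>i j. if i = j then c n i else 0"
    have "(c n i)\<^sup>2 \<le> (\<Sum>i<d. (c n i)\<^sup>2)"
      by (rule member_le_sum) (use that in auto)
    also have "\<dots> = (\<Sum>i<d. \<Sum>j<d. if j = i then (c n i)\<^sup>2 else 0)"
      by simp
    also have "\<dots> = (\<Sum>i<d. \<Sum>j<d. ?C i j * ?C j i)"
      by (intro sum.cong refl) (auto simp: power2_eq_square)
    also have "\<dots> = (cf (F n) (d - 1) 1)\<^sup>2 - 2 * cf (F n) (d - 2) 2"
      unfolding sum_squares_from_coeffs[OF d]
      using d by (simp add: coeff_Det_top[where D = "D n"] Fn)
    finally show "(c n i)\<^sup>2 \<le> (cf (F n) (d - 1) 1)\<^sup>2 - 2 * cf (F n) (d - 2) 2" .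
  qed
  define X where "X n p = (case p of Inl (i, j) \<Rightarrow> D n i j | Inr i \<Rightarrow> c n i)" for n and p :: "nat \<times> nat + nat"
  obtain r where r: "strict_mono r" "\<forall>p \<in> ({..<d} \<times> {..<d}) <+> {..<d}. convergent (\<lambda>n. X (r n) p)"
  proof -
    have "Bseq (\<lambda>n. X n p)" if "p \<in> ({..<d} \<times> {..<d}) <+> {..<d}" for p
      using that D_bound c_bound by (auto simp: X_def)
    then show thesis
      using bounded_family_subsequence[of "({..<d} \<times> {..<d}) <+> {..<d}" X] that by auto
  qed
  define D' where "D' i j = (if i < d \<and> j < d then lim (\<lambda>n. D (r n) i j) else 0)" for i j
  define c' where "c' i = lim (\<lambda>n. c (r n) i)" for i
  have D': "(\<lambda>n. D (r n) i j) \<longlonglongrightarrow> D' i j" if "i < d" "j < d" for i j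
    using r(2) that by (auto simp: X_def D'_def convergent_LIMSEQ_iff dest!: bspec[of _ _ "Inl (i, j)"])
  have c': "(\<lambda>n. c (r n) i) \<longlonglongrightarrow> c' i" if "i < d" for i
    using r(2) that by (auto simp: X_def c'_def convergent_LIMSEQ_iff dest!: bspec[of _ _ "Inr i"])
  let ?G = "Det d (lin D' (\<lambda>i j. if i = j then c' i else 0))"
  have "g = ?G"
  proof (rule poly_poly_ext)
    fix x z :: real
    interpret e: comm_ring_hom "\<lambda>f. poly (map_poly (\<lambda>p. poly p z) f) x" by (rule poly_eval_hom)
    \<comment> \<open>Entries outside the index range are set to 0 because
      \<open>tendsto_Det\<close> asks for convergence of all entries, while that of
      \<open>D (r n) i j\<close> is known only for i, j < d.\<close>
    have ev: "poly (map_poly (\<lambda>p. poly p z) (Det d (lin D C))) x = Det d (\<lambda>i j. if i < d \<and> j < d then D i j + z * C i j + (if i = j then x else 0) else 0)"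
      for D C :: "nat \<Rightarrow> nat \<Rightarrow> real"
      unfolding e.hom_Det by (intro Det_cong) (simp add: poly_lin)
    have "(\<lambda>n. poly (map_poly (\<lambda>p. poly p z) (F (r n))) x) \<longlonglongrightarrow> poly (map_poly (\<lambda>p. poly p z) ?G) x"
      unfolding Fn ev
    proof (rule tendsto_Det)
      fix i j
      show "(\<lambda>n. if i < d \<and> j < d then D (r n) i j + z * (if i = j then c (r n) i else 0) + (if i = j then x else 0) else 0)
         \<longlonglongrightarrow> (if i < d \<and> j < d then D' i j + z * (if i = j then c' i else 0) + (if i = j then x else 0) else 0)"
        using D'[of i j] c'[of i] by (auto intro!: tendsto_intros)
    qed
    moreover have "(\<lambda>n. poly (map_poly (\<lambda>p. poly p z) (F (r n))) x) \<longlonglongrightarrow> poly (map_poly (\<lambda>p. poly p z) g) x"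
    proof -
      have "(\<lambda>n. cf (F (r n)) k j) \<longlonglongrightarrow> cf g k j" for k j
        using LIMSEQ_subseq_LIMSEQ[OF lim r(1)] by (simp add: comp_def)
      moreover have F: "monic_form d (F n)" for n unfolding Fn by (rule monic_form_Det)
      ultimately show ?thesis
        unfolding poly_real_eval[OF g] poly_real_eval[OF F] by (intro tendsto_intros)
    qed
    ultimately show "poly (map_poly (\<lambda>p. poly p z) g) x = poly (map_poly (\<lambda>p. poly p z) ?G) x"
      using LIMSEQ_unique by blast
  qed
  moreover have "D' i j = D' j i" for i j
  proof -
    have "(\<lambda>n. D (r n) i j) = (\<lambda>n. D (r n) j i)" using D by blast
    then show ?thesis by (auto simp: D'_def)
  qed
  ultimately show ?thesis unfolding representable_def by blast
qed

subsection \<open>Paths of smooth forms\<close>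

text \<open>The origin is excluded since over y = z = 0 a monic form is x^d. As a condition on all
  nonzero points with y and z real it is homogeneous, so it can be tested on a compact
  sphere.\<close>

definition simple_rooted :: "nat \<Rightarrow> real poly poly \<Rightarrow> bool" where
  "simple_rooted d f \<longleftrightarrow> (\<forall>x (y::real) (z::real). x \<noteq> 0 \<or> y \<noteq> 0 \<or> z \<noteq> 0 \<longrightarrow>
     poly (hpoly d f (of_real y) (of_real z)) x \<noteq> 0 \<or> poly (pderiv (hpoly d f (of_real y) (of_real z))) x \<noteq> 0)"

definition zderiv :: "nat \<Rightarrow> real poly poly \<Rightarrow> complex \<Rightarrow> complex \<Rightarrow> complex" where
  "zderiv d f x z = (\<Sum>k\<le>d. \<Sum>j\<le>d. of_real (cf f k j) * x ^ k * (of_nat j * z ^ (j - 1)))"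

text \<open>Smoothness in the chart y = 1, stated in exactly the region that
  \<open>simple_rooted\<close> leaves open. The line y = 0 does not appear, since there the tangent
  argument uses only that the entries of \<open>C\<close> are distinct.\<close>

definition nonreal_smooth :: "nat \<Rightarrow> real poly poly \<Rightarrow> bool" where
  "nonreal_smooth d f \<longleftrightarrow> (\<forall>x z. Im z \<noteq> 0 \<longrightarrow>
     \<not> (poly (hpoly d f 1 z) x = 0 \<and> poly (pderiv (hpoly d f 1 z)) x = 0 \<and> zderiv d f x z = 0))"

lemma field_derivative_rule:
  "derivation_rule (\<lambda>f f'. (f has_field_derivative f' x) (at x)) (x::complex)"
  by unfold_locales (auto intro!: derivative_eq_intros simp: mult.commute)

text \<open>On the line y = 0 the pencil is diagonal with determinant the product of the x + z c i,
  so two equal \<open>c\<close> would give a double root at z = 1.\<close>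

lemma simple_rooted_imp_inj:
  fixes D :: "nat \<Rightarrow> nat \<Rightarrow> real"
  assumes "simple_rooted d (Det d (lin D (\<lambda>i j. if i = j then c i else 0)))"
  shows "inj_on c {..<d}"
proof (rule inj_onI, rule ccontr)
  fix i j assume ij: "i \<in> {..<d}" "j \<in> {..<d}" "c i = c j" "i \<noteq> j"
  interpret r: map_poly_comm_ring_hom complex_of_real ..
  let ?f = "Det d (lin D (\<lambda>i j. if i = j then c i else 0))"
  let ?p = "\<lambda>i. [:c i, 1:]"
  define q where "q = map_poly complex_of_real (?p i)"
  define R where "R = (\<Prod>m\<in>{..<d} - {i} - {j}. ?p m)"
  have "Det d (\<lambda>i j. [:if i = j then c i else 0, if i = j then 1 else 0:]) = (\<Prod>m<d. ?p m)"
    by (subst Det_upper_triangular) auto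
  also have "\<dots> = ?p i * (\<Prod>m\<in>{..<d} - {i}. ?p m)"
    using ij by (subst prod.remove[of _ i]) auto
  also have "(\<Prod>m\<in>{..<d} - {i}. ?p m) = ?p j * R"
    unfolding R_def using ij by (subst prod.remove[of _ j]) auto
  finally have "Det d (\<lambda>i j. [:if i = j then c i else 0, if i = j then 1 else 0:]) = ?p i * (?p i * R)"
    using ij(3) by simp
  then have h: "hpoly d ?f 0 1 = q * (q * map_poly of_real R)"
    by (simp only: hpoly_top_Det r.hom_mult q_def)
  have "q = [:of_real (c i), 1:]"
    by (simp add: q_def map_poly_linear)
  then have "poly q (- of_real (c i)) = 0" by simp
  then have "poly (hpoly d ?f 0 1) (- of_real (c i)) = 0 \<and> poly (pderiv (hpoly d ?f 0 1)) (- of_real (c i)) = 0"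
    unfolding h by (simp add: pderiv_mult)
  moreover have "poly (hpoly d ?f 0 1) x \<noteq> 0 \<or> poly (pderiv (hpoly d ?f 0 1)) x \<noteq> 0" for x
    using assms[unfolded simple_rooted_def, rule_format, of x 0 1] by simp
  ultimately show False by blast
qed

text \<open>If all cofactors vanish at a point, so does the determinant, by row expansion, and so do
  its derivatives in x and z, by Jacobi's formula. For real \<open>z\<close> the x-derivative alone
  contradicts simple roots; for other \<open>z\<close> the point is a forbidden singularity.\<close>

lemma cofactors_nonzero_if_smooth:
  fixes D C :: "nat \<Rightarrow> nat \<Rightarrow> real"
  assumes d: "d \<ge> 1" and sr: "simple_rooted d (Det d (lin D C))" and ns: "nonreal_smooth d (Det d (lin D C))"
  shows "\<exists>i<d. \<exists>j<d. Cof d (\<lambda>i j. complex_of_real (D i j) + z * complex_of_real (C i j) + (if i = j then x else 0)) i j \<noteq> 0"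
proof (rule ccontr)
  let ?M = "\<lambda>x z i j. complex_of_real (D i j) + z * complex_of_real (C i j) + (if i = j then x else 0)"
  let ?f = "Det d (lin D C)"
  assume "\<not> ?thesis"
  then have zero: "Cof d (?M x z) i j = 0" if "i < d" "j < d" for i j using that by blast
  have M: "poly (hpoly d ?f 1 z) x = Det d (?M x z)" for x z
    unfolding poly_hpoly_Det by simp
  have "(\<Sum>l<d. ?M x z 0 l * Cof d (?M x z) 0 l) = Det d (?M x z)"
    using Cof_rows[of 0 d 0 "?M x z"] d by simp
  then have 1: "poly (hpoly d ?f 1 z) x = 0"
    unfolding M using d by (simp add: zero)
  interpret dx: derivation_rule "\<lambda>f f'. (f has_field_derivative f' x) (at x)" x by (rule field_derivative_rule)
  have "((\<lambda>w. Det d (?M w z)) has_field_derivative (\<Sum>i<d. \<Sum>j<d. (if i = j then 1 else 0) * Cof d (?M x z) i j)) (at x)"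
    by (rule dx.Det) (auto intro!: derivative_eq_intros)
  then have "(poly (hpoly d ?f 1 z) has_field_derivative 0) (at x)"
    unfolding M[symmetric] by (simp add: zero)
  then have 2: "poly (pderiv (hpoly d ?f 1 z)) x = 0"
    using DERIV_unique poly_DERIV by blast
  interpret dz: derivation_rule "\<lambda>f f'. (f has_field_derivative f' z) (at z)" z by (rule field_derivative_rule)
  have "((\<lambda>w. Det d (?M x w)) has_field_derivative (\<Sum>i<d. \<Sum>j<d. of_real (C i j) * Cof d (?M x z) i j)) (at z)"
    by (rule dz.Det) (auto intro!: derivative_eq_intros)
  then have "((\<lambda>w. poly (hpoly d ?f 1 w) x) has_field_derivative 0) (at z)"
    unfolding M[symmetric] by (simp add: zero)
  moreover have "((\<lambda>w. poly (hpoly d ?f 1 w) x) has_field_derivative zderiv d ?f x z) (at z)"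
    unfolding poly_hpoly zderiv_def power_one mult_1_right
    by (intro DERIV_sum DERIV_cmult) (auto intro!: derivative_eq_intros)
  ultimately have 3: "zderiv d ?f x z = 0" using DERIV_unique by blast
  show False
  proof (cases "Im z = 0")
    case True
    then have "z = of_real (Re z)" by (simp add: complex_eq_iff)
    then have "poly (hpoly d ?f (of_real 1) (of_real (Re z))) x = 0 \<and> poly (pderiv (hpoly d ?f (of_real 1) (of_real (Re z)))) x = 0"
      using 1 2 by (simp only: of_real_1)
    then show False using sr[unfolded simple_rooted_def, rule_format, of x 1 "Re z"] by simp
  next
    case False
    then show False using ns 1 2 3 unfolding nonreal_smooth_def by blast
  qed
qed

lemma representable_open:
  assumes "d \<ge> 1" "representable d f" "simple_rooted d f" "nonreal_smooth d f"
  shows "\<exists>e>0. \<forall>g. monic_form d g \<longrightarrow> (\<forall>k\<le>d. \<forall>j\<le>d. \<bar>cf g k j - cf f k j\<bar> < e) \<longrightarrow> representable d g"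
proof -
  obtain D c where D: "\<forall>i j. D i j = D j i" and f: "f = Det d (lin D (\<lambda>i j. if i = j then c i else 0))"
    using assms(2) unfolding representable_def by blast
  show ?thesis unfolding f
  proof (rule representable_nbhd)
    show "D i j = D j i" for i j using D by blast
    show "inj_on c {..<d}" using simple_rooted_imp_inj assms(3) unfolding f by blast
  qed (rule cofactors_nonzero_if_smooth; use assms f in blast)
qed

lemma representable_along_path:
  fixes G :: "real \<Rightarrow> real poly poly"
  assumes d: "d \<ge> 3" and cont: "\<And>k j. continuous_on {0..1} (\<lambda>t. cf (G t) k j)"
    and G: "\<And>t. t \<in> {0..1} \<Longrightarrow> monic_form d (G t)"
    and sr: "\<And>t. t \<in> {0..1} \<Longrightarrow> simple_rooted d (G t)"
    and ns: "\<And>t. t \<in> {0..1} \<Longrightarrow> nonreal_smooth d (G t)"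
    and s: "s \<in> {0..1}" "representable d (G s)" and t: "t \<in> {0..1}"
  shows "representable d (G t)"
proof -
  let ?T = "{t \<in> {0..1}. representable d (G t)}"
  have "openin (top_of_set {0..1}) ?T"
    unfolding openin_euclidean_subtopology_iff
  proof (intro conjI ballI)
    fix u assume u: "u \<in> ?T"
    then obtain e where e: "e > 0"
      "\<And>g. monic_form d g \<Longrightarrow> (\<forall>k\<le>d. \<forall>j\<le>d. \<bar>cf g k j - cf (G u) k j\<bar> < e) \<Longrightarrow> representable d g"
      using representable_open[of d "G u"] d sr ns by fastforce
    have "\<forall>\<^sub>F v in at u within {0..1}. \<forall>k\<in>{..d}. \<forall>j\<in>{..d}. dist (cf (G v) k j) (cf (G u) k j) < e"
      using cont u e(1) unfolding continuous_on_def
      by (intro eventually_ball_finite ballI tendstoD) auto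
    then obtain r where r: "r > 0"
      "\<And>v. v \<in> {0..1} \<Longrightarrow> v \<noteq> u \<Longrightarrow> dist v u < r \<Longrightarrow> \<forall>k\<in>{..d}. \<forall>j\<in>{..d}. dist (cf (G v) k j) (cf (G u) k j) < e"
      unfolding eventually_at by blast
    have "v \<in> ?T" if v: "v \<in> {0..1}" "dist v u < r" for v
    proof (cases "v = u")
      case False
      have "representable d (G v)"
        using r(2)[OF v(1) False v(2)] by (intro e(2) G v(1)) (simp add: dist_real_def)
      then show ?thesis using v by simp
    qed (use u in simp)
    then show "\<exists>e>0. \<forall>x'\<in>{0..1}. dist x' u < e \<longrightarrow> x' \<in> ?T" using r(1) by blast
  qed auto
  moreover have "closedin (top_of_set {0..1}) ?T"
  proof -
    have "closed ?T"
      unfolding closed_sequential_limits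
    proof (intro allI impI, elim conjE)
      fix x l assume x: "\<forall>n. x n \<in> ?T" "x \<longlonglongrightarrow> l"
      have l: "l \<in> {0..1}"
        using closed_sequentially[of "{0..1::real}" x l] x by auto
      have "representable d (G l)"
      proof (rule representable_limit[OF d])
        show "representable d (G (x n))" for n using x(1) by blast
        show "(\<lambda>n. cf (G (x n)) k j) \<longlonglongrightarrow> cf (G l) k j" for k j
          using continuous_on_tendsto_compose[OF cont x(2) l] x(1) by simp
        show "monic_form d (G l)" by (rule G[OF l])
      qed
      then show "l \<in> ?T" using l by simp
    qed
    then show ?thesis by (rule closed_subset[rotated]) auto
  qed
  moreover have "connected {0..1::real}" by simp
  ultimately have "?T = {} \<or> ?T = {0..1}" unfolding connected_clopen by blast
  then show ?thesis using s t by blast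
qed

subsection \<open>Nuij's deformation\<close>

definition real_rooted :: "complex poly \<Rightarrow> bool" where
  "real_rooted p \<longleftrightarrow> p \<noteq> 0 \<and> (\<forall>x. poly p x = 0 \<longrightarrow> Im x = 0)"

definition nuij :: "real \<Rightarrow> complex poly \<Rightarrow> complex poly" where
  "nuij c p = p + smult (of_real c) (pderiv p)"

text \<open>These are p'/p and the negative of its derivative, written as sums over the roots and
  with the denominators p and p^2 cleared.\<close>

lemma log_derivatives:
  fixes r :: "nat \<Rightarrow> complex"
  defines "P \<equiv> \<lambda>n. \<Prod>i<n. [:- r i, 1:]"
  assumes "\<And>i. i < n \<Longrightarrow> x \<noteq> r i"
  shows "poly (pderiv (P n)) x = poly (P n) x * (\<Sum>i<n. 1 / (x - r i)) \<and>
    (poly (pderiv (P n)) x)\<^sup>2 - poly (pderiv (pderiv (P n))) x * poly (P n) x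
      = (poly (P n) x)\<^sup>2 * (\<Sum>i<n. 1 / (x - r i)\<^sup>2)"
  using assms(2)
proof (induction n)
  case 0
  show ?case by (simp add: P_def)
next
  case (Suc n)
  define Q Q' Q'' l where "Q = poly (P n) x" and "Q' = poly (pderiv (P n)) x"
    and "Q'' = poly (pderiv (pderiv (P n))) x" and "l = x - r n"
  have l: "l \<noteq> 0" using Suc.prems[of n] by (simp add: l_def)
  have P: "P (Suc n) = P n * [:- r n, 1:]" by (simp add: P_def)
  have 1: "poly (P (Suc n)) x = Q * l" by (simp add: P Q_def l_def algebra_simps)
  have 2: "poly (pderiv (P (Suc n))) x = Q' * l + Q"
    unfolding P pderiv_mult by (simp add: pderiv_pCons Q_def Q'_def l_def algebra_simps)
  have 3: "poly (pderiv (pderiv (P (Suc n)))) x = Q'' * l + 2 * Q'"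
    unfolding P pderiv_mult pderiv_add by (simp add: pderiv_pCons pderiv_mult Q'_def Q''_def l_def algebra_simps)
  have IH: "Q' = Q * (\<Sum>i<n. 1 / (x - r i))" "Q'\<^sup>2 - Q'' * Q = Q\<^sup>2 * (\<Sum>i<n. 1 / (x - r i)\<^sup>2)"
    using Suc.IH Suc.prems by (auto simp: Q_def Q'_def Q''_def)
  have a: "Q' * l + Q = Q * l * (\<Sum>i<Suc n. 1 / (x - r i))"
    using l IH(1) by (simp add: l_def[symmetric] field_simps)
  have "(Q' * l + Q)\<^sup>2 - (Q'' * l + 2 * Q') * (Q * l) = (Q'\<^sup>2 - Q'' * Q) * l\<^sup>2 + Q\<^sup>2"
    by (simp add: power2_eq_square algebra_simps)
  also have "\<dots> = (Q * l)\<^sup>2 * (\<Sum>i<Suc n. 1 / (x - r i)\<^sup>2)"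
    unfolding IH(2) using l by (simp add: l_def[symmetric] field_simps)
  finally show ?case unfolding 1 2 3 using a by simp
qed

lemma real_rooted_log_derivatives:
  assumes p: "real_rooted p" and x: "poly p x \<noteq> 0"
  obtains r :: "nat \<Rightarrow> real" where
    "poly (pderiv p) x = poly p x * (\<Sum>i<degree p. 1 / (x - of_real (r i)))"
    "(poly (pderiv p) x)\<^sup>2 - poly (pderiv (pderiv p)) x * poly p x
      = (poly p x)\<^sup>2 * (\<Sum>i<degree p. 1 / (x - of_real (r i))\<^sup>2)"
    "\<And>i. i < degree p \<Longrightarrow> x \<noteq> of_real (r i)"
proof -
  obtain root where root: "smult (lead_coeff p) (\<Prod>i<degree p. [:- root i, 1:]) = p"
    using complex_poly_decompose' by blast
  define a where "a = lead_coeff p"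
  define P where "P = (\<Prod>i<degree p. [:- root i, 1:])"
  have pP: "p = smult a P" using root by (simp add: a_def P_def)
  have rt: "poly p (root i) = 0" if "i < degree p" for i
  proof -
    have "poly P (root i) = 0" unfolding P_def poly_prod using that by (intro prod_zero) auto
    then show ?thesis by (subst pP) simp
  qed
  then have re: "root i = of_real (Re (root i))" if "i < degree p" for i
    using p that by (auto simp: real_rooted_def complex_eq_iff)
  have ne: "x \<noteq> root i" if "i < degree p" for i using rt[OF that] x by auto
  have L: "poly (pderiv P) x = poly P x * (\<Sum>i<degree p. 1 / (x - root i))"
    "(poly (pderiv P) x)\<^sup>2 - poly (pderiv (pderiv P)) x * poly P x = (poly P x)\<^sup>2 * (\<Sum>i<degree p. 1 / (x - root i)\<^sup>2)"
    using log_derivatives[of "degree p" x root] ne unfolding P_def by blast+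
  have s: "(\<Sum>i<degree p. 1 / (x - root i)) = (\<Sum>i<degree p. 1 / (x - of_real (Re (root i))))"
    "(\<Sum>i<degree p. 1 / (x - root i)\<^sup>2) = (\<Sum>i<degree p. 1 / (x - of_real (Re (root i)))\<^sup>2)"
    using re by (auto intro!: sum.cong)
  show thesis
  proof (rule that[of "\<lambda>i. Re (root i)"])
    show "poly (pderiv p) x = poly p x * (\<Sum>i<degree p. 1 / (x - of_real (Re (root i))))"
      using L(1) unfolding s[symmetric] by (subst (1 2) pP) (simp add: pderiv_smult)
    have "(poly (pderiv p) x)\<^sup>2 - poly (pderiv (pderiv p)) x * poly p x
        = a\<^sup>2 * ((poly (pderiv P) x)\<^sup>2 - poly (pderiv (pderiv P)) x * poly P x)"
      by (subst (1 2 3) pP) (simp add: pderiv_smult power2_eq_square algebra_simps)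
    also have "\<dots> = (poly p x)\<^sup>2 * (\<Sum>i<degree p. 1 / (x - root i)\<^sup>2)"
    proof -
      have "poly p x = a * poly P x" using arg_cong[OF pP, of "\<lambda>q. poly q x"] by simp
      then show ?thesis by (simp only: L(2) power_mult_distrib mult.assoc)
    qed
    finally show "(poly (pderiv p) x)\<^sup>2 - poly (pderiv (pderiv p)) x * poly p x
      = (poly p x)\<^sup>2 * (\<Sum>i<degree p. 1 / (x - of_real (Re (root i)))\<^sup>2)" unfolding s .
    show "x \<noteq> of_real (Re (root i))" if "i < degree p" for i using ne[OF that] re[OF that] by simp
  qed
qed

lemma nuij_nonzero: "p \<noteq> 0 \<Longrightarrow> nuij c p \<noteq> 0"
proof
  assume p: "p \<noteq> 0" and n: "nuij c p = 0"
  then have "p = - smult (of_real c) (pderiv p)" by (simp add: nuij_def add_eq_0_iff)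
  then have "degree p \<le> degree p - 1"
    by (metis degree_minus degree_pderiv degree_smult_le)
  then have "degree p = 0" by simp
  then have "pderiv p = 0" by (simp add: pderiv_eq_0_iff)
  then show False using n p by (simp add: nuij_def)
qed

text \<open>At a nonreal x the logarithmic derivative, the sum of the 1/(x - r i) with real
  \<open>r i\<close>, has nonzero imaginary part, so it cannot equal -1/c.\<close>

lemma real_rooted_nuij:
  assumes p: "real_rooted p"
  shows "real_rooted (nuij c p)"
  unfolding real_rooted_def
proof (intro conjI allI impI)
  show "nuij c p \<noteq> 0" using p nuij_nonzero by (simp add: real_rooted_def)
  fix x assume x: "poly (nuij c p) x = 0"
  show "Im x = 0"
  proof (rule ccontr)
    assume im: "Im x \<noteq> 0"
    then have px: "poly p x \<noteq> 0" using p by (auto simp: real_rooted_def)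
    obtain r :: "nat \<Rightarrow> real" where r: "poly (pderiv p) x = poly p x * (\<Sum>i<degree p. 1 / (x - of_real (r i)))"
      using real_rooted_log_derivatives[OF p px] by metis
    let ?s = "\<Sum>i<degree p. 1 / (x - of_real (r i))"
    have "poly p x * (1 + of_real c * ?s) = 0"
      using x unfolding nuij_def by (simp add: r algebra_simps)
    then have s: "of_real c * ?s = -1" using px by (simp add: add_eq_0_iff)
    have "Im ?s = - Im x * (\<Sum>i<degree p. 1 / (cmod (x - of_real (r i)))\<^sup>2)"
      by (simp add: sum_distrib_left Im_divide cmod_power2)
    moreover have "c * Im ?s = 0" using arg_cong[OF s, of Im] by simp
    moreover have "c \<noteq> 0" using s by auto
    moreover have "degree p \<noteq> 0"
    proof
      assume "degree p = 0"
      with s show False by simp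
    qed
    ultimately have "(\<Sum>i<degree p. 1 / (cmod (x - of_real (r i)))\<^sup>2) = 0" using im by simp
    moreover have "(\<Sum>i<degree p. 1 / (cmod (x - of_real (r i)))\<^sup>2) > 0"
    proof (rule sum_pos)
      show "{..<degree p} \<noteq> {}" using \<open>degree p \<noteq> 0\<close> by auto
      show "0 < 1 / (cmod (x - of_real (r i)))\<^sup>2" for i
        using im by (auto simp: complex_eq_iff)
    qed simp
    ultimately show False by simp
  qed
qed

text \<open>A root of \<open>p\<close> loses multiplicity because p' does not vanish there to the
  full order. At any other point, a double root would give p = -c p' and p' = -c p'', hence p'^2 = p
  p''; but at a real point p'^2 - p p'' is p^2 times a positive sum of squares.\<close>

lemma order_nuij:
  assumes p: "real_rooted p" and c: "c \<noteq> 0"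
  shows "order x (nuij c p) \<le> max 1 (order x p - 1)"
proof (cases "poly p x = 0")
  case True
  have p0: "p \<noteq> 0" using p by (simp add: real_rooted_def)
  then have dp: "pderiv p \<noteq> 0" using True by (metis degree_0 order_root pderiv_eq_0_iff order_degree le_zero_eq)
  have o: "order x p \<noteq> 0" using True p0 by (simp add: order_root)
  then have op: "order x p = Suc (order x (pderiv p))" using order_pderiv[OF p0 True] by simp
  have "order x (nuij c p) < order x p"
  proof (rule ccontr)
    assume "\<not> ?thesis"
    then have "[:- x, 1:] ^ order x p dvd nuij c p" by (simp add: order_divides)
    moreover have "[:- x, 1:] ^ order x p dvd p" by (rule order_1)
    ultimately have "[:- x, 1:] ^ order x p dvd nuij c p - p" by (rule dvd_diff)
    then have "[:- x, 1:] ^ order x p dvd smult (of_real c) (pderiv p)" by (simp add: nuij_def)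
    then have "[:- x, 1:] ^ order x p dvd pderiv p" using c by (simp add: dvd_smult_iff)
    then have "order x p \<le> order x (pderiv p)" using dp unfolding order_divides by blast
    then show False using op by simp
  qed
  then show ?thesis by simp
next
  case False
  let ?q = "nuij c p"
  have "order x ?q \<le> 1"
  proof (rule ccontr)
    assume "\<not> ?thesis"
    then have o: "order x ?q \<ge> 2" by simp
    have rq: "real_rooted ?q" by (rule real_rooted_nuij[OF p])
    then have q0: "?q \<noteq> 0" by (simp add: real_rooted_def)
    have qx: "poly ?q x = 0" using o by (metis order_root not_numeral_le_zero)
    have "[:- x, 1:] ^ 2 dvd ?q" using o by (simp add: order_divides)
    then obtain k where k: "?q = [:- x, 1:] ^ 2 * k" by blast
    have q'x: "poly (pderiv ?q) x = 0"       by (simp only: k power2_eq_square mult.assoc pderiv_mult[of "[:- x, 1:]" "[:- x, 1:] * k"] poly_add poly_mult) simp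
    have x: "Im x = 0" using rq qx by (simp add: real_rooted_def)
    obtain r :: "nat \<Rightarrow> real" where r: "(poly (pderiv p) x)\<^sup>2 - poly (pderiv (pderiv p)) x * poly p x
      = (poly p x)\<^sup>2 * (\<Sum>i<degree p. 1 / (x - of_real (r i))\<^sup>2)" "\<And>i. i < degree p \<Longrightarrow> x \<noteq> of_real (r i)"
      using real_rooted_log_derivatives[OF p False] by metis
    have 1: "poly p x + of_real c * poly (pderiv p) x = 0" using qx by (simp add: nuij_def)
    have 2: "poly (pderiv p) x + of_real c * poly (pderiv (pderiv p)) x = 0"
      using q'x by (simp add: nuij_def pderiv_add pderiv_smult)
    have pe: "poly p x = - of_real c * poly (pderiv p) x" using 1 by (simp add: add_eq_0_iff)
    have pe2: "poly (pderiv p) x = - of_real c * poly (pderiv (pderiv p)) x" using 2 by (simp add: add_eq_0_iff)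
    have "(poly (pderiv p) x)\<^sup>2 - poly (pderiv (pderiv p)) x * poly p x = 0"
      unfolding pe by (subst (2) pe2) (simp add: power2_eq_square pe2)
    then have "(\<Sum>i<degree p. 1 / (x - of_real (r i))\<^sup>2) = 0" using r(1) False by simp
    moreover have "x = of_real (Re x)" using x by (simp add: complex_eq_iff)
    then have "(\<Sum>i<degree p. 1 / (x - of_real (r i))\<^sup>2) = of_real (\<Sum>i<degree p. 1 / (Re x - r i)\<^sup>2)"
      by (metis (no_types, lifting) of_real_1 of_real_diff of_real_divide of_real_power of_real_sum sum.cong)
    ultimately have s0: "(\<Sum>i<degree p. 1 / (Re x - r i)\<^sup>2) = 0" by (metis of_real_eq_0_iff)
    have "degree p \<noteq> 0"
    proof
      assume "degree p = 0"
      then have "pderiv p = 0" by (simp add: pderiv_eq_0_iff)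
      then show False using 1 False by simp
    qed
    then have "(\<Sum>i<degree p. 1 / (Re x - r i)\<^sup>2) > 0"
      using r(2) \<open>x = of_real (Re x)\<close> by (intro sum_pos) (auto simp: lessThan_empty_iff)
    then show False using s0 by simp
  qed
  then show ?thesis by simp
qed

lemma nuij_0 [simp]: "nuij 0 p = p"
  by (simp add: nuij_def)

lemma real_rooted_iter: "real_rooted p \<Longrightarrow> real_rooted ((nuij c ^^ n) p)"
  by (induction n) (auto intro: real_rooted_nuij)

lemma order_iter_le:
  assumes "real_rooted p" "c \<noteq> 0" "\<And>x. order x p \<le> Suc n"
  shows "order x ((nuij c ^^ n) p) \<le> 1"
proof -
  have "order x ((nuij c ^^ m) p) \<le> max 1 (Suc n - m)" for m x
  proof (induction m)
    case 0
    then show ?case using assms(3)[of x] by simp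
  next
    case (Suc m)
    have "order x (nuij c ((nuij c ^^ m) p)) \<le> max 1 (order x ((nuij c ^^ m) p) - 1)"
      by (rule order_nuij[OF real_rooted_iter[OF assms(1)] assms(2)])
    then show ?case using Suc by simp
  qed
  from this[of x n] show ?thesis by simp
qed

lemma order_iter_simple:
  assumes "real_rooted p" "\<And>x. order x p \<le> 1"
  shows "order x ((nuij c ^^ n) p) \<le> 1"
proof (induction n arbitrary: x)
  case (Suc n)
  show ?case
  proof (cases "c = 0")
    case False
    have "order x (nuij c ((nuij c ^^ n) p)) \<le> max 1 (order x ((nuij c ^^ n) p) - 1)"
      by (rule order_nuij[OF real_rooted_iter[OF assms(1)] False])
    then show ?thesis using Suc[of x] by simp
  qed (use Suc in simp)
qed (use assms in simp)

lemma simple_if_order_le_1: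
  fixes p :: "complex poly"
  assumes "p \<noteq> 0" "order x p \<le> 1"
  shows "poly p x \<noteq> 0 \<or> poly (pderiv p) x \<noteq> 0"
proof (rule ccontr)
  assume "\<not> ?thesis"
  then have "poly p x = 0" "poly (pderiv p) x = 0" by auto
  have "order x p \<noteq> 0" using assms(1) \<open>poly p x = 0\<close> by (simp add: order_root)
  moreover have "pderiv p \<noteq> 0"
    using assms(1) \<open>poly p x = 0\<close> by (metis degree_0 order_root pderiv_eq_0_iff order_degree le_zero_eq)
  ultimately have "order x p = Suc (order x (pderiv p))" using order_pderiv[OF assms(1) \<open>poly p x = 0\<close>] by simp
  moreover have "order x (pderiv p) \<noteq> 0"
    using \<open>pderiv p \<noteq> 0\<close> \<open>poly (pderiv p) x = 0\<close> by (simp add: order_root)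
  ultimately show False using assms(2) by simp
qed

section \<open>Nuij's operators on forms and contraction to X^d\<close>

definition hyperbolic_form :: "nat \<Rightarrow> real poly poly \<Rightarrow> bool" where
  "hyperbolic_form d f \<longleftrightarrow> (\<forall>(y::real) (z::real) x. poly (hpoly d f (of_real y) (of_real z)) x = 0 \<longrightarrow> Im x = 0)"

text \<open>In the chart y = 1 the factor Y of the operator becomes 1; in \<open>nuij_z\<close> the
  factor Z remains, as \<open>[:0, s:]\<close>.\<close>

definition nuij_y :: "real \<Rightarrow> real poly poly \<Rightarrow> real poly poly" where
  "nuij_y s f = f + smult [:s:] (pderiv f)"

definition nuij_z :: "real \<Rightarrow> real poly poly \<Rightarrow> real poly poly" where
  "nuij_z s f = f + smult [:0, s:] (pderiv f)"

text \<open>Over real (y, z) the operators act as \<open>nuij (s * z)\<close> and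
  \<open>nuij (s * y)\<close>. If z \<noteq> 0 the first family makes all roots simple and the
  second keeps them so; if z = 0 the first is the identity and the second does the work.
  Multiplicities are at most \<open>d\<close>, so \<open>d\<close> applications suffice.\<close>

definition nuij_form :: "nat \<Rightarrow> real \<Rightarrow> real poly poly \<Rightarrow> real poly poly" where
  "nuij_form d s f = (nuij_y s ^^ d) ((nuij_z s ^^ d) f)"

lemma cf_nuij_y: "cf (nuij_y s f) k j = cf f k j + s * real (Suc k) * cf f (Suc k) j"
proof -
  have "cf (pderiv f) k j = real (Suc k) * cf f (Suc k) j"
    by (simp add: coeff_pderiv of_nat_poly)
  then show ?thesis by (simp add: nuij_y_def)
qed

lemma cf_nuij_z: "cf (nuij_z s f) k j = cf f k j + (case j of 0 \<Rightarrow> 0 | Suc i \<Rightarrow> s * real (Suc k) * cf f (Suc k) i)"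
proof -
  have "cf (pderiv f) k j = real (Suc k) * cf f (Suc k) j" for j
    by (simp add: coeff_pderiv of_nat_poly)
  then show ?thesis by (simp add: nuij_z_def coeff_pCons split: nat.split)
qed

lemma monic_form_iff: "monic_form d f \<longleftrightarrow> cf f d 0 = 1 \<and> (\<forall>k j. k + j > d \<longrightarrow> cf f k j = 0)"
proof -
  have "coeff f d = 1" if "cf f d 0 = 1" "\<forall>k j. k + j > d \<longrightarrow> cf f k j = 0"
  proof (rule poly_eqI)
    fix j show "coeff (coeff f d) j = coeff 1 j" using that by (cases j) auto
  qed
  then show ?thesis unfolding monic_form_def total_degree_le_def by auto
qed

lemma monic_form_nuij_y: "monic_form d f \<Longrightarrow> monic_form d (nuij_y s f)"
  unfolding monic_form_iff cf_nuij_y by auto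

lemma monic_form_nuij_z: "monic_form d f \<Longrightarrow> monic_form d (nuij_z s f)"
  unfolding monic_form_iff cf_nuij_z by (auto split: nat.split)

lemma hpoly_nuij_y:
  assumes f: "monic_form d f"
  shows "hpoly d (nuij_y s f) (of_real y) (of_real z) = nuij (s * y) (hpoly d f (of_real y) (of_real z))"
proof (rule poly_eqI)
  fix k
  have f0: "cf f k j = 0" if "k + j > d" for k j using f that by (simp add: monic_form_iff)
  show "coeff (hpoly d (nuij_y s f) (of_real y) (of_real z)) k = coeff (nuij (s * y) (hpoly d f (of_real y) (of_real z))) k"
  proof (cases "k < d")
    case True
    have "of_real (cf (nuij_y s f) k j) * of_real y ^ (d - k - j) * of_real z ^ j
      = of_real (cf f k j) * of_real y ^ (d - k - j) * of_real z ^ j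
        + of_real (s * y) * (of_nat (Suc k) * (of_real (cf f (Suc k) j) * complex_of_real y ^ (d - Suc k - j) * of_real z ^ j))" for j
    proof (cases "Suc k + j \<le> d")
      case True
      then have "d - k - j = Suc (d - Suc k - j)" by simp
      then have "complex_of_real y ^ (d - k - j) = of_real y * of_real y ^ (d - Suc k - j)" by simp
      then show ?thesis by (simp add: cf_nuij_y algebra_simps)
    qed (simp add: cf_nuij_y f0)
    then show ?thesis using True
      by (simp add: coeff_hpoly nuij_def coeff_pderiv sum.distrib sum_distrib_left)
  next
    case False
    then show ?thesis
      by (auto simp: coeff_hpoly nuij_def coeff_pderiv cf_nuij_y f0)
  qed
qed

lemma hpoly_nuij_z:
  assumes f: "monic_form d f"
  shows "hpoly d (nuij_z s f) (of_real y) (of_real z) = nuij (s * z) (hpoly d f (of_real y) (of_real z))"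
proof (rule poly_eqI)
  fix k
  have f0: "cf f k j = 0" if "k + j > d" for k j using f that by (simp add: monic_form_iff)
  show "coeff (hpoly d (nuij_z s f) (of_real y) (of_real z)) k = coeff (nuij (s * z) (hpoly d f (of_real y) (of_real z))) k"
  proof (cases "k < d")
    case True
    let ?c = "\<lambda>j. of_real s * (of_nat (Suc k) * (of_real (cf f (Suc k) j) * complex_of_real y ^ (d - Suc k - j) * of_real z ^ Suc j))"
    obtain d' where d': "d = Suc d'" using True by (cases d) auto
    have "(\<Sum>j\<le>d. of_real (cf (nuij_z s f) k j) * complex_of_real y ^ (d - k - j) * of_real z ^ j)
      = (\<Sum>j\<le>d. of_real (cf f k j) * complex_of_real y ^ (d - k - j) * of_real z ^ j)
       + (\<Sum>j\<le>d. case j of 0 \<Rightarrow> 0 | Suc i \<Rightarrow> ?c i)"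
      unfolding sum.distrib[symmetric]
      by (intro sum.cong refl) (auto simp: cf_nuij_z algebra_simps split: nat.split)
    also have "(\<Sum>j\<le>d. case j of 0 \<Rightarrow> 0 | Suc i \<Rightarrow> ?c i) = (\<Sum>i\<le>d'. ?c i)"
      unfolding d' by (subst sum.atMost_Suc_shift) simp
    \<comment> \<open>Multiplication by z has shifted the index by one; the term i = d that is added
      has total degree above \<open>d\<close> and is zero.\<close>
    also have "\<dots> = (\<Sum>i\<le>d. ?c i)"
      by (simp add: d' f0)
    finally show ?thesis using True
      by (simp add: coeff_hpoly nuij_def coeff_pderiv sum_distrib_left mult_ac)
  next
    case False
    then show ?thesis
      by (auto simp: coeff_hpoly nuij_def coeff_pderiv cf_nuij_z f0 split: nat.split intro!: sum.cong)
  qed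
qed

lemma nuij_iter:
  assumes f: "monic_form d f"
  shows "monic_form d ((nuij_z s ^^ n) f)" "monic_form d ((nuij_y s ^^ n) f)"
    "hpoly d ((nuij_z s ^^ n) f) (of_real y) (of_real z) = (nuij (s * z) ^^ n) (hpoly d f (of_real y) (of_real z))"
    "hpoly d ((nuij_y s ^^ n) f) (of_real y) (of_real z) = (nuij (s * y) ^^ n) (hpoly d f (of_real y) (of_real z))"
proof -
  show z: "monic_form d ((nuij_z s ^^ n) f)" for n by (induction n) (auto simp: f monic_form_nuij_z)
  show y: "monic_form d ((nuij_y s ^^ n) f)" for n by (induction n) (auto simp: f monic_form_nuij_y)
  show "hpoly d ((nuij_z s ^^ n) f) (of_real y) (of_real z) = (nuij (s * z) ^^ n) (hpoly d f (of_real y) (of_real z))"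
    by (induction n) (auto simp: hpoly_nuij_z[OF z])
  show "hpoly d ((nuij_y s ^^ n) f) (of_real y) (of_real z) = (nuij (s * y) ^^ n) (hpoly d f (of_real y) (of_real z))"
    by (induction n) (auto simp: hpoly_nuij_y[OF y])
qed

lemma monic_form_nuij_form: "monic_form d f \<Longrightarrow> monic_form d (nuij_form d s f)"
  unfolding nuij_form_def by (intro nuij_iter)

lemma coeff_hpoly_d:
  assumes "monic_form d f"
  shows "coeff (hpoly d f y z) d = 1"
proof -
  have "(\<Sum>j\<le>d. of_real (cf f d j) * y ^ (d - d - j) * z ^ j) = (\<Sum>j\<le>d. if j = 0 then 1 else 0)"
    using assms by (intro sum.cong) (auto simp: monic_form_iff)
  then show ?thesis by (simp add: coeff_hpoly)
qed

lemma hpoly_0_0: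
  assumes "monic_form d f"
  shows "hpoly d f 0 0 = monom 1 d"
proof (rule poly_eqI)
  fix k
  have "of_real (cf f k j) * 0 ^ (d - k - j) * 0 ^ j = (0::complex)" if "k < d" for j
    using that by (cases j) auto
  then show "coeff (hpoly d f 0 0) k = coeff (monom 1 d) k"
    using coeff_hpoly_d[OF assms, of 0 0] by (cases k d rule: linorder_cases) (auto simp: coeff_hpoly)
qed

lemma simple_rooted_nuij_form:
  assumes f: "monic_form d f" and h: "hyperbolic_form d f" and s: "s \<noteq> 0"
  shows "simple_rooted d (nuij_form d s f)"
  unfolding simple_rooted_def
proof (intro allI impI)
  fix x :: complex and y z :: real
  assume xyz: "x \<noteq> 0 \<or> y \<noteq> 0 \<or> z \<noteq> 0"
  let ?p = "hpoly d f (of_real y) (of_real z)"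
  have eq: "hpoly d (nuij_form d s f) (of_real y) (of_real z) = (nuij (s * y) ^^ d) ((nuij (s * z) ^^ d) ?p)"
    unfolding nuij_form_def using nuij_iter(3,4) nuij_iter(1)[OF f] f by simp
  have p0: "?p \<noteq> 0" using coeff_hpoly_d[OF f, of "of_real y" "of_real z"] by auto
  then have rr: "real_rooted ?p" using h unfolding real_rooted_def hyperbolic_form_def by blast
  have "degree ?p \<le> d" by (rule degree_le) (simp add: coeff_hpoly)
  then have ord: "order x ?p \<le> Suc d" for x using order_degree[OF p0, of x] by simp
  show "poly (hpoly d (nuij_form d s f) (of_real y) (of_real z)) x \<noteq> 0 \<or>
     poly (pderiv (hpoly d (nuij_form d s f) (of_real y) (of_real z))) x \<noteq> 0"
  proof (cases "y = 0 \<and> z = 0")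
    case True
    then show ?thesis using xyz hpoly_0_0[OF monic_form_nuij_form[OF f]] by (simp add: poly_monom)
  next
    case False
    have rr': "real_rooted ((nuij (s * z) ^^ d) ?p)" by (rule real_rooted_iter[OF rr])
    have "order x ((nuij (s * y) ^^ d) ((nuij (s * z) ^^ d) ?p)) \<le> 1"
    proof (cases "z = 0")
      case True
      then have "y \<noteq> 0" using False by simp
      have "(nuij 0 ^^ n) q = q" for n q by (induction n) auto
      then have "(nuij (s * z) ^^ d) ?p = ?p" using True by simp
      then show ?thesis using order_iter_le[OF rr _ ord] \<open>y \<noteq> 0\<close> s by simp
    next
      case False
      then have "order x ((nuij (s * z) ^^ d) ?p) \<le> 1" for x
        using order_iter_le[OF rr _ ord] s by simp
      then show ?thesis by (rule order_iter_simple[OF rr'])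
    qed
    moreover have "(nuij (s * y) ^^ d) ((nuij (s * z) ^^ d) ?p) \<noteq> 0"
      using real_rooted_iter[OF rr'] by (simp add: real_rooted_def)
    ultimately show ?thesis unfolding eq by (intro simple_if_order_le_1)
  qed
qed

text \<open>F(x, t y, t z): the coefficient of x^k has degree d - k in y and z. This contracts a
  monic form to x^d while preserving hyperbolicity.\<close>

definition scale_form :: "nat \<Rightarrow> real \<Rightarrow> real poly poly \<Rightarrow> real poly poly" where
  "scale_form d t f = (\<Sum>k\<le>d. monom (smult (t ^ (d - k)) (coeff f k)) k)"

lemma cf_scale_form: "cf (scale_form d t f) k j = (if k \<le> d then t ^ (d - k) * cf f k j else 0)"
proof -
  have "cf (scale_form d t f) k j = (\<Sum>i\<le>d. if i = k then t ^ (d - k) * cf f k j else 0)"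
    unfolding scale_form_def coeff_sum by (intro sum.cong) auto
  then show ?thesis by simp
qed

lemma monic_form_scale_form: "monic_form d f \<Longrightarrow> monic_form d (scale_form d t f)"
  unfolding monic_form_iff cf_scale_form by auto

lemma scale_form_1: "monic_form d f \<Longrightarrow> scale_form d 1 f = f"
  by (intro poly_eqI) (auto simp: cf_scale_form monic_form_iff)

lemma scale_form_0: "monic_form d f \<Longrightarrow> scale_form d 0 f = monom 1 d"
proof (intro poly_eqI)
  fix k j
  assume "monic_form d f"
  then show "cf (scale_form d 0 f) k j = cf (monom 1 d) k j"
    by (cases k d rule: linorder_cases; cases j) (auto simp: cf_scale_form monic_form_iff)
qed

lemma hpoly_scale_form:
  assumes f: "monic_form d f"
  shows "hpoly d (scale_form d t f) y z = hpoly d f (of_real t * y) (of_real t * z)"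
proof (rule poly_eqI)
  fix k
  have "of_real (cf (scale_form d t f) k j) * y ^ (d - k - j) * z ^ j
     = of_real (cf f k j) * (of_real t * y) ^ (d - k - j) * (of_real t * z) ^ j" if "k \<le> d" for j
  proof (cases "k + j \<le> d")
    case True
    then have "t ^ (d - k) = t ^ (d - k - j) * t ^ j" by (simp flip: power_add)
    then show ?thesis using that by (simp add: cf_scale_form power_mult_distrib mult_ac)
  qed (use f in \<open>simp add: cf_scale_form monic_form_iff\<close>)
  then show "coeff (hpoly d (scale_form d t f) y z) k = coeff (hpoly d f (of_real t * y) (of_real t * z)) k"
    by (simp add: coeff_hpoly)
qed

lemma hyperbolic_form_scale_form:
  assumes "monic_form d f" "hyperbolic_form d f"
  shows "hyperbolic_form d (scale_form d t f)"
  using assms(2) unfolding hyperbolic_form_def hpoly_scale_form[OF assms(1)] of_real_mult[symmetric] by blast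

text \<open>\<open>Q\<close> stands for a regularity property, such as differentiability, of functions of \<open>t\<close>.\<close>

lemma nuij_form_invariant:
  assumes "\<And>k j. Q (\<lambda>t. cf (g t) k j)"
    and step: "\<And>u v c. Q u \<Longrightarrow> Q v \<Longrightarrow> Q (\<lambda>t. u t + S t * c * v t)"
  shows "Q (\<lambda>t. cf (nuij_form d (S t) (g t)) k j)"
proof -
  have y: "Q (\<lambda>t. cf (nuij_y (S t) (h t)) k j)" if "\<And>k j. Q (\<lambda>t. cf (h t) k j)" for h k j
    unfolding cf_nuij_y using that by (intro step)
  have z: "Q (\<lambda>t. cf (nuij_z (S t) (h t)) k j)" if "\<And>k j. Q (\<lambda>t. cf (h t) k j)" for h k j
    unfolding cf_nuij_z using that step by (cases j) auto
  have zn: "Q (\<lambda>t. cf ((nuij_z (S t) ^^ n) (g t)) k j)" for n k j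
    by (induction n arbitrary: k j) (auto intro: assms(1) z)
  have "Q (\<lambda>t. cf ((nuij_y (S t) ^^ n) ((nuij_z (S t) ^^ d) (g t))) k j)" for n k j
    by (induction n arbitrary: k j) (auto intro: zn y)
  then show ?thesis unfolding nuij_form_def .
qed

lemma nuij_form_path_differentiable:
  "(\<lambda>t. cf (nuij_form d s (scale_form d t f)) k j) differentiable at t"
proof (rule nuij_form_invariant[where Q = "\<lambda>u. u differentiable at t" and S = "\<lambda>_. s"])
  show "(\<lambda>t. cf (scale_form d t f) k j) differentiable at t" for k j
    unfolding cf_scale_form by (cases "k \<le> d") (auto intro!: derivative_intros)
qed (auto intro!: derivative_intros)

lemma nuij_form_0: "nuij_form d 0 f = f"
proof -
  have "(nuij_y 0 ^^ n) f = f" "(nuij_z 0 ^^ n) f = f" for n f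
    by (induction n) (auto simp: nuij_y_def nuij_z_def)
  then show ?thesis by (simp add: nuij_form_def)
qed

lemma nuij_form_tendsto:
  "((\<lambda>s. cf (nuij_form d s f) k j) \<longlongrightarrow> cf f k j) (at 0)"
proof -
  have "isCont (\<lambda>s. cf (nuij_form d s f) k j) 0"
    by (rule nuij_form_invariant[where Q = "\<lambda>u. isCont u 0" and S = "\<lambda>s. s" and g = "\<lambda>_. f"])
       (auto intro!: continuous_intros)
  then show ?thesis by (simp add: isCont_def nuij_form_0)
qed

subsection \<open>Generic perturbations\<close>

text \<open>Six real numbers, packed into a Euclidean space so that negligible sets apply. The real
  affine factor of x adjusts the x-derivative at a nonreal \<open>z\<close>; the real cubic in z
  then adjusts value and z-derivative. The cubic has total degree three, hence d \<ge> 3.\<close>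

fun perturb :: "complex \<times> complex \<times> complex \<Rightarrow> real poly poly" where
  "perturb (p, q, r) = [:[:Re q, Im q, Re r, Im r:], [:Re p, Im p:]:]"

lemma cf_perturb: "cf (perturb (p, q, r)) k j =
    (if k = 0 then if j = 0 then Re q else if j = 1 then Im q else if j = 2 then Re r else if j = 3 then Im r else 0
     else if k = 1 then if j = 0 then Re p else if j = 1 then Im p else 0 else 0)"
  by (auto simp: coeff_pCons numeral_2_eq_2 numeral_3_eq_3 split: nat.split)

lemma sum_perturb:
  fixes h :: "nat \<Rightarrow> nat \<Rightarrow> complex"
  assumes "d \<ge> 3"
  shows "(\<Sum>k\<le>d. \<Sum>j\<le>d. of_real (cf (perturb (p, q, r)) k j) * h k j) =
    of_real (Re q) * h 0 0 + of_real (Im q) * h 0 1 + of_real (Re r) * h 0 2 + of_real (Im r) * h 0 3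
    + of_real (Re p) * h 1 0 + of_real (Im p) * h 1 1"
proof -
  let ?c = "\<lambda>k j. of_real (cf (perturb (p, q, r)) k j) * h k j"
  have inner: "(\<Sum>j\<le>d. ?c k j) = (\<Sum>j\<in>{0,1,2,3}. ?c k j)" for k
    using assms by (intro sum.mono_neutral_right) (auto simp: cf_perturb simp del: perturb.simps)
  have "(\<Sum>k\<le>d. \<Sum>j\<le>d. ?c k j) = (\<Sum>k\<in>{0,1}. \<Sum>j\<in>{0,1,2,3}. ?c k j)"
    unfolding inner using assms by (intro sum.mono_neutral_right) (auto simp: cf_perturb simp del: perturb.simps)
  also have "\<dots> = of_real (Re q) * h 0 0 + of_real (Im q) * h 0 1 + of_real (Re r) * h 0 2 + of_real (Im r) * h 0 3
    + of_real (Re p) * h 1 0 + of_real (Im p) * h 1 1"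
    by (simp add: cf_perturb del: perturb.simps)
  finally show ?thesis .
qed

lemma monic_form_perturb:
  assumes "d \<ge> 3" "monic_form d f"
  shows "monic_form d (f + perturb a)"
proof (cases a)
  case (fields p q r)
  show ?thesis using assms unfolding fields monic_form_iff
    by (auto simp: cf_perturb simp del: perturb.simps)
qed

lemma poly_pderiv_hpoly: "poly (pderiv (hpoly d f y z)) x =
  (\<Sum>k\<le>d. \<Sum>j\<le>d. of_real (cf f k j) * (of_nat k * x ^ (k - 1) * y ^ (d - k - j) * z ^ j))"
  unfolding hpoly_def higher_pderiv_sum[of 1, simplified]
  by (simp add: pderiv_sum pderiv_monom poly_sum poly_monom sum_distrib_left mult_ac)

lemma poly_hpoly': "poly (hpoly d f y z) x =
  (\<Sum>k\<le>d. \<Sum>j\<le>d. of_real (cf f k j) * (x ^ k * y ^ (d - k - j) * z ^ j))"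
  by (simp add: poly_hpoly mult.assoc)

lemma zderiv': "zderiv d f x z = (\<Sum>k\<le>d. \<Sum>j\<le>d. of_real (cf f k j) * (x ^ k * (of_nat j * z ^ (j - 1))))"
  by (simp add: zderiv_def mult.assoc)

lemma sum_cf_add:
  fixes h :: "nat \<Rightarrow> nat \<Rightarrow> complex"
  shows "(\<Sum>k\<le>d. \<Sum>j\<le>d. of_real (cf (f + g) k j) * h k j) =
    (\<Sum>k\<le>d. \<Sum>j\<le>d. of_real (cf f k j) * h k j) + (\<Sum>k\<le>d. \<Sum>j\<le>d. of_real (cf g k j) * h k j)"
  by (simp add: algebra_simps sum.distrib)

lemma differentiable_bounded_linear:
  "bounded_linear L \<Longrightarrow> f differentiable at x \<Longrightarrow> (\<lambda>x. L (f x)) differentiable at x"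
  using differentiable_chain_at[of f x L] by (simp add: bounded_linear_imp_differentiable comp_def)

text \<open>Hermite interpolation at the conjugate pair \<open>z, cnj z\<close> determines the perturbation from the
  singular point; the six real parameters are thus a smooth function of the five real parameters
  \<open>t, x, z\<close>.\<close>

lemma negligible_singular_perturbations:
  fixes G :: "real \<Rightarrow> real poly poly"
  assumes d: "d \<ge> 3" and G: "\<And>k j t. (\<lambda>t. cf (G t) k j) differentiable at t"
  shows "negligible {a. \<exists>t. \<not> nonreal_smooth d (G t + perturb a)}"
proof -
  define S where "S = {p :: real \<times> complex \<times> complex. Im (snd (snd p)) \<noteq> 0}"
  define T X Z where "T = (\<lambda>p :: real \<times> complex \<times> complex. fst p)"
    and "X = (\<lambda>p :: real \<times> complex \<times> complex. fst (snd p))"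
    and "Z = (\<lambda>p :: real \<times> complex \<times> complex. snd (snd p))"
  define ev where "ev h p = (\<Sum>k\<le>d. \<Sum>j\<le>d. complex_of_real (cf (G (T p)) k j) * h k j p)" for h p
  define v where "v = ev (\<lambda>k j p. X p ^ k * 1 ^ (d - k - j) * Z p ^ j)"
  define u where "u = ev (\<lambda>k j p. of_nat k * X p ^ (k - 1) * 1 ^ (d - k - j) * Z p ^ j)"
  define w where "w = ev (\<lambda>k j p. X p ^ k * (of_nat j * Z p ^ (j - 1)))"
  define y where "y p = Im (Z p)" for p
  \<comment> \<open>For nonreal z every complex number is a + b z with unique real a and b, and b is
    the quotient of the imaginary parts. Here -u is written in this way, so that the x-derivative
    cancels; the same device recurs for \<open>V\<close> and \<open>R\<close>.\<close>
  define p1 where "p1 p = Im (- u p) / y p" for p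
  define p0 where "p0 p = Re (- u p) - p1 p * Re (Z p)" for p
  \<comment> \<open>Since p0 + p1 z = -u, this is the value that the cubic must take at z; al + be z
    interpolates it at z and its conjugate.\<close>
  define V where "V p = - v p + X p * u p" for p
  define be where "be p = Im (V p) / y p" for p
  define al where "al p = Re (V p) - be p * Re (Z p)" for p
  \<comment> \<open>The cubic is al + be T + (ga + de T)(T^2 - 2 Re(z) T + m), the quadratic
    vanishing at z and its conjugate. Its derivative at T = z is be + (ga + de z) 2 i Im(z), so
    \<open>R\<close> is the required value of ga + de z.\<close>
  define R where "R p = (- w p - of_real (p1 p) * X p - of_real (be p)) / (2 * \<i> * of_real (y p))" for p
  define de where "de p = Im (R p) / y p" for p
  define ga where "ga p = Re (R p) - de p * Re (Z p)" for p
  define m where "m p = (Re (Z p))\<^sup>2 + (Im (Z p))\<^sup>2" for p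
  \<comment> \<open>The second and third components list the coefficients of the expanded cubic in
    increasing order of powers.\<close>
  define Phi where "Phi p = (of_real (p0 p) + \<i> * of_real (p1 p),
     of_real (al p + ga p * m p) + \<i> * of_real (be p - 2 * Re (Z p) * ga p + m p * de p),
     of_real (ga p - 2 * Re (Z p) * de p) + \<i> * of_real (de p))" for p
  have dT: "T differentiable at p" and dX: "X differentiable at p" and dZ: "Z differentiable at p" for p
    unfolding T_def X_def Z_def
    by (auto intro!: bounded_linear_imp_differentiable bounded_linear_intros)
  note bl = differentiable_bounded_linear[OF bounded_linear_Re] differentiable_bounded_linear[OF bounded_linear_Im]
    differentiable_bounded_linear[OF bounded_linear_of_real]
  have dev: "ev h differentiable at p" if "\<And>k j. (\<lambda>p. h k j p) differentiable at p" for h p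
  proof -
    have "(\<lambda>p. cf (G (T p)) k j) differentiable at p" for k j
      using differentiable_chain_at[OF dT, of "\<lambda>t. cf (G t) k j" p] G by (simp add: comp_def)
    then show ?thesis unfolding ev_def using that
      by (intro differentiable_sum differentiable_mult bl ballI finite_atMost)
  qed
  have "Phi differentiable_on S"
    unfolding differentiable_on_def
  proof
    fix p assume "p \<in> S"
    then have y0: "y p \<noteq> 0" by (simp add: S_def y_def Z_def)
    note di = differentiable_add differentiable_diff differentiable_mult differentiable_divide differentiable_minus
      differentiable_power differentiable_const bl dX dZ
    have dv: "v differentiable at p" and du: "u differentiable at p" and dw: "w differentiable at p"
      unfolding v_def u_def w_def by (intro dev di)+
    have dy: "y differentiable at p" unfolding y_def by (intro di)
    have dp1: "p1 differentiable at p" unfolding p1_def by (intro di du dy y0)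
    have dp0: "p0 differentiable at p" unfolding p0_def by (intro di du dp1)
    have dV: "V differentiable at p" unfolding V_def by (intro di du dv)
    have dbe: "be differentiable at p" unfolding be_def by (intro di dV dy y0)
    have dal: "al differentiable at p" unfolding al_def by (intro di dV dbe)
    have dR: "R differentiable at p" unfolding R_def by (intro di dw dp1 dbe dy) (use y0 in simp)
    have dde: "de differentiable at p" unfolding de_def by (intro di dR dy y0)
    have dga: "ga differentiable at p" unfolding ga_def by (intro di dR dde)
    have dm: "m differentiable at p" unfolding m_def by (intro di)
    have "Phi differentiable at p"
      unfolding Phi_def by (intro differentiable_Pair di dp0 dp1 dal dbe dga dde dm)
    then show "Phi differentiable at p within S" by (rule differentiable_at_withinI)
  qed
  then have "negligible (Phi ` S)"
    by (rule negligible_differentiable_image_lowdim[rotated]) simp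
  moreover have "{a. \<exists>t. \<not> nonreal_smooth d (G t + perturb a)} \<subseteq> Phi ` S"
  proof
    fix a assume "a \<in> {a. \<exists>t. \<not> nonreal_smooth d (G t + perturb a)}"
    then obtain t x z where z: "Im z \<noteq> 0"
      and 1: "poly (hpoly d (G t + perturb a) 1 z) x = 0"
      and 2: "poly (pderiv (hpoly d (G t + perturb a) 1 z)) x = 0"
      and 3: "zderiv d (G t + perturb a) x z = 0"
      unfolding nonreal_smooth_def by blast
    obtain a1 a2 a3 where a: "a = (a1, a2, a3)" by (cases a)
    define P where "P = (t, x, z)"
    have TXZ: "T P = t" "X P = x" "Z P = z" by (simp_all add: P_def T_def X_def Z_def)
    have e1: "v P + (Re a2 + Im a2 * z + Re a3 * z\<^sup>2 + Im a3 * z ^ 3) + (Re a1 + Im a1 * z) * x = 0"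
      using 1 unfolding poly_hpoly' sum_cf_add a sum_perturb[OF d]
      by (simp add: v_def ev_def TXZ algebra_simps)
    have e2: "u P + (Re a1 + Im a1 * z) = 0"
      using 2 unfolding poly_pderiv_hpoly sum_cf_add a sum_perturb[OF d]
      by (simp add: u_def ev_def TXZ algebra_simps)
    have e3: "w P + (Im a2 + 2 * Re a3 * z + 3 * Im a3 * z\<^sup>2) + Im a1 * x = 0"
      using 3 unfolding zderiv' sum_cf_add a sum_perturb[OF d]
      by (simp add: w_def ev_def TXZ algebra_simps)
    have solve: "- a - x * c = b" if "a + b + c * x = 0" for a b c :: complex
    proof -
      have "b = (a + b + c * x) - a - x * c" by (simp add: algebra_simps)
      then show ?thesis using that by simp
    qed
    have yP: "y P = Im z" by (simp add: y_def TXZ)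
    have U: "- u P = Re a1 + Im a1 * z" using e2 by (simp add: add_eq_0_iff2 add.commute)
    have p1: "p1 P = Im a1" unfolding p1_def U yP using z by simp
    have p0: "p0 P = Re a1" unfolding p0_def U p1 by (simp add: TXZ)
    \<comment> \<open>Division with remainder of the given cubic by the quadratic with roots z and
      its conjugate: C + D T is the quotient, A + B T the remainder.\<close>
    define D where "D = Im a3"
    define C where "C = Re a3 + 2 * Re z * D"
    define B where "B = Im a2 + 2 * Re z * C - m P * D"
    define A where "A = Re a2 - C * m P"
    have mP: "m P = (Re z)\<^sup>2 + (Im z)\<^sup>2" by (simp add: m_def TXZ)
    have quad: "z\<^sup>2 = 2 * Re z * z - m P"
      unfolding mP by (simp add: complex_eq_iff power2_eq_square algebra_simps)
    have cubic: "z ^ 3 = 2 * Re z * z\<^sup>2 - m P * z"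
      using arg_cong[OF quad, of "\<lambda>s. s * z"] by (simp add: power2_eq_square power3_eq_cube algebra_simps)
    have "V P = - v P - x * (Re a1 + Im a1 * z)" unfolding V_def TXZ U[symmetric] by simp
    also have "\<dots> = Re a2 + Im a2 * z + Re a3 * z\<^sup>2 + Im a3 * z ^ 3"
      by (rule solve[OF e1])
    also have "\<dots> = A + B * z"
      unfolding cubic quad A_def B_def C_def D_def by (simp add: algebra_simps)
    finally have V: "V P = A + B * z" .
    have be: "be P = B" unfolding be_def V yP using z by simp
    have al: "al P = A" unfolding al_def V be by (simp add: TXZ)
    have z2: "2 * z - 2 * Re z = 2 * \<i> * Im z" by (simp add: complex_eq_iff)
    have "- w P - Im a1 * x - B = Im a2 + 2 * Re a3 * z + 3 * Im a3 * z\<^sup>2 - B"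
      using solve[OF e3] by (simp add: mult.commute)
    also have "\<dots> = (C + D * z) * (2 * z - 2 * Re z)"
    proof -
      have "z * z + m P = z * (2 * Re z)"
        using quad by (simp add: power2_eq_square)
      from arg_cong[OF this, of "\<lambda>s. Im a3 * s"] show ?thesis
        by (simp add: B_def C_def D_def power2_eq_square algebra_simps)
    qed
    finally have "R P = C + D * z"
      unfolding R_def p1 be TXZ yP z2 using z by simp
    then have de: "de P = D" and ga: "ga P = C"
      unfolding de_def ga_def yP using z by (simp_all add: TXZ)
    have "Phi P = a"
      unfolding Phi_def p0 p1 al be de ga TXZ a A_def B_def
      by (simp add: complex_eq_iff C_def D_def)
    moreover have "P \<in> S" using z by (simp add: S_def P_def)
    ultimately show "a \<in> Phi ` S" by blast
  qed
  ultimately show ?thesis using negligible_subset by blast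
qed

section \<open>Stability of simple roots under small perturbations\<close>

lemma poly_hpoly_homogeneous:
  assumes f: "monic_form d f"
  shows "poly (hpoly d f (c * y) (c * z)) (c * x) = c ^ d * poly (hpoly d f y z) x"
    and "c * poly (pderiv (hpoly d f (c * y) (c * z))) (c * x) = c ^ d * poly (pderiv (hpoly d f y z)) x"
proof -
  have e: "of_real (cf f k j) * ((c * x) ^ k * (c * y) ^ (d - k - j) * (c * z) ^ j)
      = c ^ d * (of_real (cf f k j) * (x ^ k * y ^ (d - k - j) * z ^ j))" for k j and x :: complex
  proof (cases "k + j \<le> d")
    case True
    then have "c ^ d = c ^ k * c ^ (d - k - j) * c ^ j" by (simp flip: power_add)
    then show ?thesis by (simp add: power_mult_distrib)
  qed (use f in \<open>simp add: monic_form_iff\<close>)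
  show "poly (hpoly d f (c * y) (c * z)) (c * x) = c ^ d * poly (hpoly d f y z) x"
    unfolding poly_hpoly' sum_distrib_left e ..
  have "c * (of_real (cf f k j) * (of_nat k * (c * x) ^ (k - 1) * (c * y) ^ (d - k - j) * (c * z) ^ j))
      = c ^ d * (of_real (cf f k j) * (of_nat k * x ^ (k - 1) * y ^ (d - k - j) * z ^ j))" for k j
  proof (cases "k = 0 \<or> k + j > d")
    case False
    then have "c ^ d = c * c ^ (k - 1) * c ^ (d - k - j) * c ^ j" by (simp flip: power_add power_Suc)
    then show ?thesis by (simp add: power_mult_distrib)
  qed (use f in \<open>auto simp: monic_form_iff\<close>)
  then show "c * poly (pderiv (hpoly d f (c * y) (c * z))) (c * x) = c ^ d * poly (pderiv (hpoly d f y z)) x"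
    unfolding poly_pderiv_hpoly sum_distrib_left by (intro sum.cong refl)
qed

lemma simple_rooted_if_on_sphere:
  assumes f: "monic_form d f"
    and sph: "\<And>x (y::real) (z::real). norm (x, y, z) = 1 \<Longrightarrow>
      poly (hpoly d f (of_real y) (of_real z)) x \<noteq> 0 \<or> poly (pderiv (hpoly d f (of_real y) (of_real z))) x \<noteq> 0"
  shows "simple_rooted d f"
  unfolding simple_rooted_def
proof (intro allI impI)
  fix x :: complex and y z :: real
  assume "x \<noteq> 0 \<or> y \<noteq> 0 \<or> z \<noteq> 0"
  then have n: "norm (x, y, z) \<noteq> 0" by (auto simp: prod_eq_iff)
  define c where "c = 1 / norm (x, y, z)"
  have c: "c > 0" using n by (simp add: c_def)
  have "norm (c *\<^sub>R (x, y, z)) = 1" using n by (simp only: norm_scaleR c_def) simp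
  then have "norm (of_real c * x, c * y, c * z) = 1" by (simp add: scaleR_conv_of_real)
  from sph[OF this] show "poly (hpoly d f (of_real y) (of_real z)) x \<noteq> 0 \<or> poly (pderiv (hpoly d f (of_real y) (of_real z))) x \<noteq> 0"
    using poly_hpoly_homogeneous[OF f, of "of_real c" "of_real y" "of_real z" x] c by auto
qed

text \<open>Simple roots mean that |p| + |p'| has no zero on the product of the path with the unit
  sphere. This product is compact, so the sum has a positive minimum there; homogeneity extends the
  conclusion from the sphere to all nonzero points.\<close>

lemma simple_rooted_stable:
  fixes G :: "real \<Rightarrow> real poly poly"
  assumes d: "d \<ge> 3" and cont: "\<And>k j. continuous_on {0..1} (\<lambda>t. cf (G t) k j)"
    and G: "\<And>t. t \<in> {0..1} \<Longrightarrow> monic_form d (G t)"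
    and sr: "\<And>t. t \<in> {0..1} \<Longrightarrow> simple_rooted d (G t)"
  shows "\<exists>e>0. \<forall>a. norm a < e \<longrightarrow> (\<forall>t\<in>{0..1}. simple_rooted d (G t + perturb a))"
proof -
  define K where "K = {0..1::real} \<times> sphere (0 :: complex \<times> real \<times> real) 1"
  define E where "E p = (case p of (t, x, y, z) \<Rightarrow>
      norm (poly (hpoly d (G t) (of_real y) (of_real z)) x) + norm (poly (pderiv (hpoly d (G t) (of_real y) (of_real z))) x))"
    for p :: "real \<times> complex \<times> real \<times> real"
  have "compact K" unfolding K_def by (intro compact_Times) auto
  moreover have "(0, 1, 0, 0) \<in> K" by (simp add: K_def norm_Pair)
  then have "K \<noteq> {}" by blast
  moreover have "continuous_on K E"
  proof -
    have cG: "continuous_on K (\<lambda>p. cf (G (fst p)) k j)" for k j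
      by (rule continuous_on_compose2[OF cont]) (auto simp: K_def intro!: continuous_intros)
    show ?thesis
      unfolding E_def poly_hpoly' poly_pderiv_hpoly split_beta
      by (intro continuous_intros cG)
  qed
  ultimately obtain p where p: "p \<in> K" "\<And>q. q \<in> K \<Longrightarrow> E p \<le> E q"
    using continuous_attains_inf[of K E] by blast
  define m where "m = E p"
  have "m > 0"
  proof -
    obtain t x y z where q: "p = (t, x, y, z)" by (cases p)
    then have t: "t \<in> {0..1}" and "norm (x, y, z) = 1" using p(1) by (auto simp: K_def)
    then have "x \<noteq> 0 \<or> y \<noteq> 0 \<or> z \<noteq> 0" by (auto simp: zero_prod_def[symmetric])
    then have "poly (hpoly d (G t) (of_real y) (of_real z)) x \<noteq> 0 \<or> poly (pderiv (hpoly d (G t) (of_real y) (of_real z))) x \<noteq> 0"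
      using sr[OF t] unfolding simple_rooted_def by blast
    then show ?thesis unfolding m_def E_def q
      by (elim disjE) (simp_all add: add_pos_nonneg add_nonneg_pos)
  qed
  \<comment> \<open>On the sphere the perturbation changes the value by at most six times its norm
    and the x-derivative by at most twice, together less than the minimum m.\<close>
  have "simple_rooted d (G t + perturb a)" if a: "norm a < m / 8" and t: "t \<in> {0..1}" for a t
  proof (rule simple_rooted_if_on_sphere)
    show "monic_form d (G t + perturb a)" by (rule monic_form_perturb[OF d G[OF t]])
    fix x :: complex and y z :: real
    assume s: "norm (x, y, z) = 1"
    obtain a1 a2 a3 where a3: "a = (a1, a2, a3)" by (cases a)
    have na: "norm a1 \<le> norm a" "norm a2 \<le> norm a" "norm a3 \<le> norm a"
      unfolding a3 by (auto intro: order_trans[OF norm_fst_le] order_trans[OF norm_snd_le] norm_fst_le order_trans[OF _ norm_snd_le])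
    have nx: "norm x \<le> 1" "\<bar>y\<bar> \<le> 1" "\<bar>z\<bar> \<le> 1"
      using norm_fst_le[of x "(y, z)"] norm_snd_le[of "(y, z)" x] norm_fst_le[of y z] norm_snd_le[of z y] s by auto
    have mono: "norm (of_real r * (x ^ i * of_real y ^ j * of_real z ^ k)) \<le> norm a" if "\<bar>r\<bar> \<le> norm a" for r i j k
    proof -
      have "norm (of_real r * (x ^ i * of_real y ^ j * of_real z ^ k)) = \<bar>r\<bar> * (norm x ^ i * \<bar>y\<bar> ^ j * \<bar>z\<bar> ^ k)"
        by (simp add: norm_mult norm_power)
      also have "\<dots> \<le> norm a * (1 * 1 * 1)"
        using that nx by (intro mult_mono power_le_one) auto
      finally show ?thesis by simp
    qed
    have re: "\<bar>Re b\<bar> \<le> norm b" "\<bar>Im b\<bar> \<le> norm b" for b by (rule abs_Re_le_cmod, rule abs_Im_le_cmod)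
    let ?h = "\<lambda>f. poly (hpoly d f (of_real y) (of_real z)) x"
    let ?h' = "\<lambda>f. poly (pderiv (hpoly d f (of_real y) (of_real z))) x"
    have bounds1: "norm (?h (perturb a)) \<le> norm a + norm a + norm a + norm a + norm a + norm a"
      unfolding poly_hpoly' a3 sum_perturb[OF d] unfolding a3[symmetric]
      by (intro norm_triangle_mono mono order_trans[OF re(1)] order_trans[OF re(2)] na)
    have bounds2: "norm (?h' (perturb a)) \<le> norm a + norm a"
    proof -
      have "?h' (perturb a)
        = of_real (Re a1) * (x ^ 0 * of_real y ^ (d - 1) * of_real z ^ 0) + of_real (Im a1) * (x ^ 0 * of_real y ^ (d - 2) * of_real z ^ 1)"
        unfolding poly_pderiv_hpoly a3 sum_perturb[OF d] by (simp add: numeral_2_eq_2)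
      then show ?thesis
        by (simp only:) (intro norm_triangle_mono mono order_trans[OF re(1) na(1)] order_trans[OF re(2) na(1)])
    qed
    have bounds3: "m \<le> norm (?h (G t)) + norm (?h' (G t))"
    proof -
      have "(t, x, y, z) \<in> K" using t s by (simp add: K_def)
      from p(2)[OF this] show ?thesis by (simp add: m_def E_def[of "(t, x, y, z)"])
    qed
    have same: "norm A = norm B" if "A + B = 0" for A B :: complex
      using that by (metis add_eq_0_iff2 norm_minus_cancel)
    have "?h (G t + perturb a)
       = ?h (G t) + ?h (perturb a)"
      "?h' (G t + perturb a)
       = ?h' (G t) + ?h' (perturb a)"
      unfolding poly_hpoly' poly_pderiv_hpoly sum_cf_add by simp_all
    note eqs = this
    show "?h (G t + perturb a) \<noteq> 0 \<or>
       ?h' (G t + perturb a) \<noteq> 0"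
    proof (rule ccontr)
      assume "\<not> ?thesis"
      then have "norm (?h (G t)) = norm (?h (perturb a))"
        "norm (?h' (G t)) = norm (?h' (perturb a))"
        unfolding eqs by (auto intro: same)
      with bounds1 bounds2 bounds3 show False using a by linarith
    qed
  qed
  then show ?thesis using \<open>m > 0\<close> by (intro exI[of _ "m / 8"]) auto
qed

subsection \<open>A tridiagonal starting point\<close>

definition path_adjacency :: "nat \<Rightarrow> nat \<Rightarrow> real" where
  "path_adjacency i j = (if i = Suc j \<or> j = Suc i then 1 else 0)"

text \<open>Deleting the first row and the last column leaves a triangular matrix with the
  subdiagonal ones on its diagonal. The minor is therefore 1 for all x and z, so no smoothness of
  the curve is needed at the starting form.\<close>

lemma path_adjacency_cofactor:
  assumes "d \<ge> 1"
  shows "Cof d (\<lambda>i j. complex_of_real (path_adjacency i j) + z * complex_of_real (if i = j then real i else 0)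
     + (if i = j then x else 0)) 0 (d - 1) \<noteq> 0"
proof -
  let ?M = "\<lambda>i j. complex_of_real (path_adjacency i j) + z * complex_of_real (if i = j then real i else 0) + (if i = j then x else 0)"
  have "Det (d - 1) (\<lambda>k l. ?M (insert_index 0 k) (insert_index (d - 1) l)) = Det (d - 1) (\<lambda>k l. ?M (Suc k) l)"
    by (rule Det_cong) (simp add: insert_index_def)
  also have "\<dots> = (\<Prod>k<d - 1. ?M (Suc k) k)"
    by (rule Det_upper_triangular) (auto simp: path_adjacency_def)
  also have "\<dots> = 1" by (simp add: path_adjacency_def)
  finally show ?thesis unfolding Cof_def by simp
qed

text \<open>Pairing a kernel vector with its conjugate gives Q + x N = 0, where \<open>Q\<close> is
  real by symmetry and \<open>N\<close> is the squared norm.\<close>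

lemma symmetric_eigenvalue_real:
  fixes A :: "nat \<Rightarrow> nat \<Rightarrow> real"
  assumes A: "\<And>i j. A i j = A j i"
    and det: "Det d (\<lambda>i j. of_real (A i j) + (if i = j then x else 0)) = (0::complex)"
  shows "Im x = 0"
proof -
  let ?M = "Matrix.mat d d (\<lambda>(i, j). of_real (A i j) + (if i = j then x else 0)) :: complex mat"
  obtain v where v: "v \<in> carrier_vec d" "v \<noteq> 0\<^sub>v d" "?M *\<^sub>v v = 0\<^sub>v d"
    using det det_0_iff_vec_prod_zero_field[of ?M d] unfolding Det_def by auto
  have row: "(\<Sum>j<d. (of_real (A i j) + (if i = j then x else 0)) * (v $ j)) = 0" if "i < d" for i
  proof -
    have "(?M *\<^sub>v v) $ i = (\<Sum>j<d. (of_real (A i j) + (if i = j then x else 0)) * (v $ j))"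
      using that v(1) by (auto simp: scalar_prod_def lessThan_atLeast0 intro!: sum.cong)
    then show ?thesis using v(3) that by simp
  qed
  define Q where "Q = (\<Sum>i<d. \<Sum>j<d. of_real (A i j) * (cnj (v $ i) * (v $ j)))"
  define N where "N = (\<Sum>i<d. (cmod (v $ i))\<^sup>2)"
  have "0 = (\<Sum>i<d. cnj (v $ i) * (\<Sum>j<d. (of_real (A i j) + (if i = j then x else 0)) * (v $ j)))"
    by (simp add: row)
  also have "\<dots> = (\<Sum>i<d. (\<Sum>j<d. of_real (A i j) * (cnj (v $ i) * (v $ j))) + (\<Sum>j<d. if j = i then x * (cnj (v $ i) * (v $ i)) else 0))"
    unfolding sum_distrib_left sum.distrib[symmetric]
    by (intro sum.cong refl) (auto simp: algebra_simps)
  also have "\<dots> = Q + x * of_real N"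
  proof -
    have "cnj w * w = of_real ((cmod w)\<^sup>2)" for w
      by (simp only: complex_norm_square mult.commute)
    then show ?thesis
      unfolding Q_def N_def sum.distrib by (simp add: sum_distrib_left)
  qed
  finally have eq: "Q + x * of_real N = 0" by simp
  have "cnj Q = (\<Sum>i<d. \<Sum>j<d. of_real (A i j) * (cnj (v $ j) * (v $ i)))"
    by (simp add: Q_def mult_ac)
  also have "\<dots> = (\<Sum>j<d. \<Sum>i<d. of_real (A i j) * (cnj (v $ j) * (v $ i)))" by (rule sum.swap)
  also have "\<dots> = Q" unfolding Q_def by (intro sum.cong refl) (subst A, rule refl)
  finally have "Im Q = 0" by (simp add: complex_eq_iff)
  then have "Im x * N = 0" using arg_cong[OF eq, of Im] by simp
  moreover have "N > 0"
  proof -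
    obtain i where i: "i < d" "v $ i \<noteq> 0" using v(1,2) by (metis carrier_vecD eq_vecI index_zero_vec)
    show ?thesis unfolding N_def using i by (intro sum_pos2[of _ i]) auto
  qed
  ultimately show ?thesis by simp
qed

lemma hyperbolic_form_Det:
  fixes D C :: "nat \<Rightarrow> nat \<Rightarrow> real"
  assumes "\<And>i j. D i j = D j i" "\<And>i j. C i j = C j i"
  shows "hyperbolic_form d (Det d (lin D C))"
  unfolding hyperbolic_form_def
proof (intro allI impI)
  fix y z :: real and x :: complex
  assume "poly (hpoly d (Det d (lin D C)) (of_real y) (of_real z)) x = 0"
  then have "Det d (\<lambda>i j. of_real (y * D i j + z * C i j) + (if i = j then x else 0)) = 0"
    unfolding poly_hpoly_Det by simp
  moreover have "y * D i j + z * C i j = y * D j i + z * C j i" for i j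
    using assms(1)[of i j] assms(2)[of i j] by simp
  ultimately show "Im x = 0" by (rule symmetric_eigenvalue_real[rotated])
qed

subsection \<open>Hyperbolic forms are representable\<close>

lemma cf_perturb_le: "\<bar>cf (perturb a) k j\<bar> \<le> norm a"
proof -
  obtain p q r where a: "a = (p, q, r)" by (cases a)
  have n: "norm p \<le> norm a" "norm q \<le> norm a" "norm r \<le> norm a"
    unfolding a by (auto intro: order_trans[OF norm_fst_le] order_trans[OF norm_snd_le] norm_fst_le order_trans[OF _ norm_snd_le])
  have re: "\<bar>Re b\<bar> \<le> norm b" "\<bar>Im b\<bar> \<le> norm b" for b by (rule abs_Re_le_cmod, rule abs_Im_le_cmod)
  note le = order_trans[OF re(1) n(1)] order_trans[OF re(2) n(1)] order_trans[OF re(1) n(2)] order_trans[OF re(2) n(2)]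
    order_trans[OF re(1) n(3)] order_trans[OF re(2) n(3)]
  show ?thesis using le unfolding a cf_perturb by auto
qed

text \<open>Representability is carried from F1 contracted down to the common end at t = 0 and back
  up to \<open>f\<close>, with the same perturbation on both paths. As only almost every
  perturbation avoids the singularities, \<open>near\<close> is required on a whole ball; letting
  the perturbation tend to 0 removes it.\<close>

lemma representable_nuij_form:
  fixes F1 :: "real poly poly"
  assumes d: "d \<ge> 3" and s: "s \<noteq> 0" and r: "r > 0"
    and F1: "monic_form d F1" "hyperbolic_form d F1"
    and near: "\<And>a. norm a < r \<Longrightarrow> representable d (nuij_form d s F1 + perturb a)"
    and f: "monic_form d f" "hyperbolic_form d f"
  shows "representable d (nuij_form d s f)"
proof -
  define P where "P g t = nuij_form d s (scale_form d t g)" for g t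
  have diff: "(\<lambda>t. cf (P g t) k j) differentiable at t" for g k j t
    unfolding P_def by (rule nuij_form_path_differentiable)
  then have cont: "continuous_on {0..1} (\<lambda>t. cf (P g t) k j)" for g k j
    by (intro continuous_at_imp_continuous_on ballI differentiable_imp_continuous_within)
  have mono: "monic_form d (P g t)" if "monic_form d g" for g t
    unfolding P_def by (intro monic_form_nuij_form monic_form_scale_form that)
  have sr: "simple_rooted d (P g t)" if "monic_form d g" "hyperbolic_form d g" for g t
    unfolding P_def
    by (intro simple_rooted_nuij_form monic_form_scale_form hyperbolic_form_scale_form that s)
  have P1: "P g 1 = nuij_form d s g" and P0: "P g 0 = nuij_form d s (monom 1 d)" if "monic_form d g" for g
    unfolding P_def using scale_form_1[OF that] scale_form_0[OF that] by auto
  obtain e1 e2 where e: "e1 > 0" "e2 > 0"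
    "\<And>a t. norm a < e1 \<Longrightarrow> t \<in> {0..1} \<Longrightarrow> simple_rooted d (P F1 t + perturb a)"
    "\<And>a t. norm a < e2 \<Longrightarrow> t \<in> {0..1} \<Longrightarrow> simple_rooted d (P f t + perturb a)"
    using simple_rooted_stable[OF d cont mono[OF F1(1)] sr[OF F1]]
      simple_rooted_stable[OF d cont mono[OF f(1)] sr[OF f]] by blast
  \<comment> \<open>One null set for both paths, so that a single \<open>a\<close> outside it serves
    for the whole connection.\<close>
  define Bad where "Bad = {a. \<exists>t. \<not> nonreal_smooth d (P F1 t + perturb a)} \<union> {a. \<exists>t. \<not> nonreal_smooth d (P f t + perturb a)}"
  have "negligible Bad"
    unfolding Bad_def by (intro negligible_Un negligible_singular_perturbations d diff)
  have path: "representable d (P g t + perturb a)"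
    if g: "monic_form d g" and a: "\<And>t. t \<in> {0..1} \<Longrightarrow> simple_rooted d (P g t + perturb a)"
      "\<And>t. nonreal_smooth d (P g t + perturb a)"
      and u: "u \<in> {0..1}" "representable d (P g u + perturb a)" and t: "t \<in> {0..1}" for g a u t
  proof (rule representable_along_path[where G = "\<lambda>t. P g t + perturb a", OF d _ _ _ _ u t])
    show "continuous_on {0..1} (\<lambda>t. cf (P g t + perturb a) k j)" for k j
      using cont by (auto intro!: continuous_intros)
    show "monic_form d (P g t + perturb a)" for t by (intro monic_form_perturb d mono g)
  qed (use a in auto)
  have ex: "\<exists>a. norm a < q \<and> representable d (nuij_form d s f + perturb a)" if q: "q > 0" for q
  proof -
    define m where "m = min (min q r) (min e1 e2)"
    have "m > 0" using q r e by (simp add: m_def)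
    then have "\<not> negligible (ball (0 :: complex \<times> complex \<times> complex) m)"
      by (intro open_not_negligible) auto
    then have "\<not> ball 0 m \<subseteq> Bad" using negligible_subset[OF \<open>negligible Bad\<close>] by blast
    then obtain a where "a \<in> ball 0 m" and a2: "a \<notin> Bad" by blast
    then have "norm a < m" by simp
    note a = this a2
    have "representable d (P F1 1 + perturb a)"
      using near[of a] a by (simp add: P1[OF F1(1)] m_def)
    then have "representable d (P F1 0 + perturb a)"
      using path[OF F1(1), of a 1 0] e(3)[of a] a by (simp add: Bad_def m_def)
    then have "representable d (P f 0 + perturb a)"
      by (simp add: P0[OF F1(1)] P0[OF f(1)])
    then have "representable d (P f 1 + perturb a)"
      using path[OF f(1), of a 0 1] e(4)[of a] a by (simp add: Bad_def m_def)
    then show ?thesis using a by (intro exI[of _ a]) (simp add: P1[OF f(1)] m_def)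
  qed
  then have "\<exists>a. norm a < 1 / real (Suc n) \<and> representable d (nuij_form d s f + perturb a)" for n by simp
  then obtain a where a: "\<And>n. norm (a n) < 1 / real (Suc n)" "\<And>n. representable d (nuij_form d s f + perturb (a n))"
    by metis
  show ?thesis
  proof (rule representable_limit[OF d a(2)])
    show "monic_form d (nuij_form d s f)" by (rule monic_form_nuij_form[OF f(1)])
    fix k j
    have "(\<lambda>n. cf (perturb (a n)) k j) \<longlonglongrightarrow> 0"
    proof (rule Lim_null_comparison)
      show "\<forall>\<^sub>F n in sequentially. norm (cf (perturb (a n)) k j) \<le> 1 / real (Suc n)"
        unfolding real_norm_def
        by (intro always_eventually allI order_trans[OF cf_perturb_le less_imp_le[OF a(1)]])
      show "(\<lambda>n. 1 / real (Suc n)) \<longlonglongrightarrow> 0" by (rule LIMSEQ_Suc[OF lim_1_over_n])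
    qed
    from tendsto_add[OF tendsto_const[of "cf (nuij_form d s f) k j"] this]
    show "(\<lambda>n. cf (nuij_form d s f + perturb (a n)) k j) \<longlonglongrightarrow> cf (nuij_form d s f) k j" by simp
  qed
qed

text \<open>For small \<open>s\<close> the Nuij image of \<open>F1\<close> is within e/2 of
  \<open>F1\<close>, which leaves e/2 for the perturbation inside the representable neighbourhood.
  This covers the Nuij image of \<open>f\<close> for all small \<open>s\<close> \<noteq> 0, and
  closedness as \<open>s\<close> tends to 0 gives \<open>f\<close>.\<close>

lemma representable_if_hyperbolic:
  assumes d: "d \<ge> 3" and f: "monic_form d f" "hyperbolic_form d f"
  shows "representable d f"
proof -
  define F1 where "F1 = Det d (lin path_adjacency (\<lambda>i j. if i = j then real i else 0))"
  have F1: "monic_form d F1" "hyperbolic_form d F1"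
    unfolding F1_def by (rule monic_form_Det, rule hyperbolic_form_Det) (auto simp: path_adjacency_def)
  have "\<exists>e>0. \<forall>g. monic_form d g \<longrightarrow> (\<forall>k\<le>d. \<forall>j\<le>d. \<bar>cf g k j - cf F1 k j\<bar> < e) \<longrightarrow> representable d g"
    unfolding F1_def
  proof (rule representable_nbhd)
    show "path_adjacency i j = path_adjacency j i" for i j by (auto simp: path_adjacency_def)
    show "inj_on real {..<d}" by (simp add: inj_on_def)
    show "\<exists>i<d. \<exists>j<d. Cof d (\<lambda>i j. complex_of_real (path_adjacency i j) + z * complex_of_real (if i = j then real i else 0)
        + (if i = j then x else 0)) i j \<noteq> 0" for x z
      using path_adjacency_cofactor[of d z x] d by (intro exI[of _ 0] conjI exI[of _ "d - 1"]) auto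
  qed
  then obtain e where e: "e > 0"
    "\<And>g. monic_form d g \<Longrightarrow> (\<forall>k\<le>d. \<forall>j\<le>d. \<bar>cf g k j - cf F1 k j\<bar> < e) \<Longrightarrow> representable d g" by blast
  have "\<forall>\<^sub>F s in at 0. \<forall>k\<in>{..d}. \<forall>j\<in>{..d}. dist (cf (nuij_form d s F1) k j) (cf F1 k j) < e / 2"
    using e(1) by (intro eventually_ball_finite ballI tendstoD nuij_form_tendsto) auto
  then obtain r where r: "r > 0" "\<And>s. s \<noteq> 0 \<Longrightarrow> \<bar>s\<bar> < r \<Longrightarrow>
      \<forall>k\<in>{..d}. \<forall>j\<in>{..d}. dist (cf (nuij_form d s F1) k j) (cf F1 k j) < e / 2"
    unfolding eventually_at by auto
  have rep: "representable d (nuij_form d s f)" if s: "s \<noteq> 0" "\<bar>s\<bar> < r" for s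
  proof (rule representable_nuij_form[OF d s(1) half_gt_zero[OF e(1)] F1 _ f])
    fix a :: "complex \<times> complex \<times> complex" assume a: "norm a < e / 2"
    show "representable d (nuij_form d s F1 + perturb a)"
    proof (rule e(2))
      show "monic_form d (nuij_form d s F1 + perturb a)"
        by (intro monic_form_perturb d monic_form_nuij_form F1)
      show "\<forall>k\<le>d. \<forall>j\<le>d. \<bar>cf (nuij_form d s F1 + perturb a) k j - cf F1 k j\<bar> < e"
      proof (intro allI impI)
        fix k j assume kj: "k \<le> d" "j \<le> d"
        then have "\<bar>cf (nuij_form d s F1) k j - cf F1 k j\<bar> < e / 2"
          using r(2)[OF s] by (simp add: dist_real_def)
        moreover have "\<bar>cf (perturb a) k j\<bar> < e / 2" using cf_perturb_le a by (rule le_less_trans)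
        ultimately show "\<bar>cf (nuij_form d s F1 + perturb a) k j - cf F1 k j\<bar> < e"
          unfolding coeff_add by linarith
      qed
    qed
  qed
  define s where "s n = r / 2 * (1 / real (Suc n))" for n
  have s: "s n \<noteq> 0" "\<bar>s n\<bar> < r" for n
  proof -
    have "s n > 0" using r(1) by (simp add: s_def)
    moreover have "s n \<le> r / 2 * 1" unfolding s_def using r(1) by (intro mult_left_mono) auto
    ultimately show "s n \<noteq> 0" "\<bar>s n\<bar> < r" using r(1) by auto
  qed
  show ?thesis
  proof (rule representable_limit[OF d rep[OF s] _ f(1)])
    have "s \<longlonglongrightarrow> 0"
      unfolding s_def by (rule tendsto_mult_right_zero[OF LIMSEQ_Suc[OF lim_1_over_n]])
    then have "filterlim s (at 0) sequentially"
      using s(1) by (simp add: filterlim_at)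
    then show "(\<lambda>n. cf (nuij_form d (s n) f) k j) \<longlonglongrightarrow> cf f k j" for k j
      by (rule filterlim_compose[OF nuij_form_tendsto])
  qed
qed

subsection \<open>Evaluation of ternary polynomials\<close>

lemma psubst_superset:
  fixes c :: "real \<Rightarrow> 'a::comm_semiring_1"
  assumes "c 0 = 0" "finite K" "Poly_Mapping.keys F \<subseteq> K"
  shows "psubst c x F = (\<Sum>m\<in>K. c (Poly_Mapping.lookup F m) * (\<Prod>i\<in>UNIV. x i ^ Poly_Mapping.lookup m i))"
  unfolding psubst_def using assms
  by (intro sum.mono_neutral_left) (auto simp: in_keys_iff)

lemma psubst_hom:
  assumes "comm_semiring_hom h"
  shows "h (psubst c x F) = psubst (\<lambda>a. h (c a)) (\<lambda>i. h (x i)) F"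
proof -
  interpret comm_semiring_hom h by fact
  show ?thesis unfolding psubst_def by (simp add: hom_distribs)
qed

lemma psubst_single:
  "c 0 = 0 \<Longrightarrow> psubst c x (Poly_Mapping.single m a) = c a * (\<Prod>i\<in>UNIV. x i ^ Poly_Mapping.lookup m i)"
  by (subst psubst_superset[of c "{m}"]) auto

lemma psubst_add:
  assumes "c 0 = 0" "\<And>a b. c (a + b) = c a + c b"
  shows "psubst c x (F + G) = psubst c x F + psubst c x G"
proof -
  let ?K = "Poly_Mapping.keys F \<union> Poly_Mapping.keys G"
  have "finite ?K" "Poly_Mapping.keys (F + G) \<subseteq> ?K" by (auto simp: Poly_Mapping.keys_add)
  then show ?thesis
    by (simp add: psubst_superset[where K = ?K] assms lookup_add distrib_right sum.distrib)
qed

lemma psubst_sum: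
  assumes "c 0 = 0" "\<And>a b. c (a + b) = c a + c b"
  shows "psubst c x (\<Sum>i\<in>I. F i) = (\<Sum>i\<in>I. psubst c x (F i))"
proof (induction I rule: infinite_finite_induct)
  case (insert i I)
  then show ?case by (simp add: psubst_add assms)
qed (simp_all add: psubst_def)

lemma sum_single_lookup:
  "F = (\<Sum>m\<in>Poly_Mapping.keys F. Poly_Mapping.single m (Poly_Mapping.lookup F m))"
proof (rule poly_mapping_eqI)
  fix n
  let ?S = "\<Sum>m\<in>Poly_Mapping.keys F. Poly_Mapping.single m (Poly_Mapping.lookup F m)"
  have "Poly_Mapping.lookup ?S n
     = (\<Sum>m\<in>Poly_Mapping.keys F. if m = n then Poly_Mapping.lookup F n else 0)"
    unfolding lookup_sum by (intro sum.cong) (auto simp: lookup_single when_def)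
  also have "\<dots> = Poly_Mapping.lookup F n"
    by (simp add: in_keys_iff)
  finally show "Poly_Mapping.lookup F n = Poly_Mapping.lookup ?S n" ..
qed

lemma psubst_mult:
  fixes c :: "real \<Rightarrow> 'a::comm_semiring_1"
  assumes c: "c 0 = 0" "\<And>a b. c (a + b) = c a + c b" "\<And>a b. c (a * b) = c a * c b"
  shows "psubst c x (F * G) = psubst c x F * psubst c x G"
proof -
  let ?s = "\<lambda>F m. Poly_Mapping.single m (Poly_Mapping.lookup F m)"
  have single: "psubst c x (?s F m * ?s G n) = psubst c x (?s F m) * psubst c x (?s G n)" for m n
    by (simp add: mult_single psubst_single c lookup_add power_add prod.distrib mult_ac)
  have "psubst c x (F * G) = psubst c x ((\<Sum>m\<in>Poly_Mapping.keys F. ?s F m) * (\<Sum>n\<in>Poly_Mapping.keys G. ?s G n))"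
    by (subst (1 2) sum_single_lookup) rule
  also have "\<dots> = (\<Sum>m\<in>Poly_Mapping.keys F. \<Sum>n\<in>Poly_Mapping.keys G. psubst c x (?s F m * ?s G n))"
    by (simp add: sum_product psubst_sum c)
  also have "\<dots> = (\<Sum>m\<in>Poly_Mapping.keys F. psubst c x (?s F m)) * (\<Sum>n\<in>Poly_Mapping.keys G. psubst c x (?s G n))"
    by (simp only: single sum_product)
  also have "\<dots> = psubst c x F * psubst c x G"
    by (simp only: psubst_sum[OF c(1,2), symmetric] sum_single_lookup[symmetric])
  finally show ?thesis .
qed

lemma peval_hom: "comm_ring_hom (\<lambda>F. peval F v)"
proof
  show "peval 1 v = 1"
    using psubst_single[of "\<lambda>c. c :: real" "vec_nth v" 0 1] by (simp add: peval_def)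
  show "peval 0 v = 0" by (simp add: peval_def psubst_def)
  show "peval (F + G) v = peval F v + peval G v" for F G
    unfolding peval_def by (rule psubst_add) auto
  show "peval (F * G) v = peval F v * peval G v" for F G
    unfolding peval_def by (rule psubst_mult) auto
qed

lemma peval_PConst: "peval (PConst c) v = c"
  by (simp add: peval_def PConst_def psubst_single)

lemma peval_PVar: "peval (PVar i) v = v $ i"
proof -
  have "(\<Prod>j\<in>UNIV. v $ j ^ Poly_Mapping.lookup (Poly_Mapping.single i 1) j) = (\<Prod>j\<in>UNIV. if j = i then v $ i else 1)"
    by (intro prod.cong) (auto simp: lookup_single when_def)
  then show ?thesis by (simp add: peval_def PVar_def psubst_single)
qed

text \<open>Kronecker substitution: on the curve \<open>(t, t^N, t^(N^2))\<close> distinct monomials of degrees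
  below \<open>N\<close> become distinct powers of \<open>t\<close>.\<close>

lemma ternary_poly_eq_0:
  assumes "\<And>v. peval F v = 0"
  shows "F = 0"
proof (rule ccontr)
  assume "F \<noteq> 0"
  then obtain m0 where m0: "m0 \<in> Poly_Mapping.keys F" by (metis all_not_in_conv keys_eq_empty)
  let ?K = "Poly_Mapping.keys F"
  let ?l = "Poly_Mapping.lookup :: (3 \<Rightarrow>\<^sub>0 nat) \<Rightarrow> 3 \<Rightarrow> nat"
  define N where "N = Suc (Max ((\<lambda>(m, i). ?l m i) ` (?K \<times> UNIV)))"
  have N: "?l m i < N" if "m \<in> ?K" for m i
    unfolding N_def less_Suc_eq_le using that by (intro Max_ge) auto
  define kap where "kap m = ?l m 1 + N * (?l m 2 + N * ?l m 3)" for m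
  have inj: "m = m'" if "m \<in> ?K" "m' \<in> ?K" "kap m = kap m'" for m m'
  proof (rule poly_mapping_eqI)
    have digits: "a = a' \<and> b = b'" if "a + N * b = a' + N * b'" "a < N" "a' < N" for a b a' b' :: nat
      using arg_cong[OF that(1), of "\<lambda>n. n mod N"] arg_cong[OF that(1), of "\<lambda>n. n div N"] that(2,3) by simp
    have 1: "?l m 1 = ?l m' 1" "?l m 2 + N * ?l m 3 = ?l m' 2 + N * ?l m' 3"
      using digits[of "?l m 1" "?l m 2 + N * ?l m 3" "?l m' 1"] that N by (auto simp: kap_def)
    have 2: "?l m 2 = ?l m' 2" "?l m 3 = ?l m' 3"
      using digits[OF 1(2)] that N by auto
    fix i :: 3
    show "?l m i = ?l m' i" using exhaust_3[of i] 1 2 by auto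
  qed
  define p where "p = (\<Sum>m\<in>?K. monom (Poly_Mapping.lookup F m) (kap m))"
  have "poly p t = 0" for t
  proof -
    define v :: "real^3" where "v = vector [t, t ^ N, t ^ (N * N)]"
    have v: "v $ 1 = t" "v $ 2 = t ^ N" "v $ 3 = t ^ (N * N)" by (simp_all add: v_def vector_3)
    have "(\<Prod>i\<in>UNIV. v $ i ^ ?l m i) = t ^ kap m" for m
    proof -
      have "(\<Prod>i\<in>UNIV. v $ i ^ ?l m i) = v $ 1 ^ ?l m 1 * (v $ 2 ^ ?l m 2 * v $ 3 ^ ?l m 3)"
        unfolding UNIV_3 by (simp add: mult.assoc)
      then show ?thesis by (simp add: v kap_def power_add[symmetric] power_mult[symmetric] algebra_simps)
    qed
    then have "peval F v = poly p t"
      by (simp add: peval_def psubst_def p_def poly_sum poly_monom)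
    then show ?thesis using assms by simp
  qed
  then have "p = 0" by (simp add: poly_eq_poly_eq_iff[symmetric] fun_eq_iff)
  have "coeff p (kap m0) = (\<Sum>m\<in>?K. if m = m0 then Poly_Mapping.lookup F m0 else 0)"
    unfolding p_def coeff_sum using inj m0 by (intro sum.cong) auto
  then have "coeff p (kap m0) = Poly_Mapping.lookup F m0" using m0 by simp
  then show False using \<open>p = 0\<close> m0 by (simp add: in_keys_iff)
qed

lemma ternary_poly_eqI:
  assumes "\<And>v. peval F v = peval G v"
  shows "F = G"
proof -
  have "peval (F - G) v = 0" for v
  proof -
    interpret comm_ring_hom "\<lambda>F. peval F v" by (rule peval_hom)
    show ?thesis using assms by (simp add: hom_minus)
  qed
  then show ?thesis using ternary_poly_eq_0 by fastforce
qed

subsection \<open>Forms of degree at most two\<close>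

text \<open>The common conclusion for all degrees. Degrees one and two have explicit pencils, while
  the trace formula and the cubic perturbations work from degree three on.\<close>

definition sym_representable :: "nat \<Rightarrow> real poly poly \<Rightarrow> bool" where
  "sym_representable d f \<longleftrightarrow> (\<exists>D C. (\<forall>i j. D i j = D j i) \<and> (\<forall>i j. C i j = C j i) \<and> f = Det d (lin D C))"

lemma representable_imp_sym: "representable d f \<Longrightarrow> sym_representable d f"
proof -
  assume "representable d f"
  then obtain D c where "\<forall>i j. D i j = D j i" "f = Det d (lin D (\<lambda>i j. if i = j then c i else 0))"
    unfolding representable_def by blast
  then show ?thesis
    unfolding sym_representable_def by (intro exI[of _ D] exI[of _ "\<lambda>i j. if i = j then c i else 0"]) auto
qed

lemma Det_1: "Det 1 A = A 0 0"
  using Det_upper_triangular[of 1 A] by simp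

lemma Det_2: "Det 2 A = A 0 0 * A 1 1 - A 0 1 * A 1 0"
proof -
  have "Det 2 A = (\<Sum>l<2. A 0 l * Cof 2 A 0 l)" using Cof_rows[of 0 2 0 A] by simp
  also have "\<dots> = A 0 0 * Cof 2 A 0 0 + A 0 1 * Cof 2 A 0 1" by (simp add: numeral_2_eq_2)
  moreover have "Cof 2 A 0 0 = A 1 1" "Cof 2 A 0 1 = - A 1 0"
    using Det_1[of "\<lambda>k l. A (insert_index 0 k) (insert_index 0 l)"] Det_1[of "\<lambda>k l. A (insert_index 0 k) (insert_index 1 l)"]
    by (simp_all add: Cof_def insert_index_def)
  ultimately show ?thesis by simp
qed

lemma sym_representable_1:
  assumes "monic_form 1 f"
  shows "sym_representable 1 f"
proof -
  have "f = Det 1 (lin (\<lambda>_ _. cf f 0 0) (\<lambda>_ _. cf f 0 1))"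
  proof (intro poly_eqI)
    fix k j
    show "cf f k j = cf (Det 1 (lin (\<lambda>_ _. cf f 0 0) (\<lambda>_ _. cf f 0 1))) k j"
      using assms unfolding Det_1 lin_def monic_form_iff
      by (cases k; cases j) (auto simp: coeff_pCons split: nat.split)
  qed
  then show ?thesis
    unfolding sym_representable_def
    by (intro exI[of _ "\<lambda>_ _. cf f 0 0"] exI[of _ "\<lambda>_ _. cf f 0 1"]) simp
qed

text \<open>Completing the square in z writes the form as (u0 y + u1 z)^2 + (w y)^2. That the second
  square involves y alone later keeps \<open>C\<close> diagonal.\<close>

lemma psd_binary_quadratic_two_squares:
  fixes al be ga :: real
  assumes q: "\<And>y z. ga * y\<^sup>2 + 2 * be * y * z + al * z\<^sup>2 \<ge> 0"
  obtains u0 u1 w where "ga = u0\<^sup>2 + w\<^sup>2" "be = u0 * u1" "al = u1\<^sup>2"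
proof (cases "al = 0")
  case True
  have "be = 0"
  proof (rule ccontr)
    assume "be \<noteq> 0"
    then have "ga * 1\<^sup>2 + 2 * be * 1 * (- (ga + 1) / (2 * be)) + al * (- (ga + 1) / (2 * be))\<^sup>2 = -1"
      using True by (simp add: field_simps)
    then show False using q[of 1 "- (ga + 1) / (2 * be)"] by simp
  qed
  moreover have "ga \<ge> 0" using q[of 1 0] by simp
  ultimately show ?thesis using that[of "sqrt ga" 0 0] True by simp
next
  case False
  have "al \<ge> 0" using q[of 0 1] by simp
  then have al: "al > 0" using False by simp
  have "ga * 1\<^sup>2 + 2 * be * 1 * (- be / al) + al * (- be / al)\<^sup>2 = ga - be\<^sup>2 / al"
    using False by (simp add: field_simps power2_eq_square)
  then have "ga - be\<^sup>2 / al \<ge> 0" using q[of 1 "- be / al"] by simp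
  moreover have "(be / sqrt al)\<^sup>2 = be\<^sup>2 / al" using al by (simp add: power_divide)
  ultimately show ?thesis
    using that[of "be / sqrt al" "sqrt (ga - be\<^sup>2 / al)" "sqrt al"] al by simp
qed

text \<open>For f = x^2 + b x + c, hyperbolicity makes b^2/4 - c nonnegative, hence l^2 + (w y)^2
  with l linear. The pencil with diagonal entries x + b/2 + l and x + b/2 - l and off-diagonal entry
  w y has determinant f.\<close>

lemma sym_representable_2:
  assumes f: "monic_form 2 f" and h: "hyperbolic_form 2 f"
  shows "sym_representable 2 f"
proof -
  define b0 b1 c0 c1 c2 where "b0 = cf f 1 0" and "b1 = cf f 1 1" and "c0 = cf f 0 0" and "c1 = cf f 0 1" and "c2 = cf f 0 2"
  have ev: "poly (hpoly 2 f y z) x = x\<^sup>2 + (b0 * y + b1 * z) * x + (c0 * y\<^sup>2 + c1 * y * z + c2 * z\<^sup>2)" for x y z :: complex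
  proof -
    have "cf f 2 0 = 1" "cf f 2 1 = 0" "cf f 2 2 = 0" "cf f 1 2 = 0"
      using f by (auto simp: monic_form_iff)
    moreover have "(\<Sum>k\<le>2. \<Sum>j\<le>2. h k j) = h 0 0 + h 0 1 + h 0 2 + (h 1 0 + h 1 1 + h 1 2) + (h 2 0 + h 2 1 + h 2 2)"
      for h :: "nat \<Rightarrow> nat \<Rightarrow> complex"
      by (simp add: numeral_2_eq_2)
    ultimately show ?thesis
      by (simp add: poly_hpoly' b0_def b1_def c0_def c1_def c2_def algebra_simps)
  qed
  have "(b0\<^sup>2 / 4 - c0) * y\<^sup>2 + 2 * (b0 * b1 / 4 - c1 / 2) * y * z + (b1\<^sup>2 / 4 - c2) * z\<^sup>2 \<ge> 0" for y z :: real
  proof (rule ccontr)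
    define b c where "b = b0 * y + b1 * z" and "c = c0 * y\<^sup>2 + c1 * y * z + c2 * z\<^sup>2"
    assume "\<not> ?thesis"
    moreover have "(b0\<^sup>2 / 4 - c0) * y\<^sup>2 + 2 * (b0 * b1 / 4 - c1 / 2) * y * z + (b1\<^sup>2 / 4 - c2) * z\<^sup>2 = b\<^sup>2 / 4 - c"
      by (simp add: b_def c_def power2_eq_square field_simps)
    ultimately have neg: "c - b\<^sup>2 / 4 > 0" by simp
    \<comment> \<open>A nonreal root supplied by the quadratic formula when the discriminant is
      negative.\<close>
    define x where "x = Complex (- b / 2) (sqrt (c - b\<^sup>2 / 4))"
    have "poly (hpoly 2 f (of_real y) (of_real z)) x = x\<^sup>2 + of_real b * x + of_real c"
      by (simp add: ev b_def c_def)
    also have "\<dots> = 0"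
      using neg by (simp add: x_def complex_eq_iff power2_eq_square field_simps)
    finally have "Im x = 0" using h unfolding hyperbolic_form_def by blast
    then show False using neg by (simp add: x_def)
  qed
  from psd_binary_quadratic_two_squares[OF this] obtain u0 u1 w where
    u: "b0\<^sup>2 / 4 - c0 = u0\<^sup>2 + w\<^sup>2" "b0 * b1 / 4 - c1 / 2 = u0 * u1" "b1\<^sup>2 / 4 - c2 = u1\<^sup>2" by blast
  define D where "D i j = (if i = j then if i = 0 then b0 / 2 + u0 else b0 / 2 - u0 else w)" for i j :: nat
  define C where "C i j = (if i = j then if i = 0 then b1 / 2 + u1 else b1 / 2 - u1 else 0)" for i j :: nat
  have "Det 2 (lin D C) = [:[:c0, c1, c2:], [:b0, b1:], 1:]"
  proof -
    have "c0 = b0\<^sup>2 / 4 - u0\<^sup>2 - w\<^sup>2" "c1 = b0 * b1 / 2 - 2 * u0 * u1" "c2 = b1\<^sup>2 / 4 - u1\<^sup>2"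
      using u by simp_all
    then show ?thesis
      unfolding Det_2 by (simp add: lin_def D_def C_def power2_eq_square field_simps one_pCons)
  qed
  also have "\<dots> = f"
  proof (intro poly_eqI)
    fix k j
    have "cf f k j = 0" if "k + j > 2" using f that by (simp add: monic_form_iff)
    moreover have "cf f 2 0 = 1" using f by (simp add: monic_form_iff)
    ultimately show "cf [:[:c0, c1, c2:], [:b0, b1:], 1:] k j = cf f k j"
      by (auto simp: coeff_pCons b0_def b1_def c0_def c1_def c2_def numeral_2_eq_2 split: nat.split)
  qed
  finally show ?thesis
    unfolding sym_representable_def by (intro exI[of _ D] exI[of _ C]) (auto simp: D_def C_def)
qed

subsection \<open>Ternary forms\<close>

lemma sym_representable_if_hyperbolic:
  assumes "d \<ge> 1" "monic_form d f" "hyperbolic_form d f"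
  shows "sym_representable d f"
proof -
  consider "d = 1" | "d = 2" | "d \<ge> 3" using assms(1) by linarith
  then show ?thesis
    using assms sym_representable_1 sym_representable_2 representable_imp_sym representable_if_hyperbolic
    by cases auto
qed

section \<open>Linear substitutions into a ternary form\<close>

lemma total_degree_top_mult:
  fixes f g :: "real poly poly"
  assumes f: "total_degree_le m f" and g: "total_degree_le n g"
  shows "cf (f * g) (m + n) 0 = cf f m 0 * cf g n 0"
proof -
  have "cf (f * g) (m + n) 0 = (\<Sum>a\<le>m + n. cf f a 0 * cf g (m + n - a) 0)"
    by (simp add: coeff_mult coeff_sum)
  also have "\<dots> = (\<Sum>a\<le>m + n. if a = m then cf f m 0 * cf g n 0 else 0)"
  proof (intro sum.cong refl)
    fix a assume a: "a \<in> {..m + n}"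
    show "cf f a 0 * cf g (m + n - a) 0 = (if a = m then cf f m 0 * cf g n 0 else 0)"
      using f g a unfolding total_degree_le_def by (cases a m rule: linorder_cases) auto
  qed
  finally show ?thesis by simp
qed

lemma total_degree_top_prod:
  fixes f :: "'i \<Rightarrow> real poly poly"
  assumes "finite I" "\<And>i. i \<in> I \<Longrightarrow> total_degree_le (m i) (f i)"
  shows "cf (\<Prod>i\<in>I. f i) (\<Sum>i\<in>I. m i) 0 = (\<Prod>i\<in>I. cf (f i) (m i) 0)"
  using assms
proof (induction I rule: finite_induct)
  case (insert x F)
  then show ?case
    using total_degree_top_mult[of "m x" "f x" "\<Sum>i\<in>F. m i" "\<Prod>i\<in>F. f i"] total_degree_le_prod[of F m f] by simp
qed simp

lemma total_degree_power:
  fixes f :: "real poly poly"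
  assumes "total_degree_le 1 f"
  shows "total_degree_le n (f ^ n)" "cf (f ^ n) n 0 = cf f 1 0 ^ n"
  using total_degree_le_prod[of "{..<n}" "\<lambda>_. 1" "\<lambda>_. f"] total_degree_top_prod[of "{..<n}" "\<lambda>_. 1" "\<lambda>_. f"] assms
  by simp_all

text \<open>Under the bounds on the total degree, taking the coefficient of the top power of x is
  multiplicative. It therefore evaluates F at the vector of x-coefficients of the
  \<open>L i\<close>, which will be the direction \<open>e\<close>.\<close>

lemma psubst_linear_forms:
  fixes L :: "3 \<Rightarrow> real poly poly"
  assumes F: "ternary_form d F" and L: "\<And>i. total_degree_le 1 (L i)"
  shows "total_degree_le d (psubst (\<lambda>a. [:[:a:]:]) L F)"
    and "cf (psubst (\<lambda>a. [:[:a:]:]) L F) d 0 = psubst (\<lambda>a. a) (\<lambda>i. cf (L i) 1 0) F"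
proof -
  have t: "total_degree_le d (\<Prod>i\<in>UNIV. L i ^ Poly_Mapping.lookup m i) \<and>
      cf (\<Prod>i\<in>UNIV. L i ^ Poly_Mapping.lookup m i) d 0 = (\<Prod>i\<in>UNIV. cf (L i) 1 0 ^ Poly_Mapping.lookup m i)"
    if "m \<in> Poly_Mapping.keys F" for m
  proof -
    have d: "d = (\<Sum>i\<in>UNIV. Poly_Mapping.lookup m i)" using F that by (simp add: ternary_form_def)
    show ?thesis unfolding d
      using total_degree_le_prod[of UNIV "Poly_Mapping.lookup m" "\<lambda>i. L i ^ Poly_Mapping.lookup m i"]
        total_degree_top_prod[of UNIV "Poly_Mapping.lookup m" "\<lambda>i. L i ^ Poly_Mapping.lookup m i"]
        total_degree_power[OF L] by simp
  qed
  show "total_degree_le d (psubst (\<lambda>a. [:[:a:]:]) L F)"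
    unfolding psubst_def using t total_degree_le_mult[OF total_degree_le_const]
    by (intro total_degree_le_sum) fastforce
  show "cf (psubst (\<lambda>a. [:[:a:]:]) L F) d 0 = psubst (\<lambda>a. a) (\<lambda>i. cf (L i) 1 0) F"
    unfolding psubst_def coeff_sum using t by (intro sum.cong refl) simp
qed

lemma psubst_homogeneous:
  assumes F: "ternary_form d F"
  shows "psubst c (\<lambda>i. y * w i) F = y ^ d * psubst c w F"
  unfolding psubst_def sum_distrib_left
proof (intro sum.cong refl)
  fix m assume m: "m \<in> Poly_Mapping.keys F"
  then have d: "d = (\<Sum>i\<in>UNIV. Poly_Mapping.lookup m i)" using F by (simp add: ternary_form_def)
  show "c (Poly_Mapping.lookup F m) * (\<Prod>i\<in>UNIV. (y * w i) ^ Poly_Mapping.lookup m i) =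
    y ^ d * (c (Poly_Mapping.lookup F m) * (\<Prod>i\<in>UNIV. w i ^ Poly_Mapping.lookup m i))"
    unfolding d by (simp add: power_mult_distrib prod.distrib power_sum mult_ac)
qed

text \<open>\<open>L\<close> is the change of coordinates x e + y b1 + z b2 in the chart y = 1,
  where the identity is substitution of a homomorphism. Homogeneity gives y \<noteq> 0, and a limit
  gives y = 0.\<close>

lemma hpoly_psubst:
  fixes e b1 b2 :: "3 \<Rightarrow> real" and x y z :: complex
  defines "L \<equiv> \<lambda>i. [:[:b1 i, b2 i:], [:e i:]:]"
  assumes F: "ternary_form d F" and g: "monic_form d (smult [:r:] (psubst (\<lambda>a. [:[:a:]:]) L F))"
  shows "poly (hpoly d (smult [:r:] (psubst (\<lambda>a. [:[:a:]:]) L F)) y z) x =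
    r * psubst complex_of_real (\<lambda>i. x * e i + y * b1 i + z * b2 i) F"
proof -
  let ?g = "smult [:r:] (psubst (\<lambda>a. [:[:a:]:]) L F)"
  let ?P = "\<lambda>(y::complex) (z::complex) (x::complex). psubst complex_of_real (\<lambda>i. x * e i + y * b1 i + z * b2 i) F"
  interpret r: map_poly_comm_ring_hom complex_of_real ..
  interpret rr: map_poly_comm_ring_hom "map_poly complex_of_real" ..
  have at1: "poly (hpoly d ?g 1 z) x = r * ?P 1 z x" for z x :: complex
  proof -
    interpret ev: comm_ring_hom "\<lambda>f. poly (map_poly (\<lambda>p. poly p z) f) x" by (rule poly_eval_hom)
    let ?h = "\<lambda>f. poly (map_poly (\<lambda>p. poly p z) (map_poly (map_poly complex_of_real) f)) x"
    interpret h: comm_ring_hom ?h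
      by unfold_locales (simp_all add: rr.hom_add rr.hom_mult ev.hom_add ev.hom_mult)
    have c: "?h [:[:a:]:] = of_real a" for a
      by (simp add: map_poly_constant)
    have L: "?h (L i) = x * e i + (1::complex) * b1 i + z * b2 i" for i
      by (simp add: L_def map_poly_linear map_poly_constant)
    have "poly (hpoly d ?g 1 z) x = ?h ([:[:r:]:] * psubst (\<lambda>a. [:[:a:]:]) L F)"
      unfolding poly_hpoly_1[OF g] by simp
    also have "\<dots> = r * psubst (\<lambda>a. ?h [:[:a:]:]) (\<lambda>i. ?h (L i)) F"
      unfolding h.hom_mult c by (subst psubst_hom[OF h.comm_semiring_hom_axioms]) (simp only: c)
    finally show ?thesis unfolding c L .
  qed
  have scaled: "poly (hpoly d ?g y z) x = r * ?P y z x" if "y \<noteq> 0" for y :: complex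
  proof -
    have "poly (hpoly d ?g y z) x = y ^ d * poly (hpoly d ?g 1 (z / y)) (x / y)"
      using poly_hpoly_homogeneous(1)[OF g, of y 1 "z / y" "x / y"] that by simp
    also have "\<dots> = r * (y ^ d * ?P 1 (z / y) (x / y))" unfolding at1 by simp
    also have "y ^ d * ?P 1 (z / y) (x / y) = ?P y z x"
      unfolding psubst_homogeneous[OF F, symmetric]
      by (intro arg_cong[of _ _ "\<lambda>w. psubst _ w F"] ext) (use that in \<open>simp add: distrib_left\<close>)
    finally show ?thesis .
  qed
  show ?thesis
  proof (cases "y = 0")
    case True
    have 1: "((\<lambda>y. poly (hpoly d ?g y z) x) \<longlongrightarrow> poly (hpoly d ?g 0 z) x) (at 0)"
      unfolding poly_hpoly by (intro tendsto_intros)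
    have 2: "((\<lambda>y. r * ?P y z x) \<longlongrightarrow> r * ?P 0 z x) (at 0)"
      unfolding psubst_def by (intro tendsto_intros)
    have 3: "\<forall>\<^sub>F y in at 0. r * ?P y z x = poly (hpoly d ?g y z) x"
      unfolding eventually_at_filter by (intro always_eventually allI impI scaled[symmetric])
    show ?thesis
      unfolding True by (rule tendsto_unique[OF _ 1 Lim_transform_eventually[OF 2 3]]) simp
  qed (rule scaled)
qed

lemma pencil_eval:
  assumes "A \<in> carrier_mat d d" "B \<in> carrier_mat d d" "C \<in> carrier_mat d d"
  shows "peval (Determinant.det (pencil A B C)) v = Determinant.det (pencil_at A B C v)"
proof -
  interpret comm_ring_hom "\<lambda>F. peval F v" by (rule peval_hom)
  have "map_mat (\<lambda>F. peval F v) (pencil A B C) = pencil_at A B C v"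
    unfolding pencil_def pencil_at_def
    by (rule eq_matI) (use assms in \<open>auto simp: hom_add hom_mult peval_PVar peval_PConst\<close>)
  then show ?thesis by (simp flip: hom_det)
qed

theorem theorem1:
  fixes F :: ternary_poly and d :: nat and e :: "real^3"
  assumes "d \<ge> 1"
    and "ternary_form d F"
    and "hyperbolic F e"
  shows "\<exists>A B C. det_representation d F A B C \<and> definite_at A B C e"
proof -
  define c where "c = peval F e"
  have c: "c > 0" using assms(3) by (simp add: c_def hyperbolic_def)
  \<comment> \<open>A form of degree at least one vanishes at the origin, while F(e) > 0.\<close>
  have "\<exists>i0. e $ i0 \<noteq> 0"
  proof (rule ccontr)
    assume "\<not> ?thesis"
    then have "peval F e = psubst (\<lambda>c. c) (\<lambda>i. 0 * e $ i) F"
      unfolding peval_def by (intro arg_cong[of _ _ "\<lambda>x. psubst _ x F"] ext) simp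
    then have "c = 0" unfolding psubst_homogeneous[OF assms(2)] using assms(1) by (simp add: c_def)
    then show False using c by simp
  qed
  then obtain i0 where i0: "e $ i0 \<noteq> 0" by blast
  \<comment> \<open>Since coordinate \<open>i0\<close> of \<open>e\<close> is nonzero,
    \<open>e\<close> and the unit vectors at \<open>i1\<close> and \<open>i2\<close> form a basis,
    the new coordinate system.\<close>
  obtain i1 i2 :: 3 where i: "UNIV = {i0, i1, i2}" "i0 \<noteq> i1" "i0 \<noteq> i2" "i1 \<noteq> i2"
  proof -
    consider "i0 = 1" | "i0 = 2" | "i0 = 3" using exhaust_3 by blast
    then show thesis
      using that[of 2 3] that[of 1 3] that[of 1 2] UNIV_3 by cases auto
  qed
  have cases3: "P i" if "P i0" "P i1" "P i2" for P and i :: 3 using i(1) that by (metis UNIV_I empty_iff insert_iff)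
  define b1 b2 :: "3 \<Rightarrow> real" where "b1 i = (if i = i1 then 1 else 0)" and "b2 i = (if i = i2 then 1 else 0)" for i
  define L where "L = (\<lambda>i. [:[:b1 i, b2 i:], [:e $ i:]:])"
  \<comment> \<open>F in the new coordinates, divided by its value at \<open>e\<close>, which is the
    coefficient of x^d; the quotient is monic.\<close>
  define g where "g = smult [:1 / c:] (psubst (\<lambda>a. [:[:a:]:]) L F)"
  have L: "total_degree_le 1 (L i)" "cf (L i) 1 0 = e $ i" for i
    by (auto simp: L_def total_degree_le_def coeff_pCons split: nat.split)
  have g: "monic_form d g"
  proof -
    have "cf (psubst (\<lambda>a. [:[:a:]:]) L F) d 0 = c"
      using psubst_linear_forms(2)[OF assms(2) L(1)] by (simp add: L(2)[unfolded One_nat_def] c_def peval_def)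
    then show ?thesis
      using psubst_linear_forms(1)[OF assms(2) L(1)] c
      unfolding monic_form_iff g_def total_degree_le_def by simp
  qed
  have ev: "poly (hpoly d g y z) x = complex_of_real (1 / c) * psubst complex_of_real (\<lambda>i. x * e $ i + y * b1 i + z * b2 i) F" for x y z :: complex
    using hpoly_psubst[OF assms(2), of "1 / c" b1 b2 "vec_nth e" y z x] g unfolding g_def L_def by simp
  have "hyperbolic_form d g"
    unfolding hyperbolic_form_def
  proof (intro allI impI)
    fix y z :: real and x :: complex
    assume "poly (hpoly d g (of_real y) (of_real z)) x = 0"
    then have z: "psubst complex_of_real (\<lambda>i. x * e $ i + of_real y * b1 i + of_real z * b2 i) F = 0"
      unfolding ev using c by simp
    \<comment> \<open>The line T e - a then passes through x e + y b1 + z b2 at T = x, so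
      hyperbolicity of F along it says that x is real.\<close>
    define a :: "real^3" where "a = (\<chi> i. - (y * b1 i + z * b2 i))"
    interpret r: map_poly_comm_ring_hom complex_of_real ..
    let ?h = "\<lambda>p. poly (map_poly complex_of_real p) x"
    interpret h: comm_ring_hom ?h
      by unfold_locales (simp_all add: r.hom_add r.hom_mult)
    have "?h (line_restriction F e a) = psubst (\<lambda>c. ?h [:c:]) (\<lambda>i. ?h [:- a $ i, e $ i:]) F"
      unfolding line_restriction_def by (rule psubst_hom[OF h.comm_semiring_hom_axioms])
    also have "\<dots> = psubst complex_of_real (\<lambda>i. x * e $ i + of_real y * b1 i + of_real z * b2 i) F"
      by (simp add: map_poly_linear map_poly_constant a_def algebra_simps)
    finally have "?h (line_restriction F e a) = 0" using z by simp
    then have "x \<in> \<real>" using assms(3) unfolding hyperbolic_def only_real_roots_def by blast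
    then show "Im x = 0" by (simp add: complex_is_Real_iff)
  qed
  from sym_representable_if_hyperbolic[OF assms(1) g this]
  obtain D C where D: "\<And>i j. D i j = D j i" and C: "\<And>i j. C i j = C j i" and gD: "g = Det d (lin D C)"
    unfolding sym_representable_def by blast
  \<comment> \<open>The factor F(e) has to be put back into the matrix; as the determinant scales
    with the power \<open>d\<close>, each entry receives the positive root of that order.\<close>
  define kap where "kap = root d c"
  have kap: "kap > 0" "kap ^ d = c" using c assms(1) by (auto simp: kap_def)
  \<comment> \<open>The coordinates of \<open>v\<close> in the basis of \<open>e\<close> and the
    unit vectors at \<open>i1\<close> and \<open>i2\<close>.\<close>
  define X Y Z where "X v = v $ i0 / e $ i0" and "Y v = v $ i1 - X v * e $ i1" and "Z v = v $ i2 - X v * e $ i2" for v :: "real^3"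
  have coord: "v $ i = X v * e $ i + Y v * b1 i + Z v * b2 i" for v i
    by (rule cases3[of "\<lambda>i. v $ i = X v * e $ i + Y v * b1 i + Z v * b2 i"])
       (use i i0 in \<open>auto simp: X_def Y_def Z_def b1_def b2_def\<close>)
  define M where "M v = (\<lambda>k l. kap * ((if k = l then X v else 0) + Y v * D k l + Z v * C k l))" for v
  have FM: "peval F v = Det d (M v)" for v
  proof -
    have "complex_of_real (peval F v) = psubst complex_of_real (\<lambda>i. complex_of_real (v $ i)) F"
      unfolding peval_def by (rule psubst_hom[OF of_real_hom.comm_semiring_hom_axioms])
    also have "\<dots> = psubst complex_of_real (\<lambda>i. of_real (X v) * e $ i + of_real (Y v) * b1 i + of_real (Z v) * b2 i) F"
      by (subst coord) simp
    also have "\<dots> = of_real c * poly (hpoly d g (of_real (Y v)) (of_real (Z v))) (of_real (X v))"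
      unfolding ev using c by simp
    also have "\<dots> = of_real c * Det d (\<lambda>k l. complex_of_real ((if k = l then X v else 0) + Y v * D k l + Z v * C k l))"
      unfolding gD poly_hpoly_Det by (intro arg_cong2[of _ _ _ _ "(*)"] refl Det_cong) simp
    also have "\<dots> = complex_of_real (c * Det d (\<lambda>k l. (if k = l then X v else 0) + Y v * D k l + Z v * C k l))"
      by (simp only: of_real_hom.hom_Det[symmetric] of_real_mult)
    also have "c * Det d (\<lambda>k l. (if k = l then X v else 0) + Y v * D k l + Z v * C k l) = Det d (M v)"
      unfolding M_def Det_smult kap(2) ..
    finally show ?thesis by (simp only: of_real_eq_iff)
  qed
  \<comment> \<open>\<open>M\<close> is linear in \<open>v\<close>, so its values at the three unit
    vectors are the coefficient matrices in the original variables.\<close>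
  define N where "N j = Matrix.mat d d (\<lambda>(k, l). M (axis j 1) k l)" for j
  have N: "N j \<in> carrier_mat d d" for j by (simp add: N_def)
  let ?P = "pencil_at (N 1) (N 2) (N 3)"
  have pen: "?P v = Matrix.mat d d (\<lambda>(k, l). M v k l)" for v
  proof (rule eq_matI)
    fix k l assume "k < dim_row (Matrix.mat d d (\<lambda>(k, l). M v k l))" "l < dim_col (Matrix.mat d d (\<lambda>(k, l). M v k l))"
    then have kl: "k < d" "l < d" by auto
    have v: "v = (\<Sum>j\<in>UNIV. v $ j *\<^sub>R axis j 1)"
      using basis_expansion[of v] by (simp add: scalar_mult_eq_scaleR)
    have lin: "linear X" "linear Y" "linear Z"
      unfolding X_def Y_def Z_def by (intro linearI; simp add: field_simps add_divide_distrib)+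
    have XYZ: "X v = (\<Sum>j\<in>UNIV. v $ j * X (axis j 1))" "Y v = (\<Sum>j\<in>UNIV. v $ j * Y (axis j 1))" "Z v = (\<Sum>j\<in>UNIV. v $ j * Z (axis j 1))"
      by (subst (1) v, simp add: linear_sum[OF lin(1)] linear_sum[OF lin(2)] linear_sum[OF lin(3)] linear_cmul[OF lin(1)] linear_cmul[OF lin(2)] linear_cmul[OF lin(3)])+
    have "?P v $$ (k, l) = (\<Sum>j\<in>UNIV. v $ j * M (axis j 1) k l)"
      using kl by (simp add: pencil_at_def N_def sum_3)
    also have "\<dots> = M v k l"
      unfolding M_def XYZ
      by (simp add: sum_distrib_left sum_distrib_right sum.distrib[symmetric] distrib_left mult_ac cong: sum.cong)
    finally show "?P v $$ (k, l) = Matrix.mat d d (\<lambda>(k, l). M v k l) $$ (k, l)"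
      using kl by simp
  qed (auto simp: pencil_at_def N_def)
  have "det_representation d F (N 1) (N 2) (N 3)"
    unfolding det_representation_def
  proof (intro conjI N ternary_poly_eqI)
    show "peval F v = peval (Determinant.det (pencil (N 1) (N 2) (N 3))) v" for v
      unfolding pencil_eval[OF N N N] pen FM Det_def ..
  qed
  moreover have "definite_at (N 1) (N 2) (N 3) e"
  proof -
    have M_sym: "M v k l = M v l k" for v k l
      unfolding M_def using D[of k l] C[of k l] by simp
    have sym: "sym_mat (Matrix.mat d d (\<lambda>(k, l). M v k l))" for v
      unfolding sym_mat_def by (rule eq_matI) (auto simp: M_sym)
    \<comment> \<open>At \<open>e\<close> the new coordinates are (1,0,0), so the pencil is
      \<open>kap\<close> times the identity.\<close>
    have Me: "M e k l = (if k = l then kap else 0)" for k l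
      using i0 by (simp add: M_def X_def Y_def Z_def)
    have "pos_definite (?P e)"
      unfolding pos_definite_def
    proof (intro conjI ballI impI)
      show "sym_mat (?P e)" unfolding pen by (rule sym)
      fix v :: "real Matrix.vec" assume "v \<in> carrier_vec (dim_row (?P e))"
        and "v \<noteq> 0\<^sub>v (dim_row (?P e))"
      then have v: "v \<in> carrier_vec d" "v \<noteq> 0\<^sub>v d" unfolding pen by auto
      have "?P e *\<^sub>v v = kap \<cdot>\<^sub>v v"
        unfolding pen
      proof (rule eq_vecI)
        fix k assume "k < dim_vec (kap \<cdot>\<^sub>v v)"
        then have k: "k < d" using v by simp
        have "(Matrix.mat d d (\<lambda>(k, l). M e k l) *\<^sub>v v) $ k = (\<Sum>l = 0..<d. (if k = l then kap else 0) * v $ l)"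
          using k v(1) by (simp add: scalar_prod_def Me)
        also have "\<dots> = (\<Sum>l = 0..<d. if l = k then kap * v $ k else 0)"
          by (intro sum.cong) auto
        also have "\<dots> = (kap \<cdot>\<^sub>v v) $ k" using k v(1) by simp
        finally show "(Matrix.mat d d (\<lambda>(k, l). M e k l) *\<^sub>v v) $ k = (kap \<cdot>\<^sub>v v) $ k" .
      qed (use v in simp)
      then have "scalar_prod v (?P e *\<^sub>v v) = kap * (\<Sum>k\<in>{0..<d}. (v $ k)\<^sup>2)"
        using v(1) by (simp add: scalar_prod_def sum_distrib_left power2_eq_square mult_ac)
      moreover have "(\<Sum>k\<in>{0..<d}. (v $ k)\<^sup>2) > 0"
      proof -
        obtain k where "k < d" "v $ k \<noteq> 0" using v by (metis carrier_vecD eq_vecI index_zero_vec)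
        then show ?thesis by (intro sum_pos2[of _ k]) auto
      qed
      ultimately show "scalar_prod v (?P e *\<^sub>v v) > 0" using kap by simp
    qed
    then show ?thesis unfolding definite_at_def by (simp add: N_def sym)
  qed
  ultimately show ?thesis by blast
qed

end
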